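(* Let $\kappa\in(0,1]$, $\alpha>3$ and $\gamma\in[0,\alpha-3)$. Define $$c_4=c_4(\kappa,\alpha,\gamma)=\min\left\{\frac{2\log2}{3e^{\sqrt2\,\frac{\alpha-\gamma-1}{\alpha-\gamma-3}}}\,\kappa,\ \frac1{16}\right\},\qquad c_3=\frac{c_4}{\log2},\qquad \overline W_0=\overline W_0(\kappa,\alpha,\gamma)=-\frac1{2c_4}\log\frac\kappa{36}.$$ Then for all $\overline W\ge\overline W_0$ the following holds for the inhomogeneous one-dimensional model on $[N]=\{1,\dots,N\}$, $N\in\mathbb N$, with nearest-neighbor weights $W_{\{i-1,i\}}\ge\overline Wi^\alpha$, $2\le i\le N$, arbitrary weights $W_e\ge0$ on non-nearest-neighbor edges, and pinning of type P1 or P2 (see context). Let $E',E''$ be disjoint subsets of $\{\{x,y\}\subseteq[N]:x\ne y\}$. For an edge $e$ write $e=\{x_e,y_e\}$ with $x_e<y_e$. Assume that every $e\in E'$ is a nearest-neighbor edge, $y_e-x_e=1$, and that for any two different $e,\tilde e\in E'\cup E''$ the open intervals $(x_e,y_e)$ and $(x_{\tilde e},y_{\tilde e})$ are disjoint. Set $m_x:=c_3\overline Wx^\gamma$ for $x\in\mathbb N$. Then for all exponents $m_e$ with $0\le m_e<W_e$ for $e\in E'$ and $0\le m_e\le m_{x_e}$ for $e\in E''$, $$\mathbb E^{[N]}_{W,h}\Big[\prod_{e\in E'}B_e^{m_e}\cdot\prod_{e\in E''}B_e^{m_e}\Big]\le\prod_{e\in E'}\frac1{1-\frac{m_e}{W_e}}\cdot(1+\kappa)^{|E''|}\le(1+\kappa)^{|E'|+|E''|},$$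 uniformly in $N$. In particular, for all $e=\{x,y\}$ with $x,y\in[N]$, $x<y$, and all $m\in[0,m_x]$, $$\mathbb E^{[N]}_{W,h}\big[(\cosh(u_x-u_y))^m\big]\le\mathbb E^{[N]}_{W,h}[B_e^m]\le1+\kappa .$$ In the case P1 of pinning, all estimates are also uniform in the pinning $h$. Moreover, in the case $\gamma=0$ and $\kappa=1$ one has $$\overline W_0=\max\left\{16\log6,\ \tfrac32\,e^{\sqrt2\,\frac{\alpha-1}{\alpha-3}}\log_26\right\}.$$
   Context: General model. Let $\Lambda$ be a finite non-empty set, $\rho\notin\Lambda$ (the pinning vertex), and let $E$ be the set of all two-element subsets of $\Lambda\cup\{\rho\}$. Let $W_e\ge0$, $e\in E$, be weights ($W_{ij}:=W_{\{i,j\}}$); $h_i:=W_{i\rho}$, $i\in\Lambda$, are the pinning strengths. Let $E_+=\{e\in E:W_e>0\}$ and assume $(\Lambda\cup\{\rho\},E_+)$ is connected. For $(u,s)\in\mathbb R^\Lambda\times\mathbb R^\Lambda$ set $u_\rho=s_\rho=0$ and, for $e=\{i,j\}\in E$, $$B_e=B_{ij}=\cosh(u_i-u_j)+\tfrac12(s_i-s_j)^2e^{u_i+u_j}.$$ Let $D=(D_{ij})_{i,j\in\Lambda}$ with $D_{ij}=-W_{ij}e^{u_i+u_j}$ for $i\ne j$ and $D_{ii}=\sum_{k\in(\Lambda\cup\{\rho\})\setminus\{i\}}W_{ik}e^{u_i+u_k}$. Then $$\mu(du\,ds)=e^{-\sum_{e\in E_+}W_e(B_e-1)}\det D\prod_{i\in\Lambda}\frac{e^{-u_i}}{2\pi}\,du_i\,ds_i$$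 is a probability measure on $\mathbb R^\Lambda\times\mathbb R^\Lambda$ (known fact). Expectation with respect to it is written $\mathbb E^{\Lambda}_{W,h}$ or $\mathbb E^{\Lambda\cup\{\rho\}}_{W,h}$. Inhomogeneous one-dimensional model. The vertices are $[N]=\{1,\dots,N\}$; nearest-neighbor edges $\{i-1,i\}$, $2\le i\le N$, carry weights $W_{\{i-1,i\}}\ge\overline Wi^\alpha$. Two versions of pinning are allowed: P1: $\rho\notin[N]$, $\Lambda=[N]$, with any pinning vector $h\in[0,\infty)^N\setminus\{0\}$, $W_{j\rho}=h_j$. P2: $\rho$ is one of the vertices of $[N]$ (e.g. $\rho=N$), $\Lambda=[N]\setminus\{\rho\}$, and $h_j=W_{j\rho}$ for $j\in[N]\setminus\{\rho\}$. In both cases expectation is denoted $\mathbb E^{[N]}_{W,h}$.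
   Formalization: The second inequality, ≤ (1+κ)^{|E'|+|E''|}, fails for general 0≤m_e<W_e on E' (one edge, m_e=0.9W_e gives 10>1+κ); it is proved under the extra assumption m_e≤m_{x_e} for e∈E'. The first inequality is proved in full. *)

theory Defs
  imports "HOL-Probability.Probability" "HOL-Combinatorics.Permutations"
begin

section \<open>The general model\<close>

definition edges :: "'v set \<Rightarrow> 'v set set" where
  "edges V = {{i, j} | i j. i \<in> V \<and> j \<in> V \<and> i \<noteq> j}"

definition positive_edges :: "'v set \<Rightarrow> 'v \<Rightarrow> ('v set \<Rightarrow> real) \<Rightarrow> 'v set set" where
  "positive_edges \<Lambda> \<rho> W = {e \<in> edges (insert \<rho> \<Lambda>). W e > 0}"

text \<open>
  Fields on \<open>\<Lambda>\<close> are points of the product space \<open>Pi\<^sub>M \<Lambda> (\<lambda>_. lborel)\<close>, hence equal to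
  \<open>undefined\<close> off \<open>\<Lambda>\<close>. The following extension implements the convention
  \<open>u\<^sub>\<rho> = s\<^sub>\<rho> = 0\<close> at the pinning vertex \<open>\<rho>\<close>, which never lies in \<open>\<Lambda>\<close>.
\<close>

definition pinned :: "'v set \<Rightarrow> ('v \<Rightarrow> real) \<Rightarrow> 'v \<Rightarrow> real" where
  "pinned \<Lambda> u i = (if i \<in> \<Lambda> then u i else 0)"

definition B_pair :: "('v \<Rightarrow> real) \<Rightarrow> ('v \<Rightarrow> real) \<Rightarrow> 'v \<Rightarrow> 'v \<Rightarrow> real" where
  "B_pair u s i j = cosh (u i - u j) + (s i - s j)\<^sup>2 * exp (u i + u j) / 2"

text \<open>
  For an edge \<open>e\<close>, \<open>x\<^sub>e = Min e\<close> and \<open>y\<^sub>e = Max e\<close>. The order of the end points is immaterial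
  for \<open>B\<^sub>e\<close>, see \<open>B_edge_pair\<close> below.
\<close>

definition B_edge :: "'v::linorder set \<Rightarrow> ('v \<Rightarrow> real) \<Rightarrow> ('v \<Rightarrow> real) \<Rightarrow> 'v set \<Rightarrow> real" where
  "B_edge \<Lambda> u s e = B_pair (pinned \<Lambda> u) (pinned \<Lambda> s) (Min e) (Max e)"

lemma B_pair_commute: "B_pair u s i j = B_pair u s j i"
  by (simp add: B_pair_def power2_commute[of "s i"] add.commute[of "u i"] flip: cosh_minus[of "u i - u j"])

lemma B_edge_pair: "B_edge \<Lambda> u s {i, j} = B_pair (pinned \<Lambda> u) (pinned \<Lambda> s) i j"
  by (cases "i \<le> j") (auto simp: B_edge_def min_def max_def B_pair_commute)

text \<open>
  The index set of the matrix is a set and not a type, so the determinant is given by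
  the Leibniz formula over the permutations of that set.
\<close>

definition det_on :: "'v set \<Rightarrow> ('v \<Rightarrow> 'v \<Rightarrow> real) \<Rightarrow> real" where
  "det_on I A = (\<Sum>p | p permutes I. of_int (sign p) * (\<Prod>i\<in>I. A i (p i)))"

lemma det_on_UNIV: "det_on UNIV A = det (\<chi> i j. A i j)"
  by (simp add: det_on_def det_def)

definition D_matrix ::
    "'v set \<Rightarrow> 'v \<Rightarrow> ('v set \<Rightarrow> real) \<Rightarrow> ('v \<Rightarrow> real) \<Rightarrow> 'v \<Rightarrow> 'v \<Rightarrow> real" where
  "D_matrix \<Lambda> \<rho> W u i j =
     (if i = j
      then \<Sum>k\<in>insert \<rho> \<Lambda> - {i}. W {i, k} * exp (pinned \<Lambda> u i + pinned \<Lambda> u k)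
      else - W {i, j} * exp (pinned \<Lambda> u i + pinned \<Lambda> u j))"

definition sigma_density ::
    "'v::linorder set \<Rightarrow> 'v \<Rightarrow> ('v set \<Rightarrow> real) \<Rightarrow> ('v \<Rightarrow> real) \<Rightarrow> ('v \<Rightarrow> real) \<Rightarrow> real" where
  "sigma_density \<Lambda> \<rho> W u s =
     exp (- (\<Sum>e\<in>positive_edges \<Lambda> \<rho> W. W e * (B_edge \<Lambda> u s e - 1))) *
     det_on \<Lambda> (D_matrix \<Lambda> \<rho> W u) *
     (\<Prod>i\<in>\<Lambda>. exp (- u i) / (2 * pi))"

definition sigma_measure ::
    "'v::linorder set \<Rightarrow> 'v \<Rightarrow> ('v set \<Rightarrow> real) \<Rightarrow> (('v \<Rightarrow> real) \<times> ('v \<Rightarrow> real)) measure" where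
  "sigma_measure \<Lambda> \<rho> W =
     density (Pi\<^sub>M \<Lambda> (\<lambda>_. lborel) \<Otimes>\<^sub>M Pi\<^sub>M \<Lambda> (\<lambda>_. lborel))
       (\<lambda>(u, s). ennreal (sigma_density \<Lambda> \<rho> W u s))"


section \<open>The inhomogeneous one-dimensional model\<close>

text \<open>
  The pinning strengths are part of \<open>W\<close>: \<open>h\<^sub>j = W {j, \<rho>}\<close>.
\<close>

definition pinning_P1 :: "nat \<Rightarrow> nat set \<Rightarrow> nat \<Rightarrow> (nat set \<Rightarrow> real) \<Rightarrow> bool" where
  "pinning_P1 N \<Lambda> \<rho> W \<longleftrightarrow> \<rho> \<notin> {1..N} \<and> \<Lambda> = {1..N} \<and> (\<exists>j\<in>{1..N}. W {j, \<rho>} \<noteq> 0)"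

definition pinning_P2 :: "nat \<Rightarrow> nat set \<Rightarrow> nat \<Rightarrow> bool" where
  "pinning_P2 N \<Lambda> \<rho> \<longleftrightarrow> \<rho> \<in> {1..N} \<and> \<Lambda> = {1..N} - {\<rho>} \<and> \<Lambda> \<noteq> {}"

text \<open>
  For \<open>Wbar > 0\<close> these conditions force the graph of positive edges on \<open>\<Lambda> \<union> {\<rho>}\<close> to be
  connected, so connectedness is not listed.
\<close>

definition inhomogeneous_model ::
    "real \<Rightarrow> real \<Rightarrow> nat \<Rightarrow> nat set \<Rightarrow> nat \<Rightarrow> (nat set \<Rightarrow> real) \<Rightarrow> bool" where
  "inhomogeneous_model \<alpha> Wbar N \<Lambda> \<rho> W \<longleftrightarrow>
     (\<forall>e\<in>edges (insert \<rho> \<Lambda>). W e \<ge> 0) \<and>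
     (\<forall>i\<in>{2..N}. W {i - 1, i} \<ge> Wbar * real i powr \<alpha>) \<and>
     (pinning_P1 N \<Lambda> \<rho> W \<or> pinning_P2 N \<Lambda> \<rho>)"

definition c4 :: "real \<Rightarrow> real \<Rightarrow> real \<Rightarrow> real" where
  "c4 \<kappa> \<alpha> \<gamma> = min (2 * ln 2 / (3 * exp (sqrt 2 * ((\<alpha> - \<gamma> - 1) / (\<alpha> - \<gamma> - 3)))) * \<kappa>) (1 / 16)"

definition c3 :: "real \<Rightarrow> real \<Rightarrow> real \<Rightarrow> real" where
  "c3 \<kappa> \<alpha> \<gamma> = c4 \<kappa> \<alpha> \<gamma> / ln 2"

definition Wbar0 :: "real \<Rightarrow> real \<Rightarrow> real \<Rightarrow> real" where
  "Wbar0 \<kappa> \<alpha> \<gamma> = - (1 / (2 * c4 \<kappa> \<alpha> \<gamma>)) * ln (\<kappa> / 36)"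

definition m_vertex :: "real \<Rightarrow> real \<Rightarrow> real \<Rightarrow> real \<Rightarrow> nat \<Rightarrow> real" where
  "m_vertex \<kappa> \<alpha> \<gamma> Wbar x = c3 \<kappa> \<alpha> \<gamma> * Wbar * real x powr \<gamma>"

text \<open>
  The intervals are taken in the reals: in the natural numbers, the open interval of a
  nearest-neighbour edge would be empty.
\<close>

definition admissible_edges :: "nat \<Rightarrow> nat set set \<Rightarrow> nat set set \<Rightarrow> bool" where
  "admissible_edges N E' E'' \<longleftrightarrow>
     E' \<subseteq> edges {1..N} \<and> E'' \<subseteq> edges {1..N} \<and> E' \<inter> E'' = {} \<and>
     (\<forall>e\<in>E'. Max e = Min e + 1) \<and>
     (\<forall>e\<in>E' \<union> E''. \<forall>f\<in>E' \<union> E''. e \<noteq> f \<longrightarrow>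
        {real (Min e)<..<real (Max e)} \<inter> {real (Min f)<..<real (Max f)} = {})"

end

theory Submission
  imports Defs "HOL-Real_Asymp.Real_Asymp"
begin

text \<open>
  Normalisation comes from integrating out one vertex \<open>n\<close> at a time. The integral over \<open>s\<^sub>n\<close> is Gaussian;
  with \<open>r = u\<^sub>n - ln (\<Sum>\<^sub>k W\<^sub>n\<^sub>k e\<^bsup>u\<^sub>k\<^esup>)\<close> the star-mesh transformation leaves the model on the remaining vertices with
  weights \<open>W\<^sub>i\<^sub>j + e\<^sup>r W\<^sub>n\<^sub>i W\<^sub>n\<^sub>j\<close>, mixed over \<open>r\<close> with a probability kernel. The determinant being affine in every
  conductance, linear combinations of \<open>exp (- W\<^sub>e B\<^sub>e)\<close> and a density argument yield the Ward identity
  for arbitrary functions \<open>f\<^sub>e (B\<^sub>e)\<close>, where the conductances are given by \<open>- f\<^sub>e' / f\<^sub>e\<close>.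

  For \<open>f\<^sub>e (b) = exp (- W\<^sub>e (b - 1)) b\<^bsup>m\<^sub>e\<^esup>\<close> times a nonincreasing cutoff these are at least \<open>W\<^sub>e - m\<^sub>e / B\<^sub>e\<close>.
  Lowering a conductance by \<open>m\<^sub>e / B\<^sub>e\<close> costs a bounded factor as long as a path between the end points
  compensates for it. A nearest-neighbour edge compensates for itself, and a long edge \<open>{x, y}\<close> is
  compensated for by the path from \<open>x\<close> to \<open>y\<close> if \<open>B < 1 + i\<^bsup>-(\<alpha> - \<gamma> - 1)\<^esup>\<close> holds on all edges \<open>{i, i + 1}\<close> of it, since
  then \<open>u\<close> has bounded variation there. If the inequality fails at \<open>i\<close>, one splits
  \<open>B\<^sub>x\<^sub>y \<le> 4 B\<^sub>x\<^sub>,\<^sub>i B\<^sub>i\<^sub>,\<^sub>i\<^sub>+\<^sub>1 B\<^sub>i\<^sub>+\<^sub>1\<^sub>,\<^sub>y\<close>, uses Markov's inequality with the exponent \<open>W\<^sub>i\<^sub>,\<^sub>i\<^sub>+\<^sub>1 / 2\<close> on the middle factor, and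
  proceeds by induction on the total length of the long edges.
\<close>

section \<open>Determinants of weighted Laplacians\<close>

text \<open>The threshold exponent \<alpha> - \<gamma> - 1 answers two demands. Its half must exceed
  1, so that the increments of \<open>u\<close> along a regular path, of order
  \<open>i powr (- \<xi>)\<close>, are summable; this is the condition \<gamma> < \<alpha> - 3.
  Multiplied by a weight of order \<open>i powr \<alpha>\<close>, the threshold must beat the
  exponents, of order \<open>i powr \<gamma>\<close>; it leaves
  \<open>i powr (\<gamma> + 1)\<close>, and the spare power makes the cost of an irregular edge
  decay geometrically in \<open>i\<close>. The bound 1 + \<kappa> for a long edge is a budget: 1 +
  \<kappa> / 2 for the regular path, \<kappa> / 2 for all irregular cases together. Lowered
  conductances may be negative, so positivity of determinants has to come from the Dirichlet form
  and not from the weights. Moments of \<open>B\<close> are not known to be finite in advance; hence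
  the compactly supported cutoffs, for which the Ward identity is exact, and Fatou's lemma when they
  are removed. Normalisation is shown for strictly positive weights on the complete graph; edges of
  weight 0 enter through the functions \<open>f\<close> of the Ward identity.\<close>

lemma det_on_cong:
  assumes "\<And>i j. i \<in> I \<Longrightarrow> j \<in> I \<Longrightarrow> A i j = B i j"
  shows "det_on I A = det_on I B"
  unfolding det_on_def
  by (intro sum.cong refl arg_cong2[where f = "(*)"] prod.cong) (auto simp: assms permutes_in_image)

lemma det_on_update_row:
  assumes "finite I" "i \<in> I"
  shows "det_on I (A(i := r)) =
    (\<Sum>p | p permutes I. of_int (sign p) * (r (p i) * (\<Prod>k\<in>I - {i}. A k (p k))))"
  unfolding det_on_def
  by (intro sum.cong refl arg_cong2[where f = "(*)"])
    (auto simp: prod.remove[OF assms] intro!: prod.cong)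

lemma det_on_row_linear:
  assumes "finite I" "i \<in> I"
  shows "det_on I (A(i := \<lambda>j. a j + x * b j)) = det_on I (A(i := a)) + x * det_on I (A(i := b))"
  unfolding det_on_update_row[OF assms]
  by (simp add: sum_distrib_left sum.distrib[symmetric] algebra_simps)

lemma det_on_identical_rows:
  assumes fin: "finite I" and ij: "i \<in> I" "j \<in> I" "i \<noteq> j" and eq: "A i = A j"
  shows "det_on I A = 0"
proof -
  define t where "t = Transposition.transpose i j"
  have t: "t permutes I" unfolding t_def by (rule permutes_swap_id[OF ij(1,2)])
  have eqt: "A (t k) = A k" for k using eq by (auto simp: t_def Transposition.transpose_def)
  have "det_on I A =
      (\<Sum>p | p permutes I. of_int (sign (p \<circ> t)) * (\<Prod>k\<in>I. A k ((p \<circ> t) k)))"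
    unfolding det_on_def by (rule sum_permutations_compose_right[OF t])
  also have "\<dots> = (\<Sum>p | p permutes I. - (of_int (sign p) * (\<Prod>k\<in>I. A k (p k))))"
  proof (rule sum.cong[OF refl], clarify)
    fix p assume p: "p permutes I"
    have "(\<Prod>k\<in>I. A k (p k)) = (\<Prod>k\<in>I. A (t k) (p (t k)))"
      using prod.permute[OF t, of "\<lambda>k. A k (p k)"] by (simp add: o_def)
    also have "\<dots> = (\<Prod>k\<in>I. A k ((p \<circ> t) k))" by (simp add: eqt)
    finally have "(\<Prod>k\<in>I. A k ((p \<circ> t) k)) = (\<Prod>k\<in>I. A k (p k))" by simp
    moreover have "sign (p \<circ> t) = - sign p"
      using p t fin ij by (subst sign_compose) (auto simp: t_def sign_swap_id permutes_imp_permutation)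
    ultimately show "of_int (sign (p \<circ> t)) * (\<Prod>k\<in>I. A k ((p \<circ> t) k)) =
        - (of_int (sign p) * (\<Prod>k\<in>I. A k (p k)))" by simp
  qed
  also have "\<dots> = - det_on I A" by (simp add: det_on_def sum_negf)
  finally show ?thesis by simp
qed

text \<open>Row \<open>n\<close> lies outside \<open>K\<close> and is never changed, so the rows of
  \<open>K\<close> can be treated one after the other; each step adds a determinant with two equal
  rows.\<close>

lemma det_on_add_row_multiples:
  assumes fin: "finite I" and n: "n \<in> I" "n \<notin> K" and K: "K \<subseteq> I"
  shows "det_on I (\<lambda>i. if i \<in> K then \<lambda>j. A i j + c i * A n j else A i) = det_on I A"
proof -
  have "finite K" using K fin finite_subset by auto
  then show ?thesis using n K
  proof (induction K)
    case empty
    then show ?case by simp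
  next
    case (insert i K)
    let ?B = "\<lambda>i. if i \<in> K then \<lambda>j. A i j + c i * A n j else A i"
    have "(\<lambda>k. if k \<in> insert i K then \<lambda>j. A k j + c k * A n j else A k) =
        ?B(i := \<lambda>j. A i j + c i * A n j)" using insert by (auto simp: fun_eq_iff)
    then have "det_on I (\<lambda>k. if k \<in> insert i K then \<lambda>j. A k j + c k * A n j else A k) =
        det_on I (?B(i := A i)) + c i * det_on I (?B(i := A n))"
      using det_on_row_linear[OF fin, of i ?B] insert by auto
    also have "det_on I (?B(i := A n)) = 0"
      by (rule det_on_identical_rows[OF fin, of i n]) (use insert in auto)
    also have "?B(i := A i) = ?B" using insert by auto
    finally show ?case using insert by simp
  qed
qed

text \<open>A permutation that moves \<open>n\<close> sends some other index to \<open>n\<close> and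
  meets a zero of the column, so only the permutations of \<open>I\<close> remain.\<close>

lemma det_on_insert_zero_column:
  assumes fin: "finite I" and n: "n \<notin> I" and zero: "\<And>i. i \<in> I \<Longrightarrow> A i n = 0"
  shows "det_on (insert n I) A = A n n * det_on I A"
proof -
  let ?f = "\<lambda>p. of_int (sign p) * (\<Prod>k\<in>insert n I. A k (p k)) :: real"
  have sub: "{p. p permutes I} \<subseteq> {p. p permutes (insert n I)}"
    by (auto intro: permutes_subset)
  have "?f p = 0" if p: "p permutes insert n I" "\<not> p permutes I" for p
  proof -
    have "p n \<noteq> n"
    proof
      assume "p n = n"
      then have "p permutes I"
        by (intro permutes_superset[OF p(1)]) auto
      with p show False by simp
    qed
    have "n \<in> p ` insert n I" using permutes_image[OF p(1)] by simp
    then obtain k where k: "k \<in> insert n I" "p k = n" by fastforce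
    with \<open>p n \<noteq> n\<close> have "k \<in> I" by auto
    then have "A k (p k) = 0" using zero k by auto
    then show ?thesis using \<open>k \<in> I\<close> fin by auto
  qed
  then have "det_on (insert n I) A = (\<Sum>p | p permutes I. ?f p)"
    unfolding det_on_def using sub fin
    by (intro sum.mono_neutral_right) (auto simp: finite_permutations)
  also have "\<dots> = (\<Sum>p | p permutes I. A n n * (of_int (sign p) * (\<Prod>k\<in>I. A k (p k))))"
    using fin n by (intro sum.cong refl) (auto simp: permutes_not_in)
  finally show ?thesis by (simp add: det_on_def sum_distrib_left)
qed

text \<open>Gaussian elimination: subtracting multiples of row \<open>n\<close> clears column
  \<open>n\<close> and leaves the Schur complement.\<close>

lemma det_on_Schur:
  assumes fin: "finite I" and n: "n \<notin> I" and nz: "A n n \<noteq> 0"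
  shows "det_on (insert n I) A = A n n * det_on I (\<lambda>i j. A i j - A i n * A n j / A n n)"
proof -
  let ?B = "\<lambda>i. if i \<in> I then \<lambda>j. A i j + (- A i n / A n n) * A n j else A i"
  have "det_on (insert n I) A = det_on (insert n I) ?B"
    by (rule det_on_add_row_multiples[symmetric]) (use assms in auto)
  also have "\<dots> = A n n * det_on I ?B"
    using det_on_insert_zero_column[OF fin n, of ?B] nz n by auto
  also have "det_on I ?B = det_on I (\<lambda>i j. A i j - A i n * A n j / A n n)"
    by (rule det_on_cong) auto
  finally show ?thesis .
qed

lemma det_on_zero_row:
  assumes "finite I" "i \<in> I" "\<And>j. j \<in> I \<Longrightarrow> A i j = 0"
  shows "det_on I A = 0"
  unfolding det_on_def
proof (rule sum.neutral, clarify)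
  fix p assume "p permutes I"
  then have "A i (p i) = 0" using assms permutes_in_image[of p I i] by auto
  then have "(\<Prod>k\<in>I. A k (p k)) = 0" using assms by auto
  then show "of_int (sign p) * (\<Prod>k\<in>I. A k (p k)) = 0" by simp
qed

section \<open>Grounded Laplacians, Dirichlet forms and the star-mesh transformation\<close>

definition laplacian :: "'v set \<Rightarrow> 'v \<Rightarrow> ('v set \<Rightarrow> real) \<Rightarrow> 'v \<Rightarrow> 'v \<Rightarrow> real" where
  "laplacian \<Lambda> \<rho> w i j = (if i = j then \<Sum>k\<in>insert \<rho> \<Lambda> - {i}. w {i, k} else - w {i, j})"

text \<open>The vertex \<rho> is grounded: its row and column are deleted, but edges to \<rho> still
  count in the diagonal. By the matrix-tree theorem this is the weighted sum over spanning
  trees.\<close>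

definition laplacian_det :: "'v set \<Rightarrow> 'v \<Rightarrow> ('v set \<Rightarrow> real) \<Rightarrow> real" where
  "laplacian_det \<Lambda> \<rho> w = det_on \<Lambda> (laplacian \<Lambda> \<rho> w)"

lemma doubleton_in_edges: "i \<in> V \<Longrightarrow> j \<in> V \<Longrightarrow> i \<noteq> j \<Longrightarrow> {i, j} \<in> edges V"
  by (auto simp: edges_def)

lemma finite_edges: "finite V \<Longrightarrow> finite (edges V)"
  by (rule finite_subset[of _ "Pow V"]) (auto simp: edges_def)

lemma laplacian_det_cong:
  assumes "\<And>e. e \<in> edges (insert \<rho> \<Lambda>) \<Longrightarrow> w e = w' e"
  shows "laplacian_det \<Lambda> \<rho> w = laplacian_det \<Lambda> \<rho> w'"
  unfolding laplacian_det_def laplacian_def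
  by (rule det_on_cong) (auto intro!: sum.cong assms doubleton_in_edges)

lemma sum_update_edge:
  assumes "finite S" "i \<notin> S" "j \<noteq> i"
  shows "(\<Sum>k\<in>S. (w({i, j} := z)) {i, k}) = (\<Sum>k\<in>S. (w({i, j} := 0)) {i, k}) + (if j \<in> S then z else (0::real))"
proof (cases "j \<in> S")
  case True
  have "(\<Sum>k\<in>S - {j}. (w({i, j} := z)) {i, k}) = (\<Sum>k\<in>S - {j}. (w({i, j} := 0)) {i, k})"
    by (rule sum.cong) (auto simp: doubleton_eq_iff)
  then show ?thesis using True assms by (simp add: sum.remove[of S j])
next
  case False
  then show ?thesis by (auto intro!: sum.cong simp: doubleton_eq_iff)
qed

text \<open>The edge {i, j} enters the matrix as \<open>z\<close> times the outer product of
  \<open>?v\<close> with itself. Expanding in the rows \<open>i\<close> and \<open>j\<close>, the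
  quadratic term has two equal rows and drops out. If \<open>j\<close> is \<rho>, only row
  \<open>i\<close> depends on \<open>z\<close>.\<close>

lemma laplacian_det_affine:
  assumes fin: "finite \<Lambda>" and \<rho>: "\<rho> \<notin> \<Lambda>" and e: "e \<in> edges (insert \<rho> \<Lambda>)"
  shows "\<exists>a b. \<forall>z. laplacian_det \<Lambda> \<rho> (w(e := z)) = a + z * b"
proof -
  have "\<exists>i j. e = {i, j} \<and> i \<in> \<Lambda> \<and> j \<in> insert \<rho> \<Lambda> \<and> i \<noteq> j"
    using e \<rho> unfolding edges_def by (auto simp: insert_commute)
  then obtain i j where ij: "e = {i, j}" "i \<in> \<Lambda>" "j \<in> insert \<rho> \<Lambda>" "i \<noteq> j" by blast
  let ?M = "laplacian \<Lambda> \<rho> (w(e := 0))"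
  let ?v = "\<lambda>k. if k = i then 1 else if k = j then -1 else 0 :: real"
  have other: "laplacian \<Lambda> \<rho> (w(e := z)) a b = ?M a b" if "a \<noteq> i" "a \<noteq> j" for a b z
  proof -
    have "{a, c} \<noteq> e" for c using that ij by auto
    then show ?thesis unfolding laplacian_def by (cases "a = b") auto
  qed
  have row_i: "laplacian \<Lambda> \<rho> (w(e := z)) i b = ?M i b + z * ?v b" for b z
  proof (cases "b = i")
    case True
    then show ?thesis using ij fin sum_update_edge[of "insert \<rho> \<Lambda> - {i}" i j w z]
      unfolding laplacian_def by simp
  next
    case False
    have "{i, b} = e \<longleftrightarrow> b = j" using ij(1,4) by (simp add: doubleton_eq_iff)
    then show ?thesis using False ij(4) unfolding laplacian_def by simp
  qed
  show ?thesis
  proof (cases "j = \<rho>")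
    case True
    have "laplacian_det \<Lambda> \<rho> (w(e := z)) = det_on \<Lambda> (?M(i := \<lambda>k. ?M i k + z * ?v k))" for z
      unfolding laplacian_det_def
    proof (rule det_on_cong)
      fix a b assume "a \<in> \<Lambda>"
      then have "a \<noteq> j" using True \<rho> by auto
      then show "laplacian \<Lambda> \<rho> (w(e := z)) a b = (?M(i := \<lambda>k. ?M i k + z * ?v k)) a b"
        using other[of a z b] row_i[of z b] by (cases "a = i") auto
    qed
    then show ?thesis
      using det_on_row_linear[OF fin ij(2), of ?M "?M i" _ ?v] by auto
  next
    case False
    with ij have j: "j \<in> \<Lambda>" by auto
    have e': "e = {j, i}" using ij by auto
    have row_j: "laplacian \<Lambda> \<rho> (w(e := z)) j b = ?M j b + (-z) * ?v b" for b z
    proof (cases "b = j")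
      case True
      then show ?thesis using ij(2,4) j fin sum_update_edge[of "insert \<rho> \<Lambda> - {j}" j i w z]
        unfolding laplacian_def e' by simp
    next
      case False
      have "{j, b} = e \<longleftrightarrow> b = i" using ij(1,4) by (auto simp: doubleton_eq_iff)
      then show ?thesis using False ij(4) unfolding laplacian_def by simp
    qed
    define D where "D r1 r2 = det_on \<Lambda> (?M(i := r1, j := r2))" for r1 r2
    have eq: "laplacian_det \<Lambda> \<rho> (w(e := z)) = D (\<lambda>k. ?M i k + z * ?v k) (\<lambda>k. ?M j k + (-z) * ?v k)" for z
      unfolding laplacian_det_def D_def
    proof (rule det_on_cong)
      fix a b
      show "laplacian \<Lambda> \<rho> (w(e := z)) a b =
         (?M(i := \<lambda>k. ?M i k + z * ?v k, j := \<lambda>k. ?M j k + (-z) * ?v k)) a b"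
        using other[of a z b] row_i[of z b] row_j[of z b] ij by (cases "a = i"; cases "a = j") auto
    qed
    have lin2: "D r (\<lambda>k. a k + x * b k) = D r a + x * D r b" for r a b x
      unfolding D_def by (rule det_on_row_linear[OF fin j])
    have D_comm: "D r1 r2 = det_on \<Lambda> (?M(j := r2, i := r1))" for r1 r2
      unfolding D_def using ij by (simp add: fun_upd_twist)
    have lin1: "D (\<lambda>k. a k + x * b k) r = D a r + x * D b r" for r a b x
      unfolding D_comm by (rule det_on_row_linear[OF fin ij(2)])
    have "D ?v ?v = 0" unfolding D_def by (rule det_on_identical_rows[OF fin ij(2) j]) (use ij in auto)
    then have "laplacian_det \<Lambda> \<rho> (w(e := z)) = D (?M i) (?M j) + z * (D ?v (?M j) - D (?M i) ?v)" for z
      unfolding eq lin1 lin2 by (simp add: algebra_simps)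
    then show ?thesis by blast
  qed
qed

lemma edges_insert: "edges (insert n V) = edges V \<union> (\<lambda>k. {n, k}) ` (V - {n})"
  unfolding edges_def by (fastforce simp: insert_commute)

lemma edges_subset_Pow: "e \<in> edges V \<Longrightarrow> e \<subseteq> V"
  by (auto simp: edges_def)

lemma sum_edges_insert:
  assumes "finite V" "n \<notin> V"
  shows "(\<Sum>e\<in>edges (insert n V). g e) = (\<Sum>e\<in>edges V. g e) + (\<Sum>k\<in>V. g {n, k})"
proof -
  have "(\<Sum>e\<in>edges (insert n V). g e) = (\<Sum>e\<in>edges V. g e) + (\<Sum>e\<in>(\<lambda>k. {n, k}) ` V. g e)"
    unfolding edges_insert using assms
    by (subst sum.union_disjoint) (auto simp: finite_edges dest: edges_subset_Pow)
  also have "(\<Sum>e\<in>(\<lambda>k. {n, k}) ` V. g e) = (\<Sum>k\<in>V. g {n, k})"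
    by (subst sum.reindex) (auto simp: inj_on_def doubleton_eq_iff)
  finally show ?thesis .
qed

text \<open>\<open>(\<phi> i - \<phi> j)\<^sup>2\<close> for \<open>e = {i, j}\<close>, written without choosing an orientation.\<close>

definition grad_sq :: "('v \<Rightarrow> real) \<Rightarrow> 'v set \<Rightarrow> real" where
  "grad_sq \<phi> e = 2 * (\<Sum>i\<in>e. (\<phi> i)\<^sup>2) - (\<Sum>i\<in>e. \<phi> i)\<^sup>2"

lemma grad_sq_pair: "i \<noteq> j \<Longrightarrow> grad_sq \<phi> {i, j} = (\<phi> i - \<phi> j)\<^sup>2"
  by (simp add: grad_sq_def power2_eq_square algebra_simps)

lemma grad_sq_cong: "(\<And>i. i \<in> e \<Longrightarrow> \<phi> i = \<psi> i) \<Longrightarrow> grad_sq \<phi> e = grad_sq \<psi> e"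
  by (simp add: grad_sq_def)

lemma grad_sq_nonneg: "e \<in> edges V \<Longrightarrow> grad_sq \<phi> e \<ge> 0"
  by (auto simp: edges_def grad_sq_pair)

definition dirichlet_form :: "'v set \<Rightarrow> ('v set \<Rightarrow> real) \<Rightarrow> ('v \<Rightarrow> real) \<Rightarrow> real" where
  "dirichlet_form V w \<phi> = (\<Sum>e\<in>edges V. w e * grad_sq \<phi> e)"

text \<open>Lagrange's identity; it produces the mesh part of the star-mesh transformation.\<close>

lemma dirichlet_form_product_weights:
  assumes "finite V"
  shows "dirichlet_form V (\<lambda>e. \<Prod>k\<in>e. \<omega> k) \<phi> =
    (\<Sum>k\<in>V. \<omega> k) * (\<Sum>k\<in>V. \<omega> k * (\<phi> k)\<^sup>2) - (\<Sum>k\<in>V. \<omega> k * \<phi> k)\<^sup>2"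
  using assms
proof induction
  case empty
  then show ?case by (simp add: dirichlet_form_def edges_def)
next
  case (insert n V)
  have "(\<Sum>k\<in>V. (\<Prod>k\<in>{n, k}. \<omega> k) * grad_sq \<phi> {n, k}) =
      (\<Sum>k\<in>V. \<omega> n * (\<phi> n)\<^sup>2 * \<omega> k + \<omega> n * (\<omega> k * (\<phi> k)\<^sup>2) - 2 * \<omega> n * \<phi> n * (\<omega> k * \<phi> k))"
  proof (rule sum.cong[OF refl])
    fix k assume "k \<in> V"
    then have "n \<noteq> k" using insert by auto
    then show "(\<Prod>k\<in>{n, k}. \<omega> k) * grad_sq \<phi> {n, k} =
        \<omega> n * (\<phi> n)\<^sup>2 * \<omega> k + \<omega> n * (\<omega> k * (\<phi> k)\<^sup>2) - 2 * \<omega> n * \<phi> n * (\<omega> k * \<phi> k)"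
      by (simp add: grad_sq_pair power2_eq_square algebra_simps)
  qed
  also have "\<dots> = \<omega> n * (\<phi> n)\<^sup>2 * (\<Sum>k\<in>V. \<omega> k) + \<omega> n * (\<Sum>k\<in>V. \<omega> k * (\<phi> k)\<^sup>2) -
      2 * \<omega> n * \<phi> n * (\<Sum>k\<in>V. \<omega> k * \<phi> k)"
    by (simp only: sum.distrib sum_subtractf sum_distrib_left)
  finally show ?case using insert
    unfolding dirichlet_form_def
    by (simp add: sum_edges_insert power2_eq_square algebra_simps)
qed

text \<open>The network on \<open>V\<close> after the elimination of \<open>n\<close>. Edges are
  two-element sets, so the product is that of the conductances from \<open>n\<close> to the two end
  points.\<close>

definition star_mesh :: "'v set \<Rightarrow> 'v \<Rightarrow> ('v set \<Rightarrow> real) \<Rightarrow> 'v set \<Rightarrow> real" where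
  "star_mesh V n w e = w e + (\<Prod>k\<in>e. w {n, k}) / (\<Sum>k\<in>V. w {n, k})"

text \<open>Completing the square in the value at \<open>n\<close>; the square is centred at the
  weighted mean of the values on \<open>V\<close>.\<close>

lemma dirichlet_form_insert:
  assumes fin: "finite V" and n: "n \<notin> V" and a: "(\<Sum>k\<in>V. w {n, k}) = a" "a \<noteq> 0"
  shows "dirichlet_form (insert n V) w \<phi> =
    a * (\<phi> n - (\<Sum>k\<in>V. w {n, k} * \<phi> k) / a)\<^sup>2 + dirichlet_form V (star_mesh V n w) \<phi>"
proof -
  let ?\<omega> = "\<lambda>k. w {n, k}"
  let ?C = "\<Sum>k\<in>V. ?\<omega> k * \<phi> k" and ?Q = "\<Sum>k\<in>V. ?\<omega> k * (\<phi> k)\<^sup>2"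
  have "dirichlet_form V (star_mesh V n w) \<phi> =
      dirichlet_form V w \<phi> + dirichlet_form V (\<lambda>e. \<Prod>k\<in>e. ?\<omega> k) \<phi> / a"
    unfolding dirichlet_form_def star_mesh_def a
    by (simp add: algebra_simps sum.distrib sum_divide_distrib)
  also have "\<dots> = dirichlet_form V w \<phi> + (a * ?Q - ?C\<^sup>2) / a"
    by (simp add: dirichlet_form_product_weights[OF fin] a)
  finally have 1: "dirichlet_form V (star_mesh V n w) \<phi> = dirichlet_form V w \<phi> + (a * ?Q - ?C\<^sup>2) / a" .
  have "(\<Sum>k\<in>V. w {n, k} * grad_sq \<phi> {n, k}) =
      (\<Sum>k\<in>V. ?\<omega> k * (\<phi> n)\<^sup>2 - 2 * \<phi> n * (?\<omega> k * \<phi> k) + ?\<omega> k * (\<phi> k)\<^sup>2)"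
  proof (rule sum.cong[OF refl])
    fix k assume "k \<in> V"
    then have "n \<noteq> k" using n by auto
    then show "w {n, k} * grad_sq \<phi> {n, k} = ?\<omega> k * (\<phi> n)\<^sup>2 - 2 * \<phi> n * (?\<omega> k * \<phi> k) + ?\<omega> k * (\<phi> k)\<^sup>2"
      by (simp add: grad_sq_pair power2_eq_square algebra_simps)
  qed
  also have "\<dots> = a * (\<phi> n)\<^sup>2 - 2 * \<phi> n * ?C + ?Q"
    by (simp only: sum.distrib sum_subtractf sum_distrib_left sum_distrib_right a(1)[symmetric])
  finally have 2: "(\<Sum>k\<in>V. w {n, k} * grad_sq \<phi> {n, k}) = a * (\<phi> n)\<^sup>2 - 2 * \<phi> n * ?C + ?Q" .
  show ?thesis
    unfolding 1 unfolding dirichlet_form_def sum_edges_insert[OF fin n] 2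
    using a(2) by (simp add: field_simps power2_eq_square)
qed

text \<open>The Schur complement of a Laplacian at \<open>n\<close> is the Laplacian of the
  star-mesh network.\<close>

lemma laplacian_det_insert:
  assumes fin: "finite \<Lambda>" and n: "n \<notin> insert \<rho> \<Lambda>"
    and a: "(\<Sum>k\<in>insert \<rho> \<Lambda>. w {n, k}) = a" "a \<noteq> 0"
  shows "laplacian_det (insert n \<Lambda>) \<rho> w = a * laplacian_det \<Lambda> \<rho> (star_mesh (insert \<rho> \<Lambda>) n w)"
proof -
  let ?V = "insert \<rho> \<Lambda>" and ?L = "laplacian (insert n \<Lambda>) \<rho> w"
  have V: "insert \<rho> (insert n \<Lambda>) - {n} = ?V" using n by auto
  have nn: "?L n n = a" using V a by (simp add: laplacian_def)
  have "laplacian_det (insert n \<Lambda>) \<rho> w = a * det_on \<Lambda> (\<lambda>i j. ?L i j - ?L i n * ?L n j / a)"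
    using det_on_Schur[of \<Lambda> n ?L] fin n nn a unfolding laplacian_det_def by auto
  also have "det_on \<Lambda> (\<lambda>i j. ?L i j - ?L i n * ?L n j / a) =
      laplacian_det \<Lambda> \<rho> (star_mesh ?V n w)"
    unfolding laplacian_det_def
  proof (rule det_on_cong)
    fix i j assume ij: "i \<in> \<Lambda>" "j \<in> \<Lambda>"
    then have ne: "i \<noteq> n" "j \<noteq> n" using n by auto
    show "?L i j - ?L i n * ?L n j / a = laplacian \<Lambda> \<rho> (star_mesh ?V n w) i j"
    proof (cases "i = j")
      case False
      then show ?thesis using ne unfolding laplacian_def star_mesh_def a
        by (simp add: insert_commute)
    next
      case True
      have Vi: "insert \<rho> (insert n \<Lambda>) - {i} = insert n (?V - {i})" using ne by auto
      have "(\<Sum>k\<in>?V - {i}. star_mesh ?V n w {i, k}) =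
          (\<Sum>k\<in>?V - {i}. w {i, k}) + (\<Sum>k\<in>?V - {i}. w {n, i} / a * w {n, k})"
        unfolding star_mesh_def a sum.distrib[symmetric] by (intro sum.cong) auto
      also have "(\<Sum>k\<in>?V - {i}. w {n, i} / a * w {n, k}) = w {n, i} / a * (a - w {n, i})"
        using fin ij unfolding sum_distrib_left[symmetric] by (simp add: sum_diff1 a(1))
      finally show ?thesis using True ne n fin a(2) ij unfolding laplacian_def Vi
        by (simp add: insert_commute field_simps)
    qed
  qed
  finally show ?thesis .
qed

text \<open>Weights of either sign are allowed. Eliminating \<open>n\<close> keeps the form
  nonnegative, because the reduced form is the value of the original one where the square in the
  value at \<open>n\<close> vanishes.\<close>

lemma laplacian_det_nonneg:
  assumes "finite \<Lambda>" "\<rho> \<notin> \<Lambda>" "\<And>\<phi>. dirichlet_form (insert \<rho> \<Lambda>) w \<phi> \<ge> 0"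
  shows "laplacian_det \<Lambda> \<rho> w \<ge> 0"
  using assms
proof (induction \<Lambda> arbitrary: w)
  case empty
  then show ?case by (simp add: laplacian_det_def det_on_def)
next
  case (insert n \<Lambda>)
  let ?V = "insert \<rho> \<Lambda>"
  define a where "a = (\<Sum>k\<in>?V. w {n, k})"
  have V: "finite ?V" "n \<notin> ?V" using insert by auto
  have psd: "dirichlet_form (insert n ?V) w \<phi> \<ge> 0" for \<phi>
    using insert.prems(2)[of \<phi>] by (simp add: insert_commute)
  have split: "dirichlet_form (insert n ?V) w \<phi> = dirichlet_form ?V w \<phi> + (\<Sum>k\<in>?V. w {n, k} * (\<phi> n - \<phi> k)\<^sup>2)" for \<phi>
  proof -
    have "(\<Sum>k\<in>?V. w {n, k} * grad_sq \<phi> {n, k}) = (\<Sum>k\<in>?V. w {n, k} * (\<phi> n - \<phi> k)\<^sup>2)"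
      by (rule sum.cong[OF refl], subst grad_sq_pair) (use V in auto)
    then show ?thesis unfolding dirichlet_form_def sum_edges_insert[OF V] by simp
  qed
  have zero: "dirichlet_form ?V w (\<phi>(n := t)) = dirichlet_form ?V w \<phi>" for \<phi> t
    unfolding dirichlet_form_def
    by (rule sum.cong[OF refl], subst grad_sq_cong[of _ "\<phi>(n := t)" \<phi>])
      (use V edges_subset_Pow in auto)
  have upd: "(\<Sum>k\<in>?V. w {n, k} * ((\<phi>(n := t)) n - (\<phi>(n := t)) k)\<^sup>2) = (\<Sum>k\<in>?V. w {n, k} * (t - \<phi> k)\<^sup>2)" for \<phi> t
    by (rule sum.cong) (use V in auto)
  have "dirichlet_form ?V w (\<lambda>_. 0) = 0"
    unfolding dirichlet_form_def grad_sq_def by simp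
  then have "a \<ge> 0"
    using psd[of "(\<lambda>_. 0)(n := 1)"] unfolding split zero upd by (simp add: a_def)
  show ?case
  proof (cases "a = 0")
    case False
    have "dirichlet_form ?V (star_mesh ?V n w) \<phi> \<ge> 0" for \<phi>
    proof -
      define t where "t = (\<Sum>k\<in>?V. w {n, k} * \<phi> k) / a"
      have "(\<Sum>k\<in>?V. w {n, k} * (\<phi>(n := t)) k) / a = t"
        unfolding t_def by (rule arg_cong[where f = "\<lambda>x. x / a"], rule sum.cong) (use V in auto)
      then have "dirichlet_form ?V (star_mesh ?V n w) (\<phi>(n := t)) \<ge> 0"
        using psd[of "\<phi>(n := t)"] unfolding dirichlet_form_insert[OF V a_def[symmetric] False] by simp
      also have "dirichlet_form ?V (star_mesh ?V n w) (\<phi>(n := t)) = dirichlet_form ?V (star_mesh ?V n w) \<phi>"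
        unfolding dirichlet_form_def
        by (rule sum.cong[OF refl], subst grad_sq_cong[of _ "\<phi>(n := t)" \<phi>])
          (use V edges_subset_Pow in auto)
      finally show ?thesis .
    qed
    then have "laplacian_det \<Lambda> \<rho> (star_mesh ?V n w) \<ge> 0" using insert by auto
    then show ?thesis
      using laplacian_det_insert[OF insert.hyps(1) V(2) a_def[symmetric] False] \<open>a \<ge> 0\<close> by simp
  next
    case True
    have wk: "w {n, k} = 0" if k: "k \<in> ?V" for k
    proof (rule ccontr)
      assume nz: "w {n, k} \<noteq> 0"
      \<comment> \<open>With total conductance 0 at \<open>n\<close>, the form at the indicator of
        \<open>k\<close> is affine in the value \<open>t\<close> at \<open>n\<close>; being bounded
        below forces the slope, and with it \<open>w {n, k}\<close>, to vanish.\<close>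
      define \<phi> where "\<phi> = (\<lambda>j. if j = k then 1 else 0 :: real)"
      have eq: "(\<Sum>j\<in>?V. w {n, j} * (t - \<phi> j)\<^sup>2) = w {n, k} * (1 - 2 * t)" for t
      proof -
        have "(\<Sum>j\<in>?V. w {n, j} * (t - \<phi> j)\<^sup>2) =
            (\<Sum>j\<in>?V. t\<^sup>2 * w {n, j} + (if j = k then w {n, k} * (1 - 2 * t) else 0))"
          by (rule sum.cong) (auto simp: \<phi>_def power2_eq_square algebra_simps)
        also have "\<dots> = t\<^sup>2 * a + w {n, k} * (1 - 2 * t)"
          using V k by (simp only: sum.distrib sum_distrib_left[symmetric] sum.delta' a_def) simp
        finally show ?thesis using True by simp
      qed
      define d where "d = dirichlet_form ?V w \<phi>"
      have "d + w {n, k} * (1 - 2 * t) \<ge> 0" for t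
        using psd[of "\<phi>(n := t)"] unfolding split zero upd eq d_def by simp
      \<comment> \<open>This value of \<open>t\<close> makes the form equal to -1.\<close>
      from this[of "(1 + (d + 1) / w {n, k}) / 2"] nz show False
        by (simp add: field_simps)
    qed
    have "laplacian (insert n \<Lambda>) \<rho> w n j = 0" if "j \<in> insert n \<Lambda>" for j
      using that wk V unfolding laplacian_def by (auto intro!: sum.neutral)
    then show ?thesis unfolding laplacian_det_def
      using det_on_zero_row[of "insert n \<Lambda>" n] insert.hyps by simp
  qed
qed

lemma laplacian_det_nonneg_weights:
  assumes "finite \<Lambda>" "\<rho> \<notin> \<Lambda>" "\<And>e. e \<in> edges (insert \<rho> \<Lambda>) \<Longrightarrow> w e \<ge> 0"
  shows "laplacian_det \<Lambda> \<rho> w \<ge> 0"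
  using assms by (intro laplacian_det_nonneg)
    (auto simp: dirichlet_form_def intro!: sum_nonneg mult_nonneg_nonneg grad_sq_nonneg)

text \<open>Induction on the variables: \<open>g\<close> is \<open>g0\<close> plus \<open>z\<close>
  times \<open>g1\<close> in the variable \<open>e\<close>, and both inherit the hypotheses. The
  slope \<open>g1\<close> is nonnegative on the orthant, since otherwise a large \<open>z\<close>
  would make \<open>g\<close> negative.\<close>

lemma multi_affine_expansion:
  fixes g :: "('e \<Rightarrow> real) \<Rightarrow> real"
  assumes "finite E"
    and "\<And>w w'. (\<And>e. e \<in> E \<Longrightarrow> w e = w' e) \<Longrightarrow> g w = g w'"
    and "\<And>w e. e \<in> E \<Longrightarrow> \<exists>a b. \<forall>z. g (w(e := z)) = a + z * b"
    and "\<And>w. (\<And>e. e \<in> E \<Longrightarrow> w e \<ge> 0) \<Longrightarrow> g w \<ge> 0"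
  shows "\<exists>c. (\<forall>S. c S \<ge> 0) \<and> (\<forall>w. g w = (\<Sum>S\<in>Pow E. c S * (\<Prod>e\<in>S. w e)))"
  using assms
proof (induction E arbitrary: g)
  case empty
  have "g w = g (\<lambda>_. 0)" for w by (rule empty.prems) auto
  then show ?case using empty.prems(3)[of "\<lambda>_. 0"] by (intro exI[of _ "\<lambda>_. g (\<lambda>_. 0)"]) auto
next
  case (insert e E)
  define g0 where "g0 w = g (w(e := 0))" for w
  define g1 where "g1 w = g (w(e := 1)) - g (w(e := 0))" for w
  have dec: "g (w(e := z)) = g0 w + z * g1 w" for w z
  proof -
    obtain a b where "\<forall>z. g (w(e := z)) = a + z * b" using insert.prems(2)[of e w] by blast
    then show ?thesis by (simp add: g0_def g1_def)
  qed
  have "\<exists>c. (\<forall>S. c S \<ge> 0) \<and> (\<forall>w. g0 w = (\<Sum>S\<in>Pow E. c S * (\<Prod>e\<in>S. w e)))"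
  proof (rule insert.IH)
    show "g0 w = g0 w'" if "\<And>e. e \<in> E \<Longrightarrow> w e = w' e" for w w'
      unfolding g0_def by (rule insert.prems) (use that in auto)
    show "\<exists>a b. \<forall>z. g0 (w(e' := z)) = a + z * b" if "e' \<in> E" for w e'
    proof -
      have "e' \<noteq> e" using that insert.hyps by auto
      then have "(w(e' := z))(e := 0) = (w(e := 0))(e' := z)" for z by (rule fun_upd_twist)
      then show ?thesis using insert.prems(2)[of e' "w(e := 0)"] that
        unfolding g0_def by (simp del: fun_upd_apply)
    qed
    show "g0 w \<ge> 0" if "\<And>e. e \<in> E \<Longrightarrow> w e \<ge> 0" for w
      unfolding g0_def by (rule insert.prems) (use that in auto)
  qed
  then obtain c0 where c0: "\<And>S. c0 S \<ge> 0" "\<And>w. g0 w = (\<Sum>S\<in>Pow E. c0 S * (\<Prod>e\<in>S. w e))" by blast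
  have "\<exists>c. (\<forall>S. c S \<ge> 0) \<and> (\<forall>w. g1 w = (\<Sum>S\<in>Pow E. c S * (\<Prod>e\<in>S. w e)))"
  proof (rule insert.IH)
    show "g1 w = g1 w'" if "\<And>e. e \<in> E \<Longrightarrow> w e = w' e" for w w'
      unfolding g1_def by (intro arg_cong2[where f = "(-)"] insert.prems) (use that in auto)
    show "\<exists>a b. \<forall>z. g1 (w(e' := z)) = a + z * b" if e': "e' \<in> E" for w e'
    proof -
      have "e' \<noteq> e" using e' insert.hyps by auto
      obtain a b where "\<forall>z. g ((w(e := 1))(e' := z)) = a + z * b"
        using insert.prems(2)[of e' "w(e := 1)"] e' by blast
      moreover obtain a' b' where "\<forall>z. g ((w(e := 0))(e' := z)) = a' + z * b'"
        using insert.prems(2)[of e' "w(e := 0)"] e' by blast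
      ultimately have "\<forall>z. g1 (w(e' := z)) = (a - a') + z * (b - b')"
        using \<open>e' \<noteq> e\<close> unfolding g1_def by (simp add: fun_upd_twist algebra_simps)
      then show ?thesis by blast
    qed
    show "g1 w \<ge> 0" if "\<And>e. e \<in> E \<Longrightarrow> w e \<ge> 0" for w
    proof (rule ccontr)
      assume "\<not> g1 w \<ge> 0"
      have g0: "g0 w \<ge> 0" unfolding g0_def by (rule insert.prems) (use that in auto)
      \<comment> \<open>At this \<open>z\<close> the affine function equals -1.\<close>
      define z where "z = (g0 w + 1) / (- g1 w)"
      have "z \<ge> 0" using \<open>\<not> g1 w \<ge> 0\<close> g0 unfolding z_def by (intro divide_nonneg_pos) auto
      then have "g (w(e := z)) \<ge> 0" by (intro insert.prems) (use that in auto)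
      then show False using \<open>\<not> g1 w \<ge> 0\<close> unfolding dec z_def by (simp add: field_simps)
    qed
  qed
  then obtain c1 where c1: "\<And>S. c1 S \<ge> 0" "\<And>w. g1 w = (\<Sum>S\<in>Pow E. c1 S * (\<Prod>e\<in>S. w e))" by blast
  define c where "c S = (if e \<in> S then c1 (S - {e}) else c0 S)" for S
  have "g w = (\<Sum>S\<in>Pow (insert e E). c S * (\<Prod>e\<in>S. w e))" for w
  proof -
    have disj: "Pow E \<inter> insert e ` Pow E = {}" using insert.hyps by auto
    have inj: "inj_on (insert e) (Pow E)" using insert.hyps by (auto simp: inj_on_def)
    have "(\<Sum>S\<in>Pow (insert e E). c S * (\<Prod>e\<in>S. w e)) =
        (\<Sum>S\<in>Pow E. c S * (\<Prod>e\<in>S. w e)) + (\<Sum>S\<in>Pow E. c (insert e S) * (\<Prod>e\<in>insert e S. w e))"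
      unfolding Pow_insert using insert.hyps disj inj
      by (simp add: sum.union_disjoint sum.reindex)
    also have "(\<Sum>S\<in>Pow E. c S * (\<Prod>e\<in>S. w e)) = g0 w"
      unfolding c0(2) using insert.hyps by (intro sum.cong) (auto simp: c_def)
    also have "(\<Sum>S\<in>Pow E. c (insert e S) * (\<Prod>e\<in>insert e S. w e)) = w e * g1 w"
      unfolding c1(2) sum_distrib_left
    proof (rule sum.cong[OF refl])
      fix S assume "S \<in> Pow E"
      then have "e \<notin> S" "finite S" using insert.hyps finite_subset by auto
      then show "c (insert e S) * (\<Prod>e\<in>insert e S. w e) = w e * (c1 S * (\<Prod>e\<in>S. w e))"
        by (simp add: c_def)
    qed
    finally show ?thesis using dec[of w "w e"] by simp
  qed
  then show ?case using c0(1) c1(1) by (intro exI[of _ c]) (auto simp: c_def)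
qed

text \<open>The matrix-tree expansion, obtained from affinity in each edge and positivity alone.
  Every edge occurs at most once in a term, which is what makes the Ward density linear in each
  edge.\<close>

lemma laplacian_det_expansion:
  assumes "finite \<Lambda>" "\<rho> \<notin> \<Lambda>"
  obtains c where "\<And>S. c S \<ge> 0"
    "\<And>w. laplacian_det \<Lambda> \<rho> w = (\<Sum>S\<in>Pow (edges (insert \<rho> \<Lambda>)). c S * (\<Prod>e\<in>S. w e))"
proof -
  have "\<exists>c. (\<forall>S. c S \<ge> 0) \<and>
      (\<forall>w. laplacian_det \<Lambda> \<rho> w = (\<Sum>S\<in>Pow (edges (insert \<rho> \<Lambda>)). c S * (\<Prod>e\<in>S. w e)))"
    by (rule multi_affine_expansion)
      (use assms in \<open>auto intro: finite_edges laplacian_det_cong laplacian_det_affine laplacian_det_nonneg_weights\<close>)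
  then show ?thesis using that by blast
qed

lemma laplacian_det_mono:
  assumes "finite \<Lambda>" "\<rho> \<notin> \<Lambda>" "\<And>e. e \<in> edges (insert \<rho> \<Lambda>) \<Longrightarrow> 0 \<le> w e \<and> w e \<le> w' e"
  shows "laplacian_det \<Lambda> \<rho> w \<le> laplacian_det \<Lambda> \<rho> w'"
proof -
  obtain c where c: "\<And>S. c S \<ge> 0"
    "\<And>w. laplacian_det \<Lambda> \<rho> w = (\<Sum>S\<in>Pow (edges (insert \<rho> \<Lambda>)). c S * (\<Prod>e\<in>S. w e))"
    using laplacian_det_expansion assms(1,2) by metis
  show ?thesis unfolding c(2)
    by (intro sum_mono mult_left_mono prod_mono c) (use assms(3) in auto)
qed

section \<open>Integrating out one vertex\<close>

lemma nn_integral_normal_density: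
  assumes "\<sigma> > 0"
  shows "(\<integral>\<^sup>+x. ennreal (normal_density \<mu> \<sigma> x) \<partial>lborel) = 1"
  using assms by (subst nn_integral_eq_integral) auto

lemma nn_integral_gaussian:
  assumes "a > 0"
  shows "(\<integral>\<^sup>+y. ennreal (exp (- (a * (y - m)\<^sup>2) / 2)) \<partial>lborel) = ennreal (sqrt (2 * pi / a))"
proof -
  have "exp (- (a * (y - m)\<^sup>2) / 2) = sqrt (2 * pi / a) * normal_density m (1 / sqrt a) y" for y
    using assms by (simp add: normal_density_def power_divide real_sqrt_divide real_sqrt_mult field_simps)
  then have "(\<integral>\<^sup>+y. ennreal (exp (- (a * (y - m)\<^sup>2) / 2)) \<partial>lborel) =
      ennreal (sqrt (2 * pi / a)) * (\<integral>\<^sup>+y. ennreal (normal_density m (1 / sqrt a) y) \<partial>lborel)"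
    using assms by (subst nn_integral_cmult[symmetric]) (auto simp: ennreal_mult)
  then show ?thesis using assms by (simp add: nn_integral_normal_density)
qed

text \<open>The law of \<open>r\<close> for which \<open>exp r\<close> has the inverse Gaussian
  distribution with mean 1 / c and shape parameter 1.\<close>

definition mixing_kernel :: "real \<Rightarrow> real \<Rightarrow> real" where
  "mixing_kernel c r = exp (- r / 2) / sqrt (2 * pi) * exp (- (exp (- r) - 2 * c + c\<^sup>2 * exp r) / 2)"

lemma mixing_kernel_nonneg: "mixing_kernel c r \<ge> 0"
  by (simp add: mixing_kernel_def)

lemma mixing_kernel_measurable [measurable]: "mixing_kernel c \<in> borel_measurable borel"
  unfolding mixing_kernel_def by measurable

lemma borel_measurable_cosh_real [measurable]: "(cosh :: real \<Rightarrow> real) \<in> borel_measurable borel"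
  by (intro borel_measurable_continuous_onI continuous_intros)

lemma borel_measurable_sinh_real [measurable]: "(sinh :: real \<Rightarrow> real) \<in> borel_measurable borel"
  by (intro borel_measurable_continuous_onI continuous_intros)

lemma cosh_minus_one_half: "cosh t - 1 = 2 * (sinh (t / 2))\<^sup>2" for t :: real
proof -
  have "cosh t = cosh (2 * (t / 2))" by simp
  also have "\<dots> = 2 * (sinh (t / 2))\<^sup>2 + 1"
    unfolding cosh_double cosh_square_eq by simp
  finally show ?thesis by simp
qed

text \<open>
  Centring \<open>r\<close> at \<open>- ln c\<close> turns the kernel into \<open>exp (- t / 2)\<close> times an even function of \<open>t\<close>, so that
  \<open>exp (- t / 2)\<close> may be replaced by \<open>cosh (t / 2)\<close>; then \<open>y = sinh (t / 2)\<close> gives a Gaussian integral.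
\<close>

lemma nn_integral_mixing_kernel:
  assumes c: "c > 0"
  shows "(\<integral>\<^sup>+r. ennreal (mixing_kernel c r) \<partial>lborel) = 1"
proof -
  \<comment> \<open>Chosen so that \<open>c * (cosh t - 1)\<close>, which is 2 c times the square of
    \<open>sinh (t / 2)\<close>, becomes that square divided by twice the variance.\<close>
  define \<sigma> where "\<sigma> = 1 / (2 * sqrt c)"
  have \<sigma>: "\<sigma> > 0" "\<sigma>\<^sup>2 = 1 / (4 * c)" using c by (auto simp: \<sigma>_def power_divide power_mult_distrib)
  define g where "g t = normal_density 0 \<sigma> (sinh (t / 2)) / 2" for t
  have [measurable]: "g \<in> borel_measurable borel" unfolding g_def by measurable
  have g_even: "g (- t) = g t" for t unfolding g_def normal_density_def by simp
  have g_nonneg: "g t \<ge> 0" for t by (simp add: g_def)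
  have g_eq: "g t = sqrt (c / (2 * pi)) * exp (- (c * (cosh t - 1)))" for t
  proof -
    have "1 / sqrt (2 * pi * \<sigma>\<^sup>2) = 2 * sqrt (c / (2 * pi))"
    proof -
      have "1 / sqrt (2 * pi * \<sigma>\<^sup>2) = sqrt (4 * (c / (2 * pi)))"
      proof -
        have "2 * pi * \<sigma>\<^sup>2 = 1 / (4 * (c / (2 * pi)))" using c by (simp add: \<sigma>)
        then show ?thesis by (simp only: real_sqrt_divide real_sqrt_one) simp
      qed
      also have "\<dots> = 2 * sqrt (c / (2 * pi))" by (subst real_sqrt_mult) simp
      finally show ?thesis .
    qed
    then show ?thesis using c
      unfolding g_def normal_density_def cosh_minus_one_half \<sigma>(2) by (simp add: field_simps)
  qed
  have kernel: "mixing_kernel c (- ln c + 1 * t) = exp (- t / 2) * g t" for t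
  proof -
    have 1: "exp (- (- ln c + 1 * t) / 2) = sqrt c * exp (- t / 2)"
    proof -
      have "exp (- (- ln c + 1 * t) / 2) = exp (ln c / 2) * exp (- t / 2)"
        by (simp add: exp_add[symmetric] field_simps)
      also have "exp (ln c / 2) = sqrt c" using c by (simp add: ln_sqrt[symmetric])
      finally show ?thesis .
    qed
    have 2: "exp (- (- ln c + 1 * t)) = c * exp (- t)" "exp (- ln c + 1 * t) = exp t / c"
      using c by (simp_all add: exp_add exp_minus exp_diff field_simps)
    have 3: "exp (- (c * exp (- t) - 2 * c + c\<^sup>2 * (exp t / c)) / 2) = exp (- (c * (cosh t - 1)))"
      using c by (simp add: cosh_def field_simps power2_eq_square)
    show ?thesis unfolding mixing_kernel_def 1 2 3 g_eq
      using c by (simp add: real_sqrt_divide)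
  qed
  let ?I = "\<integral>\<^sup>+t. ennreal (exp (- t / 2) * g t) \<partial>lborel"
  have I: "(\<integral>\<^sup>+r. ennreal (mixing_kernel c r) \<partial>lborel) = ?I"
    using nn_integral_real_affine[of "\<lambda>r. ennreal (mixing_kernel c r)" 1 "- ln c"]
    by (simp only: kernel) simp
  have "?I = (\<integral>\<^sup>+t. ennreal (exp (t / 2) * g t) \<partial>lborel)"
    using nn_integral_real_affine[of "\<lambda>t. ennreal (exp (- t / 2) * g t)" "-1" 0]
    by (simp add: g_even)
  then have "2 * ?I = ?I + (\<integral>\<^sup>+t. ennreal (exp (t / 2) * g t) \<partial>lborel)"
    by (simp only: mult_2)
  also have "\<dots> = (\<integral>\<^sup>+t. ennreal (exp (- t / 2) * g t) + ennreal (exp (t / 2) * g t) \<partial>lborel)"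
    by (rule nn_integral_add[symmetric]) measurable
  also have "\<dots> = (\<integral>\<^sup>+t. 2 * ennreal (\<bar>cosh (t / 2) / 2\<bar> * normal_density 0 \<sigma> (sinh (t / 2))) \<partial>lborel)"
  proof (rule nn_integral_cong)
    fix t
    have "exp (- t / 2) * g t + exp (t / 2) * g t = 2 * (\<bar>cosh (t / 2) / 2\<bar> * normal_density 0 \<sigma> (sinh (t / 2)))"
      by (simp add: g_def cosh_def field_simps)
    then show "ennreal (exp (- t / 2) * g t) + ennreal (exp (t / 2) * g t) =
        2 * ennreal (\<bar>cosh (t / 2) / 2\<bar> * normal_density 0 \<sigma> (sinh (t / 2)))"
      using ennreal_mult'[of 2 "\<bar>cosh (t / 2) / 2\<bar> * normal_density 0 \<sigma> (sinh (t / 2))"]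
        ennreal_plus[of "exp (- t / 2) * g t" "exp (t / 2) * g t"] g_nonneg[of t]
      by (simp del: ennreal_plus)
  qed
  also have "\<dots> = 2 * (\<integral>\<^sup>+t. ennreal (\<bar>cosh (t / 2) / 2\<bar> * normal_density 0 \<sigma> (sinh (t / 2))) \<partial>lborel)"
    by (rule nn_integral_cmult) measurable
  also have "(\<integral>\<^sup>+t. ennreal (\<bar>cosh (t / 2) / 2\<bar> * normal_density 0 \<sigma> (sinh (t / 2))) \<partial>lborel) = ennreal 1"
  proof (rule nn_integral_has_integral_lborel)
    let ?n = "normal_density 0 \<sigma>"
    have der: "((\<lambda>t. sinh (t / 2)) has_field_derivative cosh (t / 2) / 2) (at t within UNIV)" for t :: real
      by (auto intro!: derivative_eq_intros)
    have range: "(\<lambda>t. sinh (t / 2)) ` (UNIV :: real set) = UNIV"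
    proof -
      have "sinh ((2 * arsinh y) / 2) = y" for y :: real by simp
      then show ?thesis by (rule surjI)
    qed
    have n: "(?n has_integral 1) UNIV"
      using has_integral_integral_lborel[of ?n] \<sigma> by simp
    have "?n absolutely_integrable_on UNIV"
      by (rule nonnegative_absolutely_integrable_1) (use n in auto)
    moreover have "integral UNIV ?n = 1" using n by (rule integral_unique)
    ultimately have "(\<lambda>t. \<bar>cosh (t / 2) / 2\<bar> * ?n (sinh (t / 2))) absolutely_integrable_on UNIV \<and>
        integral UNIV (\<lambda>t. \<bar>cosh (t / 2) / 2\<bar> * ?n (sinh (t / 2))) = 1"
      by (subst has_absolute_integral_change_of_variables_1'[OF _ der]) (auto simp: inj_on_def range)
    then show "((\<lambda>t. \<bar>cosh (t / 2) / 2\<bar> * ?n (sinh (t / 2))) has_integral 1) UNIV"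
      using absolutely_integrable_on_def integrable_integral by metis
  qed auto
  finally have "2 * ?I = 2 * 1" by simp
  then have "?I = 1" by (subst (asm) ennreal_mult_cancel_left) auto
  then show ?thesis using I by simp
qed

section \<open>The density as a function of a network, and the elimination of a vertex\<close>

definition conductance :: "('v set \<Rightarrow> real) \<Rightarrow> ('v \<Rightarrow> real) \<Rightarrow> 'v set \<Rightarrow> real" where
  "conductance w u e = w e * (\<Prod>k\<in>e. exp (u k))"

text \<open>Up to the factor \<open>exp (u i + u j) / 2\<close>, this is the sum of the squared
  increments of \<open>exp (- u)\<close> and of \<open>s\<close>. Hence the energy is a sum of two
  Dirichlet forms of one and the same network, and eliminating a vertex acts on both at
  once.\<close>

lemma B_pair_minus_one:
  "B_pair u s i j - 1 = exp (u i + u j) * ((exp (- u i) - exp (- u j))\<^sup>2 + (s i - s j)\<^sup>2) / 2"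
proof -
  have "exp (u i + u j) * (exp (- u i) - exp (- u j))\<^sup>2 = exp (u j - u i) + exp (u i - u j) - 2"
    by (simp add: power2_eq_square algebra_simps exp_add[symmetric])
  then show ?thesis by (simp add: B_pair_def cosh_def field_simps)
qed

lemma B_edge_minus_one:
  assumes "e \<in> edges V"
  shows "B_edge \<Lambda> u s e - 1 = (\<Prod>k\<in>e. exp (pinned \<Lambda> u k)) *
    (grad_sq (\<lambda>k. exp (- pinned \<Lambda> u k)) e + grad_sq (pinned \<Lambda> s) e) / 2"
proof -
  obtain i j where "e = {i, j}" "i \<noteq> j" using assms by (auto simp: edges_def)
  then show ?thesis
    by (simp add: B_edge_pair B_pair_minus_one grad_sq_pair exp_add)
qed

lemma B_edge_ge_1: "e \<in> edges V \<Longrightarrow> B_edge \<Lambda> u s e \<ge> 1"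
  using B_edge_minus_one[of e V \<Lambda> u s] grad_sq_nonneg[of e V]
  by (smt (verit, best) divide_nonneg_pos exp_ge_zero mult_nonneg_nonneg prod_nonneg)

text \<open>The energy is written with the two Dirichlet forms to which vertex elimination applies.
  It runs over all edges, so that the index set does not depend on the weights.\<close>

definition edge_density ::
    "'v set \<Rightarrow> 'v \<Rightarrow> ('v set \<Rightarrow> real) \<Rightarrow> ('v \<Rightarrow> real) \<Rightarrow> ('v \<Rightarrow> real) \<Rightarrow> real" where
  "edge_density \<Lambda> \<rho> w u s =
     exp (- (dirichlet_form (insert \<rho> \<Lambda>) (conductance w (pinned \<Lambda> u)) (\<lambda>k. exp (- pinned \<Lambda> u k)) +
             dirichlet_form (insert \<rho> \<Lambda>) (conductance w (pinned \<Lambda> u)) (pinned \<Lambda> s)) / 2) *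
     laplacian_det \<Lambda> \<rho> (conductance w (pinned \<Lambda> u)) * (\<Prod>i\<in>\<Lambda>. exp (- u i) / (2 * pi))"

lemma edge_density_eq:
  "edge_density \<Lambda> \<rho> w u s =
     exp (- (\<Sum>e\<in>edges (insert \<rho> \<Lambda>). w e * (B_edge \<Lambda> u s e - 1))) *
     laplacian_det \<Lambda> \<rho> (conductance w (pinned \<Lambda> u)) * (\<Prod>i\<in>\<Lambda>. exp (- u i) / (2 * pi))"
proof -
  have "(\<Sum>e\<in>edges (insert \<rho> \<Lambda>). w e * (B_edge \<Lambda> u s e - 1)) =
    (dirichlet_form (insert \<rho> \<Lambda>) (conductance w (pinned \<Lambda> u)) (\<lambda>k. exp (- pinned \<Lambda> u k)) +
     dirichlet_form (insert \<rho> \<Lambda>) (conductance w (pinned \<Lambda> u)) (pinned \<Lambda> s)) / 2"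
    unfolding dirichlet_form_def sum.distrib[symmetric] sum_divide_distrib
    by (rule sum.cong[OF refl], subst B_edge_minus_one)
      (auto simp: conductance_def field_simps)
  then show ?thesis by (simp add: edge_density_def)
qed

lemma edge_density_nonneg:
  assumes "finite \<Lambda>" "\<rho> \<notin> \<Lambda>" "\<And>e. e \<in> edges (insert \<rho> \<Lambda>) \<Longrightarrow> w e \<ge> 0"
  shows "edge_density \<Lambda> \<rho> w u s \<ge> 0"
  unfolding edge_density_def using assms
  by (intro mult_nonneg_nonneg prod_nonneg laplacian_det_nonneg_weights)
    (auto simp: conductance_def intro!: mult_nonneg_nonneg prod_nonneg)

text \<open>The star-mesh transformation of the conductances, read off at the level of the weights:
  the mesh conductance of {i, j} divided by \<open>exp (u i + u j)\<close> is \<open>exp r\<close>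
  times the product of the two weights to \<open>n\<close>, and depends on \<open>u\<close> through
  \<open>r\<close> only.\<close>

definition mixed_weights :: "'v \<Rightarrow> real \<Rightarrow> ('v set \<Rightarrow> real) \<Rightarrow> 'v set \<Rightarrow> real" where
  "mixed_weights n r w e = w e + exp r * (\<Prod>k\<in>e. w {n, k})"

lemma pinned_insert: "pinned (insert n \<Lambda>) (u(n := x)) = (pinned \<Lambda> u)(n := x)"
  by (auto simp: pinned_def)

text \<open>Both Dirichlet forms split off a square. The one of \<open>exp (- u)\<close> gives the
  exponent of the mixing kernel, the one of \<open>s\<close> a Gaussian in \<open>y\<close> with
  precision \<open>exp x * A\<close>; its centre \<open>m\<close> depends on \<open>u\<close> and
  \<open>s\<close> but not on \<open>y\<close>.\<close>

lemma edge_density_insert: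
  fixes \<rho> :: "'v :: linorder"
  assumes fin: "finite \<Lambda>" and n: "n \<notin> insert \<rho> \<Lambda>"
    and w: "\<And>k. k \<in> insert \<rho> \<Lambda> \<Longrightarrow> w {n, k} > 0"
    and A_def: "A = (\<Sum>k\<in>insert \<rho> \<Lambda>. w {n, k} * exp (pinned \<Lambda> u k))"
    and c_def: "c = (\<Sum>k\<in>insert \<rho> \<Lambda>. w {n, k})"
  shows "A > 0"
    and "\<exists>m. \<forall>y. edge_density (insert n \<Lambda>) \<rho> w (u(n := x)) (s(n := y)) =
      exp (- (exp (- (x - ln A)) - 2 * c + c\<^sup>2 * exp (x - ln A)) / 2) * (A / (2 * pi)) *
      exp (- (exp x * A * (y - m)\<^sup>2) / 2) *
      edge_density \<Lambda> \<rho> (mixed_weights n (x - ln A) w) u s"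
proof -
  let ?V = "insert \<rho> \<Lambda>"
  define U where "U = (pinned \<Lambda> u)(n := x)"
  define S where "S y = (pinned \<Lambda> s)(n := y)" for y
  have n': "n \<notin> ?V" using n by auto
  have U: "U n = x" "\<And>k. k \<in> ?V \<Longrightarrow> U k = pinned \<Lambda> u k"
    and S: "\<And>y. S y n = y" "\<And>y k. k \<in> ?V \<Longrightarrow> S y k = pinned \<Lambda> s k"
    using n' by (auto simp: U_def S_def)
  define r where "r = x - ln A"
  have V: "finite ?V" "?V \<noteq> {}" using fin by auto
  show A: "A > 0" unfolding A_def using V w by (intro sum_pos mult_pos_pos) auto
  define a where "a = exp x * A"
  have a: "a > 0" using A by (simp add: a_def)
  let ?X = "conductance w U" and ?Y = "conductance (mixed_weights n r w) (pinned \<Lambda> u)"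
  have Xn: "?X {n, k} = exp x * (w {n, k} * exp (pinned \<Lambda> u k))" if "k \<in> ?V" for k
  proof -
    have "n \<noteq> k" using that n by auto
    then show ?thesis using U that by (simp add: conductance_def)
  qed
  have sum_Xn: "(\<Sum>k\<in>?V. ?X {n, k}) = a"
    unfolding a_def A_def sum_distrib_left by (rule sum.cong) (auto simp: Xn)
  have er: "exp r = exp x / A" using A by (simp add: r_def exp_diff)
  have star: "star_mesh ?V n ?X e = ?Y e" if e: "e \<in> edges ?V" for e
  proof -
    obtain i j where ij: "e = {i, j}" "i \<in> ?V" "j \<in> ?V" "i \<noteq> j"
      using e unfolding edges_def by blast
    then have "i \<noteq> n" "j \<noteq> n" using n by auto
    then show ?thesis using ij A
      unfolding star_mesh_def sum_Xn mixed_weights_def er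
      by (simp add: Xn) (simp add: U conductance_def a_def field_simps)
  qed
  have form_star: "dirichlet_form ?V (star_mesh ?V n ?X) \<phi> = dirichlet_form ?V ?Y \<psi>"
    if "\<And>k. k \<in> ?V \<Longrightarrow> \<phi> k = \<psi> k" for \<phi> \<psi>
    unfolding dirichlet_form_def
    using that edges_subset_Pow
    by (intro sum.cong refl arg_cong2[where f = "(*)"] star grad_sq_cong) blast+
  define m where "m = (\<Sum>k\<in>?V. ?X {n, k} * pinned \<Lambda> s k) / a"
  have U_eq: "pinned (insert n \<Lambda>) (u(n := x)) = U" and S_eq: "\<And>y. pinned (insert n \<Lambda>) (s(n := y)) = S y"
    by (simp_all add: U_def S_def pinned_insert)
  have VV: "insert \<rho> (insert n \<Lambda>) = insert n ?V" by auto
  have formS: "dirichlet_form (insert n ?V) ?X (S y) = a * (y - m)\<^sup>2 + dirichlet_form ?V ?Y (pinned \<Lambda> s)" for y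
  proof -
    have "(\<Sum>k\<in>?V. ?X {n, k} * S y k) = (\<Sum>k\<in>?V. ?X {n, k} * pinned \<Lambda> s k)"
      by (rule sum.cong) (use U S in auto)
    moreover have "dirichlet_form ?V (star_mesh ?V n ?X) (S y) = dirichlet_form ?V ?Y (pinned \<Lambda> s)"
      by (rule form_star) (use U S in auto)
    ultimately show ?thesis
      using dirichlet_form_insert[OF V(1) n' sum_Xn, of "S y"] a S(1) by (simp add: m_def)
  qed
  have formU: "dirichlet_form (insert n ?V) ?X (\<lambda>k. exp (- U k)) =
      (exp (- r) - 2 * c + c\<^sup>2 * exp r) + dirichlet_form ?V ?Y (\<lambda>k. exp (- pinned \<Lambda> u k))"
  proof -
    have "(\<Sum>k\<in>?V. ?X {n, k} * exp (- U k)) = (\<Sum>k\<in>?V. exp x * w {n, k})"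
    proof (rule sum.cong[OF refl])
      fix k assume k: "k \<in> ?V"
      then have "k \<noteq> n" using n by auto
      then show "?X {n, k} * exp (- U k) = exp x * w {n, k}"
        using Xn[OF k] U k by (simp add: exp_minus field_simps)
    qed
    then have 1: "(\<Sum>k\<in>?V. ?X {n, k} * exp (- U k)) = exp x * c" by (simp add: c_def sum_distrib_left)
    have 2: "dirichlet_form ?V (star_mesh ?V n ?X) (\<lambda>k. exp (- U k)) = dirichlet_form ?V ?Y (\<lambda>k. exp (- pinned \<Lambda> u k))"
      by (rule form_star) (use U S in auto)
    have 3: "a * (exp (- x) - exp x * c / a)\<^sup>2 = exp (- r) - 2 * c + c\<^sup>2 * exp r"
      using A unfolding exp_minus[of r] er unfolding a_def
      by (simp add: exp_minus field_simps power2_eq_square)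
    show ?thesis
      using dirichlet_form_insert[OF V(1) n' sum_Xn, of "\<lambda>k. exp (- U k)"] a 3
      unfolding 1 2 U(1) by simp
  qed
  have det: "laplacian_det (insert n \<Lambda>) \<rho> ?X = a * laplacian_det \<Lambda> \<rho> ?Y"
    using laplacian_det_insert[OF fin n sum_Xn] a laplacian_det_cong[OF star] by simp
  have prod: "(\<Prod>i\<in>insert n \<Lambda>. exp (- (u(n := x)) i) / (2 * pi)) =
      exp (- x) / (2 * pi) * (\<Prod>i\<in>\<Lambda>. exp (- u i) / (2 * pi))"
    using fin n by (subst prod.insert) (auto intro!: arg_cong2[where f = "(*)"] prod.cong)
  have "edge_density (insert n \<Lambda>) \<rho> w (u(n := x)) (s(n := y)) =
      exp (- (exp (- r) - 2 * c + c\<^sup>2 * exp r) / 2) * (A / (2 * pi)) * exp (- (exp x * A * (y - m)\<^sup>2) / 2) *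
      edge_density \<Lambda> \<rho> (mixed_weights n r w) u s" for y
  proof -
    have aA: "a * (exp (- x) / (2 * pi)) = A / (2 * pi)"
      by (simp add: a_def exp_minus field_simps)
    have split: "exp (- ((K + F) + (a * q + G)) / 2) * (a * L) * (exp (- x) / (2 * pi) * P) =
        exp (- K / 2) * (A / (2 * pi)) * exp (- (exp x * A * q) / 2) * (exp (- (F + G) / 2) * L * P)"
      for K F q G L P :: real
    proof -
      have "exp (- ((K + F) + (a * q + G)) / 2) = exp (- K / 2) * exp (- (a * q) / 2) * exp (- (F + G) / 2)"
        by (simp add: exp_add[symmetric] field_simps)
      then show ?thesis unfolding aA[symmetric] a_def by (simp only: mult_ac)
    qed
    show ?thesis
      unfolding edge_density_def U_eq S_eq VV formS formU det prod by (rule split)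
  qed
  then show "\<exists>m. \<forall>y. edge_density (insert n \<Lambda>) \<rho> w (u(n := x)) (s(n := y)) =
      exp (- (exp (- (x - ln A)) - 2 * c + c\<^sup>2 * exp (x - ln A)) / 2) * (A / (2 * pi)) *
      exp (- (exp x * A * (y - m)\<^sup>2) / 2) *
      edge_density \<Lambda> \<rho> (mixed_weights n (x - ln A) w) u s"
    unfolding r_def[symmetric] by blast
qed

section \<open>Measurability of the density and its normalisation\<close>

abbreviation field_space :: "'v set \<Rightarrow> ('v \<Rightarrow> real) measure" where
  "field_space \<Lambda> \<equiv> Pi\<^sub>M \<Lambda> (\<lambda>_. lborel)"

interpretation lborel_product: product_sigma_finite "\<lambda>_ :: 'v. lborel :: real measure"
  by (simp add: product_sigma_finite_def lborel.sigma_finite_measure_axioms)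

lemma sigma_finite_field_space: "finite \<Lambda> \<Longrightarrow> sigma_finite_measure (field_space \<Lambda>)"
  by (rule lborel_product.sigma_finite)

lemma pinned_measurable [measurable (raw)]:
  assumes "U \<in> M \<rightarrow>\<^sub>M field_space \<Lambda>"
  shows "(\<lambda>x. pinned \<Lambda> (U x) k) \<in> borel_measurable M"
proof (cases "k \<in> \<Lambda>")
  case True
  have "(\<lambda>x. U x k) \<in> M \<rightarrow>\<^sub>M lborel"
    by (rule measurable_compose[OF assms measurable_component_singleton[OF True]])
  then show ?thesis using True by (simp add: pinned_def)
qed (simp add: pinned_def)

lemma det_on_measurable:
  assumes "\<And>i j. (\<lambda>x. A x i j) \<in> borel_measurable M"
  shows "(\<lambda>x. det_on I (A x)) \<in> borel_measurable M"
  unfolding det_on_def using assms by measurable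

lemma laplacian_det_measurable:
  assumes [measurable]: "\<And>e. (\<lambda>x. w x e) \<in> borel_measurable M"
  shows "(\<lambda>x. laplacian_det \<Lambda> \<rho> (w x)) \<in> borel_measurable M"
  unfolding laplacian_det_def
proof (rule det_on_measurable)
  fix i j
  show "(\<lambda>x. laplacian \<Lambda> \<rho> (w x) i j) \<in> borel_measurable M"
    unfolding laplacian_def by (cases "i = j") (simp_all, measurable)
qed

lemma conductance_measurable:
  assumes [measurable]: "(\<lambda>x. w x e) \<in> borel_measurable M" "U \<in> M \<rightarrow>\<^sub>M field_space \<Lambda>"
  shows "(\<lambda>x. conductance (w x) (pinned \<Lambda> (U x)) e) \<in> borel_measurable M"
  unfolding conductance_def by measurable

lemma dirichlet_form_measurable:
  assumes [measurable]: "\<And>e. (\<lambda>x. w x e) \<in> borel_measurable M" "\<And>k. (\<lambda>x. \<phi> x k) \<in> borel_measurable M"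
  shows "(\<lambda>x. dirichlet_form V (w x) (\<phi> x)) \<in> borel_measurable M"
  unfolding dirichlet_form_def grad_sq_def by measurable

lemma edge_density_measurable:
  assumes w: "\<And>e. (\<lambda>x. w x e) \<in> borel_measurable M"
    and U: "U \<in> M \<rightarrow>\<^sub>M field_space \<Lambda>" and S: "S \<in> M \<rightarrow>\<^sub>M field_space \<Lambda>"
  shows "(\<lambda>x. edge_density \<Lambda> \<rho> (w x) (U x) (S x)) \<in> borel_measurable M"
proof -
  note [measurable] = U S
  have [measurable]: "\<And>e. (\<lambda>x. conductance (w x) (pinned \<Lambda> (U x)) e) \<in> borel_measurable M"
    by (intro conductance_measurable w U)
  have [measurable]: "(\<lambda>x. U x i) \<in> borel_measurable M" if "i \<in> \<Lambda>" for i
    using pinned_measurable[OF U, of i] that by (simp add: pinned_def)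
  have [measurable]: "(\<lambda>x. dirichlet_form (insert \<rho> \<Lambda>) (conductance (w x) (pinned \<Lambda> (U x))) (\<lambda>k. exp (- pinned \<Lambda> (U x) k))) \<in> borel_measurable M"
    by (rule dirichlet_form_measurable) measurable
  have [measurable]: "(\<lambda>x. dirichlet_form (insert \<rho> \<Lambda>) (conductance (w x) (pinned \<Lambda> (U x))) (pinned \<Lambda> (S x))) \<in> borel_measurable M"
    by (rule dirichlet_form_measurable) measurable
  have [measurable]: "(\<lambda>x. laplacian_det \<Lambda> \<rho> (conductance (w x) (pinned \<Lambda> (U x)))) \<in> borel_measurable M"
    by (rule laplacian_det_measurable) measurable
  show ?thesis unfolding edge_density_def by measurable
qed

text \<open>The Gaussian integral turns the prefactor \<open>A / (2 * pi)\<close> into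
  \<open>exp (- r / 2) / sqrt (2 * pi)\<close>, the prefactor of the mixing kernel.\<close>

lemma nn_integral_edge_density_insert:
  fixes \<rho> :: "'v :: linorder"
  assumes fin: "finite \<Lambda>" and \<rho>: "\<rho> \<notin> \<Lambda>" and n: "n \<notin> insert \<rho> \<Lambda>"
    and w: "\<And>e. e \<in> edges (insert \<rho> (insert n \<Lambda>)) \<Longrightarrow> w e > 0"
    and A_def: "A = (\<Sum>k\<in>insert \<rho> \<Lambda>. w {n, k} * exp (pinned \<Lambda> u k))"
    and c_def: "c = (\<Sum>k\<in>insert \<rho> \<Lambda>. w {n, k})"
  shows "(\<integral>\<^sup>+y. ennreal (edge_density (insert n \<Lambda>) \<rho> w (u(n := x)) (s(n := y))) \<partial>lborel) =
     ennreal (mixing_kernel c (x - ln A) * edge_density \<Lambda> \<rho> (mixed_weights n (x - ln A) w) u s)"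
proof -
  let ?r = "x - ln A"
  let ?D = "edge_density \<Lambda> \<rho> (mixed_weights n ?r w) u s"
  let ?K = "exp (- (exp (- ?r) - 2 * c + c\<^sup>2 * exp ?r) / 2)"
  have w_n: "w {n, k} > 0" if "k \<in> insert \<rho> \<Lambda>" for k
    using that n by (intro w doubleton_in_edges) auto
  note step = edge_density_insert[OF fin n w_n A_def c_def]
  have A: "A > 0" by (rule step(1))
  obtain m where m: "\<And>y. edge_density (insert n \<Lambda>) \<rho> w (u(n := x)) (s(n := y)) =
      ?K * (A / (2 * pi)) * exp (- (exp x * A * (y - m)\<^sup>2) / 2) * ?D"
    using step(2)[of x s] by blast
  have "?D \<ge> 0"
  proof (rule edge_density_nonneg[OF fin \<rho>])
    fix e assume e: "e \<in> edges (insert \<rho> \<Lambda>)"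
    then have "w e > 0" "\<And>k. k \<in> e \<Longrightarrow> w {n, k} > 0"
      using w w_n by (auto simp: edges_def)
    then show "mixed_weights n ?r w e \<ge> 0"
      unfolding mixed_weights_def by (intro add_nonneg_nonneg mult_nonneg_nonneg prod_nonneg) (auto intro: less_imp_le)
  qed
  define C where "C = ?K * (A / (2 * pi)) * ?D"
  have C: "C \<ge> 0" using \<open>?D \<ge> 0\<close> A by (simp add: C_def)
  have "(\<integral>\<^sup>+y. ennreal (edge_density (insert n \<Lambda>) \<rho> w (u(n := x)) (s(n := y))) \<partial>lborel) =
      (\<integral>\<^sup>+y. ennreal C * ennreal (exp (- (exp x * A * (y - m)\<^sup>2) / 2)) \<partial>lborel)"
    unfolding m using C by (intro nn_integral_cong) (simp add: C_def ennreal_mult[symmetric] mult_ac)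
  also have "\<dots> = ennreal C * (\<integral>\<^sup>+y. ennreal (exp (- (exp x * A * (y - m)\<^sup>2) / 2)) \<partial>lborel)"
    by (rule nn_integral_cmult) measurable
  also have "\<dots> = ennreal (C * sqrt (2 * pi / (exp x * A)))"
    using A C by (subst nn_integral_gaussian) (auto simp: ennreal_mult)
  also have "C * sqrt (2 * pi / (exp x * A)) = mixing_kernel c ?r * ?D"
  proof -
    have key: "A / (2 * pi) * sqrt (2 * pi / (exp x * A)) = exp (- ?r / 2) / sqrt (2 * pi)"
    proof (rule power2_eq_imp_eq)
      have "exp (- ?r / 2) * exp (- ?r / 2) = exp (- ?r)" by (simp add: exp_add[symmetric])
      also have "\<dots> = A / exp x" using A by (simp add: exp_diff)
      finally show "(A / (2 * pi) * sqrt (2 * pi / (exp x * A)))\<^sup>2 = (exp (- ?r / 2) / sqrt (2 * pi))\<^sup>2"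
        using A unfolding power_mult_distrib power_divide by (simp add: power2_eq_square field_simps)
    qed (use A in auto)
    show ?thesis unfolding C_def mixing_kernel_def key[symmetric] by (simp only: mult_ac)
  qed
  finally show ?thesis .
qed

text \<open>For fixed \<open>r\<close> the mixed weights no longer depend on the fields and stay
  positive, so the induction hypothesis gives 1 for every \<open>r\<close>; what remains is the
  integral of the mixing kernel.\<close>

theorem edge_density_normalized:
  fixes \<rho> :: "'v :: linorder"
  assumes "finite \<Lambda>" "\<rho> \<notin> \<Lambda>" "\<And>e. e \<in> edges (insert \<rho> \<Lambda>) \<Longrightarrow> w e > 0"
  shows "(\<integral>\<^sup>+u. \<integral>\<^sup>+s. ennreal (edge_density \<Lambda> \<rho> w u s) \<partial>field_space \<Lambda> \<partial>field_space \<Lambda>) = 1"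
  using assms
proof (induction \<Lambda> arbitrary: w)
  case empty
  have "edges {\<rho>} = {}" by (auto simp: edges_def)
  then have "edge_density {} \<rho> w u s = 1" for u s
    by (simp add: edge_density_def dirichlet_form_def laplacian_det_def det_on_def)
  then show ?case by (simp add: PiM_empty)
next
  case (insert n \<Lambda>)
  let ?V = "insert \<rho> \<Lambda>" and ?P = "field_space \<Lambda>"
  have fin: "finite \<Lambda>" and \<rho>: "\<rho> \<notin> \<Lambda>" and n: "n \<notin> ?V" and n\<Lambda>: "n \<notin> \<Lambda>" using insert by auto
  interpret P: sigma_finite_measure ?P by (rule sigma_finite_field_space[OF fin])
  interpret PI: sigma_finite_measure "field_space (insert n \<Lambda>)" by (rule sigma_finite_field_space) (use fin in auto)
  interpret LP: pair_sigma_finite lborel ?P ..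
  define c where "c = (\<Sum>k\<in>?V. w {n, k})"
  have w_n: "w {n, k} > 0" if "k \<in> ?V" for k
    using that n by (intro insert.prems doubleton_in_edges) auto
  have c: "c > 0" unfolding c_def using fin w_n by (intro sum_pos) auto
  define A where "A u = (\<Sum>k\<in>?V. w {n, k} * exp (pinned \<Lambda> u k))" for u
  define G where "G r u s = mixing_kernel c r * edge_density \<Lambda> \<rho> (mixed_weights n r w) u s" for r u s
  have w_pos: "mixed_weights n r w e > 0" if "e \<in> edges ?V" for r e
  proof -
    have "w e > 0" "\<And>k. k \<in> e \<Longrightarrow> w {n, k} > 0"
      using that insert.prems w_n by (auto simp: edges_def)
    then show ?thesis
      unfolding mixed_weights_def by (intro add_pos_nonneg mult_nonneg_nonneg prod_nonneg) (auto intro: less_imp_le)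
  qed
  have dens_nonneg: "edge_density \<Lambda> \<rho> (mixed_weights n r w) u s \<ge> 0" for r u s
    by (rule edge_density_nonneg[OF fin \<rho>]) (rule less_imp_le[OF w_pos])
  have [measurable]: "(\<lambda>x. mixed_weights n (R x) w e) \<in> borel_measurable M" if "R \<in> borel_measurable M" for R e and M :: "'x measure"
    using that unfolding mixed_weights_def by measurable
  have dens_meas: "(\<lambda>x. edge_density \<Lambda> \<rho> (mixed_weights n (R x) w) (U x) (S x)) \<in> borel_measurable M"
    if "R \<in> borel_measurable M" "U \<in> M \<rightarrow>\<^sub>M ?P" "S \<in> M \<rightarrow>\<^sub>M ?P" for R U S and M :: "'x measure"
    using that by (intro edge_density_measurable) (measurable, simp_all)
  have G_meas: "(\<lambda>x. ennreal (G (R x) (U x) (S x))) \<in> borel_measurable M"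
    if [measurable]: "R \<in> borel_measurable M" "U \<in> M \<rightarrow>\<^sub>M ?P" "S \<in> M \<rightarrow>\<^sub>M ?P" for R U S and M :: "'x measure"
  proof -
    have [measurable]: "(\<lambda>x. edge_density \<Lambda> \<rho> (mixed_weights n (R x) w) (U x) (S x)) \<in> borel_measurable M"
      by (rule dens_meas) measurable
    show ?thesis unfolding G_def by measurable
  qed
  let ?F = "\<lambda>u s. ennreal (edge_density (insert n \<Lambda>) \<rho> w u s)"
  have F_meas: "(\<lambda>x. ?F (U x) (S x)) \<in> borel_measurable M"
    if "U \<in> M \<rightarrow>\<^sub>M field_space (insert n \<Lambda>)" "S \<in> M \<rightarrow>\<^sub>M field_space (insert n \<Lambda>)" for U S and M :: "'x measure"
    by (intro measurable_compose[OF _ measurable_ennreal] edge_density_measurable that) simp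
  have inner: "(\<integral>\<^sup>+s. ?F (u(n := x)) s \<partial>field_space (insert n \<Lambda>)) = (\<integral>\<^sup>+s. ennreal (G (x - ln (A u)) u s) \<partial>?P)"
    if u: "u \<in> space ?P" for u x
  proof -
    have ux: "u(n := x) \<in> space (field_space (insert n \<Lambda>))"
      using u by (auto simp: space_PiM PiE_def extensional_def)
    have "(\<integral>\<^sup>+s. ?F (u(n := x)) s \<partial>field_space (insert n \<Lambda>)) = (\<integral>\<^sup>+s. \<integral>\<^sup>+y. ?F (u(n := x)) (s(n := y)) \<partial>lborel \<partial>?P)"
      using F_meas[of "\<lambda>_. u(n := x)" _ "\<lambda>s. s"] ux
      by (intro lborel_product.product_nn_integral_insert fin n\<Lambda>) auto
    also have "\<dots> = (\<integral>\<^sup>+s. ennreal (G (x - ln (A u)) u s) \<partial>?P)"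
      unfolding G_def
      by (intro nn_integral_cong nn_integral_edge_density_insert fin \<rho> n insert.prems A_def c_def)
    finally show ?thesis .
  qed
  have "(\<integral>\<^sup>+u. \<integral>\<^sup>+s. ?F u s \<partial>field_space (insert n \<Lambda>) \<partial>field_space (insert n \<Lambda>)) =
      (\<integral>\<^sup>+u. \<integral>\<^sup>+x. \<integral>\<^sup>+s. ?F (u(n := x)) s \<partial>field_space (insert n \<Lambda>) \<partial>lborel \<partial>?P)"
  proof (rule lborel_product.product_nn_integral_insert[OF fin n\<Lambda>])
    have "(\<lambda>x. ?F (fst x) (snd x)) \<in> borel_measurable (field_space (insert n \<Lambda>) \<Otimes>\<^sub>M field_space (insert n \<Lambda>))"
      by (rule F_meas) measurable
    then show "(\<lambda>u. \<integral>\<^sup>+s. ?F u s \<partial>field_space (insert n \<Lambda>)) \<in> borel_measurable (field_space (insert n \<Lambda>))"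
      by (intro PI.borel_measurable_nn_integral) (simp add: case_prod_beta)
  qed
  also have "\<dots> = (\<integral>\<^sup>+u. \<integral>\<^sup>+x. \<integral>\<^sup>+s. ennreal (G (x - ln (A u)) u s) \<partial>?P \<partial>lborel \<partial>?P)"
    by (intro nn_integral_cong inner)
  \<comment> \<open>Translation by \<open>ln (A u)\<close> for fixed \<open>u\<close>; only now can
    the \<open>r\<close>-integral be moved outside.\<close>
  also have "\<dots> = (\<integral>\<^sup>+u. \<integral>\<^sup>+r. \<integral>\<^sup>+s. ennreal (G r u s) \<partial>?P \<partial>lborel \<partial>?P)"
  proof (rule nn_integral_cong)
    fix u assume u: "u \<in> space ?P"
    have "(\<lambda>x. \<integral>\<^sup>+s. ennreal (G (x - ln (A u)) u s) \<partial>?P) \<in> borel_measurable borel"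
    proof -
      have "(\<lambda>x. ennreal (G (fst x - ln (A u)) u (snd x))) \<in> borel_measurable (borel \<Otimes>\<^sub>M ?P)"
        by (rule G_meas) (use u in measurable)
      then show ?thesis by (intro P.borel_measurable_nn_integral) (simp add: case_prod_beta)
    qed
    then show "(\<integral>\<^sup>+x. \<integral>\<^sup>+s. ennreal (G (x - ln (A u)) u s) \<partial>?P \<partial>lborel) = (\<integral>\<^sup>+r. \<integral>\<^sup>+s. ennreal (G r u s) \<partial>?P \<partial>lborel)"
      by (subst nn_integral_real_affine[of _ 1 "ln (A u)"]) auto
  qed
  also have "\<dots> = (\<integral>\<^sup>+r. \<integral>\<^sup>+u. \<integral>\<^sup>+s. ennreal (G r u s) \<partial>?P \<partial>?P \<partial>lborel)"
  proof (rule LP.Fubini')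
    have "(\<lambda>x. ennreal (G (fst (fst x)) (snd (fst x)) (snd x))) \<in> borel_measurable ((lborel \<Otimes>\<^sub>M ?P) \<Otimes>\<^sub>M ?P)"
      by (rule G_meas) measurable
    then have "(\<lambda>x. \<integral>\<^sup>+s. ennreal (G (fst x) (snd x) s) \<partial>?P) \<in> borel_measurable (lborel \<Otimes>\<^sub>M ?P)"
      by (intro P.borel_measurable_nn_integral) (simp add: case_prod_beta)
    then show "(\<lambda>(r, u). \<integral>\<^sup>+s. ennreal (G r u s) \<partial>?P) \<in> borel_measurable (lborel \<Otimes>\<^sub>M ?P)"
      by (simp add: case_prod_beta)
  qed
  also have "\<dots> = (\<integral>\<^sup>+r. ennreal (mixing_kernel c r) \<partial>lborel)"
  proof (rule nn_integral_cong)
    fix r :: real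
    have "(\<integral>\<^sup>+u. \<integral>\<^sup>+s. ennreal (G r u s) \<partial>?P \<partial>?P) =
        (\<integral>\<^sup>+u. \<integral>\<^sup>+s. ennreal (mixing_kernel c r) * ennreal (edge_density \<Lambda> \<rho> (mixed_weights n r w) u s) \<partial>?P \<partial>?P)"
      unfolding G_def using dens_nonneg mixing_kernel_nonneg by (simp add: ennreal_mult)
    also have "\<dots> = (\<integral>\<^sup>+u. ennreal (mixing_kernel c r) * (\<integral>\<^sup>+s. ennreal (edge_density \<Lambda> \<rho> (mixed_weights n r w) u s) \<partial>?P) \<partial>?P)"
      by (intro nn_integral_cong nn_integral_cmult measurable_compose[OF _ measurable_ennreal] dens_meas) simp_all
    also have "\<dots> = ennreal (mixing_kernel c r) * (\<integral>\<^sup>+u. \<integral>\<^sup>+s. ennreal (edge_density \<Lambda> \<rho> (mixed_weights n r w) u s) \<partial>?P \<partial>?P)"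
    proof (rule nn_integral_cmult)
      have "(\<lambda>x. ennreal (edge_density \<Lambda> \<rho> (mixed_weights n r w) (fst x) (snd x))) \<in> borel_measurable (?P \<Otimes>\<^sub>M ?P)"
        by (intro measurable_compose[OF _ measurable_ennreal] dens_meas) measurable
      then show "(\<lambda>u. \<integral>\<^sup>+s. ennreal (edge_density \<Lambda> \<rho> (mixed_weights n r w) u s) \<partial>?P) \<in> borel_measurable ?P"
        by (intro P.borel_measurable_nn_integral) (simp add: case_prod_beta)
    qed
    also have "(\<integral>\<^sup>+u. \<integral>\<^sup>+s. ennreal (edge_density \<Lambda> \<rho> (mixed_weights n r w) u s) \<partial>?P \<partial>?P) = 1"
      by (rule insert.IH[OF \<rho> w_pos])
    finally show "(\<integral>\<^sup>+u. \<integral>\<^sup>+s. ennreal (G r u s) \<partial>?P \<partial>?P) = ennreal (mixing_kernel c r)" by simp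
  qed
  also have "\<dots> = 1" by (rule nn_integral_mixing_kernel[OF c])
  finally show ?case .
qed

section \<open>Ward identities\<close>

lemma tendsto_if_dist_le:
  fixes f :: "nat \<Rightarrow> real"
  assumes "\<And>n. \<bar>f n - l\<bar> \<le> 2 / (real n + 1)"
  shows "f \<longlonglongrightarrow> l"
proof -
  have "(\<lambda>n. 2 * (1 / (real n + 1))) \<longlonglongrightarrow> 2 * 0"
    by (intro tendsto_mult tendsto_const) (use LIMSEQ_inverse_real_of_nat in \<open>simp add: inverse_eq_divide add_ac\<close>)
  then have "(\<lambda>n. 2 / (real n + 1)) \<longlonglongrightarrow> 0" by simp
  then have "(\<lambda>n. f n - l) \<longlonglongrightarrow> 0"
    by (rule Lim_null_comparison[rotated]) (use assms in auto)
  then show ?thesis by (simp add: LIM_zero_iff)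
qed

text \<open>The half-line from 1 is the range of \<open>B\<close>. The sign of \<open>g\<close>
  makes g / f the conductance: it is \<open>w\<close> for \<open>exp (- w * b)\<close>.\<close>

definition compactly_supported_C1 :: "(real \<Rightarrow> real) \<Rightarrow> (real \<Rightarrow> real) \<Rightarrow> bool" where
  "compactly_supported_C1 f g \<longleftrightarrow>
     (\<forall>b\<ge>1. (f has_real_derivative - g b) (at b)) \<and> continuous_on {1..} g \<and>
     (\<exists>K. \<forall>b\<ge>K. f b = 0 \<and> g b = 0)"

text \<open>Exponents start at 2: one factor \<open>exp (- b)\<close> provides the integrable
  majorant, the other reflects that the approximating polynomials have no constant term.\<close>

definition exp_sum :: "(nat \<Rightarrow> real) \<Rightarrow> nat \<Rightarrow> real \<Rightarrow> real" where
  "exp_sum a n b = (\<Sum>i<n. a i * exp (- (real i + 2) * b))"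

definition exp_sum_deriv :: "(nat \<Rightarrow> real) \<Rightarrow> nat \<Rightarrow> real \<Rightarrow> real" where
  "exp_sum_deriv a n b = (\<Sum>i<n. a i * ((real i + 2) * exp (- (real i + 2) * b)))"

text \<open>
  With \<open>x = exp (- b)\<close> this is the density of polynomials in \<open>C\<^sup>1[0, 1 / e]\<close>, applied to
  \<open>h x = f b / x\<close>, which vanishes near \<open>0\<close>.
\<close>

lemma exp_sum_approximation:
  assumes "compactly_supported_C1 f g"
  shows "\<exists>a n C. (\<forall>b\<ge>1. (\<lambda>j. exp_sum (a j) (n j) b) \<longlonglongrightarrow> f b) \<and>
      (\<forall>b\<ge>1. (\<lambda>j. exp_sum_deriv (a j) (n j) b) \<longlonglongrightarrow> g b) \<and>
      (\<forall>j. \<forall>b\<ge>1. \<bar>exp_sum (a j) (n j) b\<bar> \<le> C * exp (- b)) \<and>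
      (\<forall>j. \<forall>b\<ge>1. \<bar>exp_sum_deriv (a j) (n j) b\<bar> \<le> C * exp (- b))"
proof -
  from assms obtain K0 where der: "\<And>b. b \<ge> 1 \<Longrightarrow> (f has_real_derivative - g b) (at b)"
    and cont_g: "continuous_on {1..} g" and K0: "\<And>b. b \<ge> K0 \<Longrightarrow> f b = 0 \<and> g b = 0"
    unfolding compactly_supported_C1_def by blast
  define K where "K = max K0 1"
  have K: "K \<ge> 1" "\<And>b. b \<ge> K \<Longrightarrow> f b = 0 \<and> g b = 0" using K0 by (auto simp: K_def)
  have cont_f: "continuous_on {1..} f"
    using der by (meson DERIV_isCont atLeast_iff continuous_at_imp_continuous_on)
  define I where "I = {0..exp (- 1) :: real}"
  define h where "h x = f (- ln x) / x" for x
  \<comment> \<open>The derivative of \<open>h\<close>.\<close>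
  define k where "k x = (g (- ln x) - f (- ln x)) / x\<^sup>2" for x
  have ln_ge: "- ln x \<ge> 1" if "x \<in> I" "x > 0" for x
    using that ln_mono[of x "exp (-1)"] by (simp add: I_def)
  have small: "h x = 0" "k x = 0" if "0 \<le> x" "x \<le> exp (- K)" for x
  proof -
    have "- ln x \<ge> K" if "x > 0" using \<open>x \<le> exp (- K)\<close> that ln_mono[of x "exp (- K)"] by simp
    then show "h x = 0" "k x = 0" using K(2)[of "- ln x"] that by (cases "x = 0"; simp add: h_def k_def)+
  qed
  have der_h: "(h has_real_derivative k x) (at x within I)" if x: "x \<in> I" for x
  proof (cases "x = 0")
    case True
    have "((\<lambda>_. 0) has_real_derivative k x) (at x within I)"
      using small(2)[of 0] True by simp
    then show ?thesis
    proof (rule has_field_derivative_transform_within[of _ _ _ _ "exp (- K)"])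
      show "x \<in> I" by fact
      show "0 = h x'" if "x' \<in> I" "dist x' x < exp (- K)" for x'
        using small(1)[of x'] that True by (simp add: I_def dist_real_def)
    qed simp
  next
    case False
    with x have pos: "x > 0" by (simp add: I_def)
    have "((\<lambda>x. f (- ln x)) has_real_derivative (- g (- ln x)) * (- (1 / x))) (at x)"
      by (rule DERIV_chain2[where f = f and g = "\<lambda>x. - ln x"])
        (use der[OF ln_ge[OF x pos]] pos in \<open>auto intro!: derivative_eq_intros\<close>)
    then have "(h has_real_derivative k x) (at x)"
      unfolding h_def using pos
      by (auto intro!: derivative_eq_intros simp: k_def field_simps power2_eq_square)
    then show ?thesis by (rule has_field_derivative_at_within)
  qed
  have "compact I" by (simp add: I_def)
  have cont_k: "continuous_on I k"
  proof -
    have "continuous_on {exp (- K)..exp (- 1)} (\<lambda>x. g (- ln x))"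
      "continuous_on {exp (- K)..exp (- 1)} (\<lambda>x. f (- ln x))"
    proof -
      have ln: "continuous_on {exp (- K)..exp (- 1)} (\<lambda>x. - ln x)"
        by (intro continuous_intros) (auto dest: less_le_trans[OF exp_gt_zero])
      have sub: "(\<lambda>x. - ln x) ` {exp (- K)..exp (- 1)} \<subseteq> {1..}"
      proof (rule image_subsetI)
        fix x assume "x \<in> {exp (- K)..exp (- 1)}"
        then have "x > 0" using less_le_trans[OF exp_gt_zero, of "- K" x] by simp
        then have "x > 0" "x \<in> I" using \<open>x \<in> _\<close> by (auto simp: I_def)
        then show "- ln x \<in> {1..}" using ln_ge by simp
      qed
      show "continuous_on {exp (- K)..exp (- 1)} (\<lambda>x. g (- ln x))"
        "continuous_on {exp (- K)..exp (- 1)} (\<lambda>x. f (- ln x))"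
        using continuous_on_compose2[OF cont_g ln sub] continuous_on_compose2[OF cont_f ln sub] by auto
    qed
    then have "continuous_on {exp (- K)..exp (- 1)} k"
      unfolding k_def by (intro continuous_intros) (auto dest: less_le_trans[OF exp_gt_zero])
    moreover have "continuous_on {0..exp (- K)} k"
      using small(2) by (subst continuous_on_cong[OF refl, of _ _ "\<lambda>_. 0"]) auto
    moreover have "I = {0..exp (- K)} \<union> {exp (- K)..exp (- 1)}"
    unfolding I_def using K(1) by (intro ivl_disj_un_two_touch(4)[symmetric]) auto
    ultimately show ?thesis by (auto intro: continuous_on_closed_Un)
  qed
  have cont_h: "continuous_on I h"
    using der_h DERIV_continuous continuous_on_eq_continuous_within by blast
  obtain Ch where Ch: "\<And>x. x \<in> I \<Longrightarrow> \<bar>h x\<bar> \<le> Ch"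
    using compact_imp_bounded[OF compact_continuous_image[OF cont_h \<open>compact I\<close>]]
    unfolding bounded_iff by auto
  obtain Ck where Ck: "\<And>x. x \<in> I \<Longrightarrow> \<bar>k x\<bar> \<le> Ck"
    using compact_imp_bounded[OF compact_continuous_image[OF cont_k \<open>compact I\<close>]]
    unfolding bounded_iff by auto
  \<comment> \<open>Approximating the derivative \<open>k\<close> and integrating controls
    \<open>h\<close> and \<open>k\<close> together; approximating \<open>h\<close> would say nothing
    about \<open>k\<close>.\<close>
  have "\<exists>a N. \<forall>x\<in>I. \<bar>k x - (\<Sum>i\<le>N. a i * x ^ i)\<bar> \<le> 1 / (real j + 1)" for j :: nat
  proof -
    obtain q where q: "real_polynomial_function q" "\<And>x. x \<in> I \<Longrightarrow> \<bar>k x - q x\<bar> < 1 / (real j + 1)"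
      by (rule Stone_Weierstrass_real_polynomial_function[OF \<open>compact I\<close> cont_k, of "1 / (real j + 1)"]) auto
    from q(1) obtain a N where "q = (\<lambda>x. \<Sum>i\<le>N. a i * x ^ i)" unfolding real_polynomial_function_iff_sum by blast
    then show ?thesis using q(2) by (intro exI[of _ a] exI[of _ N]) (auto intro: less_imp_le)
  qed
  then obtain a N where aN: "\<And>j x. x \<in> I \<Longrightarrow> \<bar>k x - (\<Sum>i\<le>N j. a j i * x ^ i)\<bar> \<le> 1 / (real j + 1)" by metis
  \<comment> \<open>The primitive that vanishes at 0, as \<open>h\<close> does.\<close>
  define P where "P j x = (\<Sum>i\<le>N j. a j i / (real i + 1) * x ^ (i + 1))" for j x
  define Q where "Q j x = (\<Sum>i\<le>N j. a j i * x ^ i)" for j x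
  have der_P: "(P j has_real_derivative Q j x) (at x within I)" for j x
    unfolding P_def Q_def
  proof (rule DERIV_sum)
    fix i
    have "((\<lambda>x. a j i / (real i + 1) * x ^ (i + 1)) has_real_derivative
        a j i / (real i + 1) * (real (i + 1) * x ^ (i + 1 - Suc 0))) (at x within I)"
      by (intro DERIV_cmult DERIV_pow)
    moreover have "a j i / (real i + 1) * (real (i + 1) * x ^ (i + 1 - Suc 0)) = a j i * x ^ i"
      by (simp add: field_simps)
    ultimately show "((\<lambda>x. a j i / (real i + 1) * x ^ (i + 1)) has_real_derivative a j i * x ^ i) (at x within I)"
      by simp
  qed
  have hP: "\<bar>h x - P j x\<bar> \<le> x / (real j + 1)" if x: "x \<in> I" for x j
  proof -
    have "norm ((h x - P j x) - (h 0 - P j 0)) \<le> 1 / (real j + 1) * norm (x - 0)"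
    proof (rule field_differentiable_bound[of I])
      show "((\<lambda>x. h x - P j x) has_field_derivative k z - Q j z) (at z within I)" if "z \<in> I" for z
        by (intro DERIV_diff der_h der_P that)
      show "norm (k z - Q j z) \<le> 1 / (real j + 1)" if "z \<in> I" for z
        using aN[OF that, of j] by (simp add: Q_def)
    qed (use x in \<open>auto simp: I_def\<close>)
    moreover have "h 0 = 0" "P j 0 = 0" by (auto simp: h_def P_def)
    ultimately show ?thesis using x by (simp add: I_def)
  qed
  define A where "A j i = a j i / (real i + 1)" for j i
  have pow: "exp (- (real i + 2) * b) = exp (- b) * (exp (- b)) ^ (i + 1)" for i b
    by (simp add: exp_of_nat_mult[symmetric] exp_add[symmetric] algebra_simps)
  have F: "exp_sum (A j) (Suc (N j)) b = exp (- b) * P j (exp (- b))" for j b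
    unfolding exp_sum_def P_def A_def lessThan_Suc_atMost sum_distrib_left pow
    by (intro sum.cong) auto
  have G: "exp_sum_deriv (A j) (Suc (N j)) b = exp (- b) * P j (exp (- b)) + (exp (- b))\<^sup>2 * Q j (exp (- b))" for j b
    unfolding exp_sum_deriv_def P_def Q_def A_def lessThan_Suc_atMost sum_distrib_left pow sum.distrib[symmetric]
    by (intro sum.cong) (auto simp: field_simps power2_eq_square)
  have x: "exp (- b) \<in> I" "0 < exp (- b)" "exp (- b) \<le> 1" if "b \<ge> 1" for b
    using that by (auto simp: I_def)
  have f: "f b = exp (- b) * h (exp (- b))" for b by (simp add: h_def)
  have g: "g b = exp (- b) * h (exp (- b)) + (exp (- b))\<^sup>2 * k (exp (- b))" for b
    by (simp add: h_def k_def field_simps)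
  have j1: "1 / (real j + 1) \<le> 1" for j by simp
  have dF: "\<bar>exp_sum (A j) (Suc (N j)) b - f b\<bar> \<le> 1 / (real j + 1)" if b: "b \<ge> 1" for j b
  proof -
    have "\<bar>exp_sum (A j) (Suc (N j)) b - f b\<bar> = exp (- b) * \<bar>h (exp (- b)) - P j (exp (- b))\<bar>"
      unfolding F f right_diff_distrib[symmetric] abs_mult by (simp add: abs_minus_commute)
    also have "\<dots> \<le> 1 * (1 / (real j + 1))"
    proof (rule mult_mono)
      have "exp (- b) / (real j + 1) \<le> 1 / (real j + 1)"
        using x(3)[OF b] by (intro divide_right_mono) auto
      then show "\<bar>h (exp (- b)) - P j (exp (- b))\<bar> \<le> 1 / (real j + 1)"
        using hP[OF x(1)[OF b], of j] by linarith
    qed (use x(3)[OF b] in auto)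
    finally show ?thesis by simp
  qed
  have dG: "\<bar>exp_sum_deriv (A j) (Suc (N j)) b - g b\<bar> \<le> 2 / (real j + 1)" if b: "b \<ge> 1" for j b
  proof -
    have "exp_sum_deriv (A j) (Suc (N j)) b - g b =
        (exp_sum (A j) (Suc (N j)) b - f b) + (exp (- b))\<^sup>2 * (Q j (exp (- b)) - k (exp (- b)))"
      unfolding F G f g by (simp add: algebra_simps)
    also have "\<bar>\<dots>\<bar> \<le> 1 / (real j + 1) + 1 * (1 / (real j + 1))"
    proof (rule order_trans[OF abs_triangle_ineq add_mono])
      show "\<bar>exp_sum (A j) (Suc (N j)) b - f b\<bar> \<le> 1 / (real j + 1)" by (rule dF[OF b])
      show "\<bar>(exp (- b))\<^sup>2 * (Q j (exp (- b)) - k (exp (- b)))\<bar> \<le> 1 * (1 / (real j + 1))"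
        unfolding abs_mult using aN[OF x(1)[OF b], of j] x[OF b]
        by (intro mult_mono) (auto simp: Q_def abs_minus_commute power_le_one)
    qed
    finally show ?thesis by simp
  qed
  have PC: "\<bar>P j x\<bar> \<le> Ch + 1" if "x \<in> I" "x \<le> 1" for x j
  proof -
    have "\<bar>P j x\<bar> \<le> \<bar>h x\<bar> + \<bar>h x - P j x\<bar>" by simp
    also have "\<dots> \<le> Ch + 1"
    proof (rule add_mono)
      have "x / (real j + 1) \<le> 1" using that by (simp add: divide_le_eq)
      then show "\<bar>h x - P j x\<bar> \<le> 1" using hP[of x j] that by linarith
    qed (use Ch[of x] that in auto)
    finally show ?thesis .
  qed
  have QC: "\<bar>Q j x\<bar> \<le> Ck + 1" if "x \<in> I" for x j
  proof -
    have "\<bar>Q j x\<bar> \<le> \<bar>k x\<bar> + \<bar>k x - Q j x\<bar>" by simp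
    also have "\<dots> \<le> Ck + 1"
      using aN[of x j] Ck[of x] that j1[of j] unfolding Q_def[symmetric] by linarith
    finally show ?thesis .
  qed
  have Ch0: "Ch \<ge> 0" "Ck \<ge> 0" using Ch[of 0] Ck[of 0] by (auto simp: I_def)
  show ?thesis
  proof (intro exI[of _ A] exI[of _ "\<lambda>j. Suc (N j)"] exI[of _ "(Ch + 1) + (Ck + 1)"] conjI allI impI)
    fix b :: real assume b: "b \<ge> 1"
    show "(\<lambda>j. exp_sum (A j) (Suc (N j)) b) \<longlonglongrightarrow> f b"
    proof (rule tendsto_if_dist_le)
      fix j
      have "1 / (real j + 1) \<le> 2 / (real j + 1)" by (simp add: divide_right_mono)
      then show "\<bar>exp_sum (A j) (Suc (N j)) b - f b\<bar> \<le> 2 / (real j + 1)" using dF[OF b, of j] by linarith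
    qed
    show "(\<lambda>j. exp_sum_deriv (A j) (Suc (N j)) b) \<longlonglongrightarrow> g b"
      by (rule tendsto_if_dist_le) (rule dG[OF b])
    fix j
    have 1: "exp (- b) * \<bar>P j (exp (- b))\<bar> \<le> exp (- b) * (Ch + 1)"
      using PC[OF x(1,3)[OF b]] by (intro mult_left_mono) auto
    have 2: "(exp (- b))\<^sup>2 * \<bar>Q j (exp (- b))\<bar> \<le> exp (- b) * (Ck + 1)"
    proof -
      have "(exp (- b))\<^sup>2 \<le> exp (- b)" using x[OF b] by (simp add: power2_eq_square mult_left_le)
      then show ?thesis using QC[OF x(1)[OF b], of j] by (intro mult_mono) auto
    qed
    have "0 \<le> exp (- b) * (Ck + 1)" using Ch0 by simp
    then show "\<bar>exp_sum (A j) (Suc (N j)) b\<bar> \<le> (Ch + 1 + (Ck + 1)) * exp (- b)"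
      using 1 unfolding F abs_mult by (simp add: algebra_simps)
    have "\<bar>exp_sum_deriv (A j) (Suc (N j)) b\<bar> \<le> exp (- b) * \<bar>P j (exp (- b))\<bar> + (exp (- b))\<^sup>2 * \<bar>Q j (exp (- b))\<bar>"
      unfolding G by (rule order_trans[OF abs_triangle_ineq]) (simp add: abs_mult)
    then show "\<bar>exp_sum_deriv (A j) (Suc (N j)) b\<bar> \<le> (Ch + 1 + (Ck + 1)) * exp (- b)"
      using 1 2 by (simp add: algebra_simps)
  qed
qed

section \<open>The Ward density and its integral\<close>

definition det_coeff :: "'v set \<Rightarrow> 'v \<Rightarrow> 'v set set \<Rightarrow> real" where
  "det_coeff \<Lambda> \<rho> = (SOME c. (\<forall>S. c S \<ge> 0) \<and>
     (\<forall>w. laplacian_det \<Lambda> \<rho> w = (\<Sum>S\<in>Pow (edges (insert \<rho> \<Lambda>)). c S * (\<Prod>e\<in>S. w e))))"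

lemma det_coeff:
  assumes "finite \<Lambda>" "\<rho> \<notin> \<Lambda>"
  shows "det_coeff \<Lambda> \<rho> S \<ge> 0"
    and "laplacian_det \<Lambda> \<rho> w = (\<Sum>S\<in>Pow (edges (insert \<rho> \<Lambda>)). det_coeff \<Lambda> \<rho> S * (\<Prod>e\<in>S. w e))"
proof -
  have "\<exists>c. (\<forall>S. c S \<ge> 0) \<and>
     (\<forall>w. laplacian_det \<Lambda> \<rho> w = (\<Sum>S\<in>Pow (edges (insert \<rho> \<Lambda>)). c S * (\<Prod>e\<in>S. w e)))"
    using laplacian_det_expansion[OF assms] by metis
  from someI_ex[OF this] show "det_coeff \<Lambda> \<rho> S \<ge> 0"
    "laplacian_det \<Lambda> \<rho> w = (\<Sum>S\<in>Pow (edges (insert \<rho> \<Lambda>)). det_coeff \<Lambda> \<rho> S * (\<Prod>e\<in>S. w e))"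
    unfolding det_coeff_def by blast+
qed

text \<open>
  The density of the model in which \<open>exp (- W\<^sub>e B\<^sub>e)\<close> is replaced by \<open>f\<^sub>e (B\<^sub>e)\<close>, with \<open>g\<^sub>e = - f\<^sub>e'\<close>. The
  determinant of the conductances \<open>g\<^sub>e / f\<^sub>e\<close> is multiplied out, as \<open>f\<^sub>e\<close> may vanish.
\<close>

definition ward_density ::
    "'v::linorder set \<Rightarrow> 'v \<Rightarrow> ('v set \<Rightarrow> real \<Rightarrow> real) \<Rightarrow> ('v set \<Rightarrow> real \<Rightarrow> real) \<Rightarrow> ('v \<Rightarrow> real) \<Rightarrow> ('v \<Rightarrow> real) \<Rightarrow> real" where
  "ward_density \<Lambda> \<rho> f g u s =
    (\<Sum>S\<in>Pow (edges (insert \<rho> \<Lambda>)). det_coeff \<Lambda> \<rho> S *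
       (\<Prod>e\<in>edges (insert \<rho> \<Lambda>). if e \<in> S then g e (B_edge \<Lambda> u s e) * (\<Prod>k\<in>e. exp (pinned \<Lambda> u k))
                                       else f e (B_edge \<Lambda> u s e))) *
    (\<Prod>i\<in>\<Lambda>. exp (- u i) / (2 * pi))"

abbreviation double_field_space :: "'v set \<Rightarrow> (('v \<Rightarrow> real) \<times> ('v \<Rightarrow> real)) measure" where
  "double_field_space \<Lambda> \<equiv> field_space \<Lambda> \<Otimes>\<^sub>M field_space \<Lambda>"

lemma ward_density_eq:
  assumes fin: "finite \<Lambda>" "\<rho> \<notin> \<Lambda>"
    and nz: "\<And>e. e \<in> edges (insert \<rho> \<Lambda>) \<Longrightarrow> f e (B_edge \<Lambda> u s e) \<noteq> 0"
  shows "ward_density \<Lambda> \<rho> f g u s = (\<Prod>e\<in>edges (insert \<rho> \<Lambda>). f e (B_edge \<Lambda> u s e)) *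
    laplacian_det \<Lambda> \<rho> (conductance (\<lambda>e. g e (B_edge \<Lambda> u s e) / f e (B_edge \<Lambda> u s e)) (pinned \<Lambda> u)) *
    (\<Prod>i\<in>\<Lambda>. exp (- u i) / (2 * pi))"
proof -
  let ?E = "edges (insert \<rho> \<Lambda>)" and ?B = "\<lambda>e. B_edge \<Lambda> u s e"
  let ?X = "conductance (\<lambda>e. g e (?B e) / f e (?B e)) (pinned \<Lambda> u)"
  have E: "finite ?E" using fin by (simp add: finite_edges)
  have "(\<Prod>e\<in>?E. if e \<in> S then g e (?B e) * (\<Prod>k\<in>e. exp (pinned \<Lambda> u k)) else f e (?B e)) =
      (\<Prod>e\<in>?E. f e (?B e)) * (\<Prod>e\<in>S. ?X e)" if S: "S \<in> Pow ?E" for S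
  proof -
    have "(\<Prod>e\<in>?E. if e \<in> S then g e (?B e) * (\<Prod>k\<in>e. exp (pinned \<Lambda> u k)) else f e (?B e)) =
        (\<Prod>e\<in>?E. f e (?B e) * (if e \<in> S then ?X e else 1))"
      by (rule prod.cong) (use nz in \<open>auto simp: conductance_def\<close>)
    also have "\<dots> = (\<Prod>e\<in>?E. f e (?B e)) * (\<Prod>e\<in>?E \<inter> S. ?X e)"
      unfolding prod.distrib using E by (simp add: prod.inter_restrict)
    also have "?E \<inter> S = S" using S by auto
    finally show ?thesis .
  qed
  then show ?thesis
    unfolding ward_density_def det_coeff(2)[OF fin]
    by (simp add: sum_distrib_left mult_ac)
qed

text \<open>The model has \<open>B - 1\<close> in the exponent while \<open>f\<close> is evaluated
  at \<open>B\<close>; the factors \<open>f e 1\<close> make up for the difference.\<close>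

lemma ward_density_exp:
  assumes fin: "finite \<Lambda>" "\<rho> \<notin> \<Lambda>"
    and f: "\<And>e b. e \<in> edges (insert \<rho> \<Lambda>) \<Longrightarrow> f e b = exp (- w e * b)"
    and g: "\<And>e b. e \<in> edges (insert \<rho> \<Lambda>) \<Longrightarrow> g e b = w e * exp (- w e * b)"
  shows "ward_density \<Lambda> \<rho> f g u s = (\<Prod>e\<in>edges (insert \<rho> \<Lambda>). f e 1) * edge_density \<Lambda> \<rho> w u s"
proof -
  let ?E = "edges (insert \<rho> \<Lambda>)" and ?B = "\<lambda>e. B_edge \<Lambda> u s e"
  have E: "finite ?E" using fin by (simp add: finite_edges)
  have det: "laplacian_det \<Lambda> \<rho> (conductance (\<lambda>e. g e (?B e) / f e (?B e)) (pinned \<Lambda> u)) =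
      laplacian_det \<Lambda> \<rho> (conductance w (pinned \<Lambda> u))"
    by (rule laplacian_det_cong) (simp add: conductance_def f g)
  have "(\<Prod>e\<in>?E. f e (?B e)) = (\<Prod>e\<in>?E. f e 1) * exp (- (\<Sum>e\<in>?E. w e * (?B e - 1)))"
  proof -
    have "(\<Prod>e\<in>?E. f e 1) * exp (- (\<Sum>e\<in>?E. w e * (?B e - 1))) = (\<Prod>e\<in>?E. f e 1 * exp (- (w e * (?B e - 1))))"
      using E by (simp add: exp_sum sum_negf[symmetric] prod.distrib)
    also have "\<dots> = (\<Prod>e\<in>?E. f e (?B e))"
      by (rule prod.cong) (auto simp: f exp_add[symmetric] algebra_simps)
    finally show ?thesis by simp
  qed
  then show ?thesis
    using ward_density_eq[of \<Lambda> \<rho> f u s g, OF fin] f det by (simp add: edge_density_eq mult_ac)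
qed

lemma has_bochner_integral_edge_density:
  fixes \<rho> :: "'v :: linorder"
  assumes fin: "finite \<Lambda>" and \<rho>: "\<rho> \<notin> \<Lambda>" and w: "\<And>e. e \<in> edges (insert \<rho> \<Lambda>) \<Longrightarrow> w e > 0"
  shows "has_bochner_integral (double_field_space \<Lambda>) (\<lambda>(u, s). edge_density \<Lambda> \<rho> w u s) 1"
proof (rule has_bochner_integral_nn_integral)
  interpret P: sigma_finite_measure "field_space \<Lambda>" by (rule sigma_finite_field_space[OF fin])
  show meas: "(\<lambda>(u, s). edge_density \<Lambda> \<rho> w u s) \<in> borel_measurable (double_field_space \<Lambda>)"
    unfolding case_prod_beta by (rule edge_density_measurable) measurable
  show "AE x in double_field_space \<Lambda>. 0 \<le> (case x of (u, s) \<Rightarrow> edge_density \<Lambda> \<rho> w u s)"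
    using edge_density_nonneg[OF fin \<rho> less_imp_le[OF w]] by (auto intro!: AE_I2)
  have "(\<integral>\<^sup>+ x. ennreal (case x of (u, s) \<Rightarrow> edge_density \<Lambda> \<rho> w u s) \<partial>double_field_space \<Lambda>) =
      (\<integral>\<^sup>+u. \<integral>\<^sup>+s. ennreal (edge_density \<Lambda> \<rho> w u s) \<partial>field_space \<Lambda> \<partial>field_space \<Lambda>)"
    using meas by (subst P.nn_integral_fst[symmetric]) auto
  then show "(\<integral>\<^sup>+ x. ennreal (case x of (u, s) \<Rightarrow> edge_density \<Lambda> \<rho> w u s) \<partial>double_field_space \<Lambda>) = ennreal 1"
    using edge_density_normalized[OF fin \<rho> w] by simp
qed simp

text \<open>In the expanded determinant every term contains \<open>e0\<close> exactly once, through
  \<open>f e0\<close> or through \<open>g e0\<close>.\<close>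

lemma ward_density_linear:
  assumes fin: "finite \<Lambda>" and e0: "e0 \<in> edges (insert \<rho> \<Lambda>)"
    and f: "\<And>b. f e0 b = (\<Sum>i<n. a i * F i b)" and g: "\<And>b. g e0 b = (\<Sum>i<n. a i * G i b)"
  shows "ward_density \<Lambda> \<rho> f g u s = (\<Sum>i<n. a i * ward_density \<Lambda> \<rho> (f(e0 := F i)) (g(e0 := G i)) u s)"
proof -
  let ?E = "edges (insert \<rho> \<Lambda>)"
  have E: "finite ?E" using fin by (simp add: finite_edges)
  let ?h = "\<lambda>f g S e. if e \<in> S then g e (B_edge \<Lambda> u s e) * (\<Prod>k\<in>e. exp (pinned \<Lambda> u k)) else f e (B_edge \<Lambda> u s e) :: real"
  have split: "(\<Prod>e\<in>?E. ?h f' g' S e) = ?h f' g' S e0 * (\<Prod>e\<in>?E - {e0}. ?h f' g' S e)" for f' g' S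
    by (rule prod.remove[OF E e0])
  have rest: "(\<Prod>e\<in>?E - {e0}. ?h (f(e0 := F i)) (g(e0 := G i)) S e) = (\<Prod>e\<in>?E - {e0}. ?h f g S e)" for i S
    by (rule prod.cong) auto
  have e0_lin: "?h f g S e0 = (\<Sum>i<n. a i * ?h (f(e0 := F i)) (g(e0 := G i)) S e0)" for S
    by (simp add: f g sum_distrib_right mult.assoc)
  have "(\<Prod>e\<in>?E. ?h f g S e) = (\<Sum>i<n. a i * (\<Prod>e\<in>?E. ?h (f(e0 := F i)) (g(e0 := G i)) S e))" for S
    unfolding split rest e0_lin[of S] by (simp only: sum_distrib_right mult.assoc)
  then have "(\<Sum>S\<in>Pow ?E. det_coeff \<Lambda> \<rho> S * (\<Prod>e\<in>?E. ?h f g S e)) =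
      (\<Sum>S\<in>Pow ?E. \<Sum>i<n. a i * (det_coeff \<Lambda> \<rho> S * (\<Prod>e\<in>?E. ?h (f(e0 := F i)) (g(e0 := G i)) S e)))"
    by (simp only: sum_distrib_left mult.left_commute)
  also have "\<dots> = (\<Sum>i<n. a i * (\<Sum>S\<in>Pow ?E. det_coeff \<Lambda> \<rho> S * (\<Prod>e\<in>?E. ?h (f(e0 := F i)) (g(e0 := G i)) S e)))"
    by (subst sum.swap) (simp only: sum_distrib_left)
  finally show ?thesis unfolding ward_density_def by (simp only: sum_distrib_right mult.assoc)
qed

text \<open>Induction on the set \<open>F\<close> of edges that carry sums: by linearity one sum is
  replaced by its single exponentials. For empty \<open>F\<close> the identity is
  normalisation.\<close>

lemma ward_identity_exp_sum:
  fixes \<rho> :: "'v :: linorder"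
  assumes fin: "finite \<Lambda>" "\<rho> \<notin> \<Lambda>"
    and "F \<subseteq> edges (insert \<rho> \<Lambda>)"
    and "\<And>e. e \<in> F \<Longrightarrow> f e = exp_sum (a e) (n e) \<and> g e = exp_sum_deriv (a e) (n e)"
    and "\<And>e. e \<in> edges (insert \<rho> \<Lambda>) - F \<Longrightarrow>
      \<exists>w>0. f e = (\<lambda>b. exp (- w * b)) \<and> g e = (\<lambda>b. w * exp (- w * b))"
  shows "has_bochner_integral (double_field_space \<Lambda>) (\<lambda>(u, s). ward_density \<Lambda> \<rho> f g u s)
    (\<Prod>e\<in>edges (insert \<rho> \<Lambda>). f e 1)"
proof -
  let ?E = "edges (insert \<rho> \<Lambda>)"
  have E: "finite ?E" using fin by (simp add: finite_edges)
  have "finite F" using assms(3) E finite_subset by auto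
  then show ?thesis using assms(3-5)
  proof (induction F arbitrary: f g)
    case empty
    then have "\<forall>e\<in>?E. \<exists>w>0. f e = (\<lambda>b. exp (- w * b)) \<and> g e = (\<lambda>b. w * exp (- w * b))" by simp
    then obtain w where w: "\<And>e. e \<in> ?E \<Longrightarrow> w e > 0"
      "\<And>e b. e \<in> ?E \<Longrightarrow> f e b = exp (- w e * b)" "\<And>e b. e \<in> ?E \<Longrightarrow> g e b = w e * exp (- w e * b)"
      by (metis (no_types, lifting))
    have "has_bochner_integral (double_field_space \<Lambda>) (\<lambda>(u, s). edge_density \<Lambda> \<rho> w u s) 1"
      by (rule has_bochner_integral_edge_density[OF fin w(1)])
    from has_bochner_integral_mult_right[OF this, of "\<Prod>e\<in>?E. f e 1"]
    show ?case using ward_density_exp[of \<Lambda> \<rho> f w g, OF fin w(2,3)] by (simp add: case_prod_beta)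
  next
    case (insert e F)
    let ?x = "\<lambda>i b. exp (- (real i + 2) * b)" and ?y = "\<lambda>i b. (real i + 2) * exp (- (real i + 2) * b)"
    have e: "e \<in> ?E" using insert.prems by auto
    have fg: "f e = exp_sum (a e) (n e)" "g e = exp_sum_deriv (a e) (n e)" using insert.prems(2)[of e] by auto
    have lin: "ward_density \<Lambda> \<rho> f g u s =
        (\<Sum>i<n e. a e i * ward_density \<Lambda> \<rho> (f(e := ?x i)) (g(e := ?y i)) u s)" for u s
      by (rule ward_density_linear[OF fin(1) e]) (simp_all add: fg exp_sum_def exp_sum_deriv_def)
    have "has_bochner_integral (double_field_space \<Lambda>)
        (\<lambda>(u, s). ward_density \<Lambda> \<rho> (f(e := ?x i)) (g(e := ?y i)) u s) (\<Prod>e'\<in>?E. (f(e := ?x i)) e' 1)" for i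
    proof (rule insert.IH)
      show "F \<subseteq> ?E" using insert.prems by auto
      show "(f(e := ?x i)) e' = exp_sum (a e') (n e') \<and> (g(e := ?y i)) e' = exp_sum_deriv (a e') (n e')"
        if "e' \<in> F" for e'
        using that insert.hyps insert.prems(2)[of e'] by auto
      show "\<exists>w>0. (f(e := ?x i)) e' = (\<lambda>b. exp (- w * b)) \<and> (g(e := ?y i)) e' = (\<lambda>b. w * exp (- w * b))"
        if "e' \<in> ?E - F" for e'
      proof (cases "e' = e")
        case True
        then show ?thesis by (intro exI[of _ "real i + 2"]) auto
      next
        case False
        then show ?thesis using insert.prems(3)[of e'] that by auto
      qed
    qed
    then have "has_bochner_integral (double_field_space \<Lambda>)
        (\<lambda>x. \<Sum>i<n e. a e i * (case x of (u, s) \<Rightarrow> ward_density \<Lambda> \<rho> (f(e := ?x i)) (g(e := ?y i)) u s))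
        (\<Sum>i<n e. a e i * (\<Prod>e'\<in>?E. (f(e := ?x i)) e' 1))"
      by (intro has_bochner_integral_sum has_bochner_integral_mult_right) auto
    moreover have "(\<Sum>i<n e. a e i * (\<Prod>e'\<in>?E. (f(e := ?x i)) e' 1)) = (\<Prod>e'\<in>?E. f e' 1)"
    proof -
      have "(\<Prod>e'\<in>?E. (f(e := ?x i)) e' 1) = ?x i 1 * (\<Prod>e'\<in>?E - {e}. f e' 1)" for i
        unfolding prod.remove[OF E e] by (intro arg_cong2[where f = "(*)"] prod.cong) auto
      then show ?thesis
        unfolding prod.remove[OF E e, of "\<lambda>e'. f e' 1"] fg exp_sum_def by (simp add: sum_distrib_right mult.assoc)
    qed
    ultimately show ?case by (simp add: lin case_prod_beta)
  qed
qed

text \<open>Dominated convergence along exponential sums. The majorant is a multiple of the density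
  for \<open>exp (- b)\<close> on all edges, that is, of the model with all weights 1, which is
  integrable by normalisation.\<close>

theorem ward_identity:
  fixes \<rho> :: "'v :: linorder"
  assumes fin: "finite \<Lambda>" "\<rho> \<notin> \<Lambda>"
    and fg: "\<And>e. e \<in> edges (insert \<rho> \<Lambda>) \<Longrightarrow> compactly_supported_C1 (f e) (g e)"
  shows "has_bochner_integral (double_field_space \<Lambda>) (\<lambda>(u, s). ward_density \<Lambda> \<rho> f g u s)
    (\<Prod>e\<in>edges (insert \<rho> \<Lambda>). f e 1)"
proof -
  let ?E = "edges (insert \<rho> \<Lambda>)" and ?M = "double_field_space \<Lambda>"
  have E: "finite ?E" using fin by (simp add: finite_edges)
  have "\<forall>e\<in>?E. \<exists>a n C. (\<forall>b\<ge>1. (\<lambda>j. exp_sum (a j) (n j) b) \<longlonglongrightarrow> f e b) \<and>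
      (\<forall>b\<ge>1. (\<lambda>j. exp_sum_deriv (a j) (n j) b) \<longlonglongrightarrow> g e b) \<and>
      (\<forall>j. \<forall>b\<ge>1. \<bar>exp_sum (a j) (n j) b\<bar> \<le> C * exp (- b)) \<and>
      (\<forall>j. \<forall>b\<ge>1. \<bar>exp_sum_deriv (a j) (n j) b\<bar> \<le> C * exp (- b))"
    by (intro ballI exp_sum_approximation fg)
  then obtain a n C where lim_f: "\<And>e b. e \<in> ?E \<Longrightarrow> b \<ge> 1 \<Longrightarrow> (\<lambda>j. exp_sum (a e j) (n e j) b) \<longlonglongrightarrow> f e b"
    and lim_g: "\<And>e b. e \<in> ?E \<Longrightarrow> b \<ge> 1 \<Longrightarrow> (\<lambda>j. exp_sum_deriv (a e j) (n e j) b) \<longlonglongrightarrow> g e b"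
    and bd_f: "\<And>e j b. e \<in> ?E \<Longrightarrow> b \<ge> 1 \<Longrightarrow> \<bar>exp_sum (a e j) (n e j) b\<bar> \<le> C e * exp (- b)"
    and bd_g: "\<And>e j b. e \<in> ?E \<Longrightarrow> b \<ge> 1 \<Longrightarrow> \<bar>exp_sum_deriv (a e j) (n e j) b\<bar> \<le> C e * exp (- b)"
    unfolding bchoice_iff by blast
  define F where "F j e = exp_sum (a e j) (n e j)" for j e
  define G where "G j e = exp_sum_deriv (a e j) (n e j)" for j e
  define x where "x = (\<lambda>(e :: 'v set) b. exp (- b) :: real)"
  have approx: "has_bochner_integral ?M (\<lambda>(u, s). ward_density \<Lambda> \<rho> (F j) (G j) u s) (\<Prod>e\<in>?E. F j e 1)" for j
    by (rule ward_identity_exp_sum[OF fin order_refl, where a = "\<lambda>e. a e j" and n = "\<lambda>e. n e j"])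
      (auto simp: F_def G_def)
  have dom: "has_bochner_integral ?M (\<lambda>(u, s). ward_density \<Lambda> \<rho> x x u s) (\<Prod>e\<in>?E. x e 1)"
    by (rule ward_identity_exp_sum[OF fin, of "{}"]) (auto simp: x_def intro!: exI[of _ "1 :: real"])
  have conv: "(\<lambda>j. ward_density \<Lambda> \<rho> (F j) (G j) u s) \<longlonglongrightarrow> ward_density \<Lambda> \<rho> f g u s" for u s
    unfolding ward_density_def
  proof (intro tendsto_mult tendsto_sum tendsto_prod tendsto_const)
    fix S e assume e: "e \<in> ?E"
    show "(\<lambda>j. if e \<in> S then G j e (B_edge \<Lambda> u s e) * (\<Prod>k\<in>e. exp (pinned \<Lambda> u k)) else F j e (B_edge \<Lambda> u s e))
       \<longlonglongrightarrow> (if e \<in> S then g e (B_edge \<Lambda> u s e) * (\<Prod>k\<in>e. exp (pinned \<Lambda> u k)) else f e (B_edge \<Lambda> u s e))"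
      using lim_f[OF e B_edge_ge_1[OF e]] lim_g[OF e B_edge_ge_1[OF e]]
      by (auto simp: F_def G_def intro!: tendsto_mult)
  qed
  have bound: "\<bar>ward_density \<Lambda> \<rho> (F j) (G j) u s\<bar> \<le> (\<Prod>e\<in>?E. C e) * ward_density \<Lambda> \<rho> x x u s" for j u s
  proof -
    let ?h = "\<lambda>f g S e. if e \<in> S then g e (B_edge \<Lambda> u s e) * (\<Prod>k\<in>e. exp (pinned \<Lambda> u k)) else f e (B_edge \<Lambda> u s e) :: real"
    let ?p = "\<Prod>i\<in>\<Lambda>. exp (- u i) / (2 * pi)"
    have "\<bar>\<Prod>e\<in>?E. ?h (F j) (G j) S e\<bar> \<le> (\<Prod>e\<in>?E. C e) * (\<Prod>e\<in>?E. ?h x x S e)" for S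
      unfolding abs_prod prod.distrib[symmetric]
    proof (rule prod_mono, safe)
      fix e assume e: "e \<in> ?E"
      have p: "(\<Prod>k\<in>e. exp (pinned \<Lambda> u k)) \<ge> 0" by (intro prod_nonneg) simp
      show "\<bar>?h (F j) (G j) S e\<bar> \<le> C e * ?h x x S e"
      proof (cases "e \<in> S")
        case True
        then show ?thesis
          using mult_right_mono[OF bd_g[OF e B_edge_ge_1[OF e], of j \<Lambda> u s] p] p
          by (simp only: if_True F_def G_def x_def abs_mult abs_of_nonneg mult.assoc)
      next
        case False
        then show ?thesis using bd_f[OF e B_edge_ge_1[OF e], of j \<Lambda> u s]
          by (simp only: if_False F_def G_def x_def)
      qed
    qed simp
    then have "(\<Sum>S\<in>Pow ?E. \<bar>det_coeff \<Lambda> \<rho> S * (\<Prod>e\<in>?E. ?h (F j) (G j) S e)\<bar>) \<le>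
        (\<Sum>S\<in>Pow ?E. det_coeff \<Lambda> \<rho> S * ((\<Prod>e\<in>?E. C e) * (\<Prod>e\<in>?E. ?h x x S e)))"
      using det_coeff(1)[OF fin] by (intro sum_mono) (auto simp: abs_mult intro!: mult_left_mono)
    then have "\<bar>\<Sum>S\<in>Pow ?E. det_coeff \<Lambda> \<rho> S * (\<Prod>e\<in>?E. ?h (F j) (G j) S e)\<bar> \<le>
        (\<Prod>e\<in>?E. C e) * (\<Sum>S\<in>Pow ?E. det_coeff \<Lambda> \<rho> S * (\<Prod>e\<in>?E. ?h x x S e))"
      unfolding sum_distrib_left by (intro order_trans[OF sum_abs]) (simp add: mult_ac)
    moreover have "?p \<ge> 0" by (intro prod_nonneg) simp
    ultimately show ?thesis
      unfolding ward_density_def abs_mult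
      by (simp only: abs_of_nonneg mult.assoc[symmetric]) (rule mult_right_mono)
  qed
  have meas_n: "(\<lambda>(u, s). ward_density \<Lambda> \<rho> (F j) (G j) u s) \<in> borel_measurable ?M" for j
    using approx[of j] by (auto simp: has_bochner_integral_iff)
  have meas: "(\<lambda>(u, s). ward_density \<Lambda> \<rho> f g u s) \<in> borel_measurable ?M"
    by (rule borel_measurable_LIMSEQ_real[OF _ meas_n]) (use conv in auto)
  have int: "integrable ?M (\<lambda>p. (\<Prod>e\<in>?E. C e) * (case p of (u, s) \<Rightarrow> ward_density \<Lambda> \<rho> x x u s))"
    using dom by (auto simp: has_bochner_integral_iff)
  have 1: "integrable ?M (\<lambda>(u, s). ward_density \<Lambda> \<rho> f g u s)"
    by (rule integrable_dominated_convergence[where s = "\<lambda>j (u, s). ward_density \<Lambda> \<rho> (F j) (G j) u s", OF meas meas_n int])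
      (use conv bound in auto)
  have 2: "(\<lambda>j. \<integral>p. (case p of (u, s) \<Rightarrow> ward_density \<Lambda> \<rho> (F j) (G j) u s) \<partial>?M) \<longlonglongrightarrow>
      (\<integral>p. (case p of (u, s) \<Rightarrow> ward_density \<Lambda> \<rho> f g u s) \<partial>?M)"
    by (rule integral_dominated_convergence[where s = "\<lambda>j (u, s). ward_density \<Lambda> \<rho> (F j) (G j) u s", OF meas meas_n int])
      (use conv bound in auto)
  have 3: "(\<integral>p. (case p of (u, s) \<Rightarrow> ward_density \<Lambda> \<rho> (F j) (G j) u s) \<partial>?M) = (\<Prod>e\<in>?E. F j e 1)" for j
    using approx[of j] by (simp add: has_bochner_integral_iff)
  have 4: "(\<lambda>j. \<Prod>e\<in>?E. F j e 1) \<longlonglongrightarrow> (\<Prod>e\<in>?E. f e 1)"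
    by (intro tendsto_prod) (use lim_f[of _ 1] in \<open>auto simp: F_def\<close>)
  show ?thesis
    using 1 LIMSEQ_unique[OF 2[unfolded 3] 4] by (simp add: has_bochner_integral_iff)
qed

section \<open>Expectations of products over edges with disjoint paths\<close>

text \<open>
  Lowering the conductance of one edge \<open>e\<close> is an affine operation, and the determinant stays
  nonnegative until the conductance has dropped by \<open>r\<close>, the effective conductance of a path
  between the end points; dropping it by \<open>d \<le> \<beta> r\<close> costs at most a factor \<open>1 - \<beta>\<close>.
\<close>

lemma laplacian_det_lower_bound:
  fixes w w' :: "'v set \<Rightarrow> real"
  assumes fin: "finite \<Lambda>" and \<rho>: "\<rho> \<notin> \<Lambda>" and I: "finite I"
    and ed: "\<And>i. i \<in> I \<Longrightarrow> ed i \<in> edges (insert \<rho> \<Lambda>)"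
    and w: "\<And>e. e \<in> edges (insert \<rho> \<Lambda>) \<Longrightarrow> w e \<ge> 0"
    and w': "\<And>e. e \<in> edges (insert \<rho> \<Lambda>) \<Longrightarrow> w' e \<ge> w e - (\<Sum>i | i \<in> I \<and> ed i = e. d i)"
    and d: "\<And>i. i \<in> I \<Longrightarrow> 0 \<le> d i \<and> d i \<le> \<beta> i * r i" and r: "\<And>i. i \<in> I \<Longrightarrow> r i > 0"
    and \<beta>: "\<And>i. i \<in> I \<Longrightarrow> \<beta> i \<le> 1"
    and P: "\<And>i. i \<in> I \<Longrightarrow> P i \<subseteq> edges (insert \<rho> \<Lambda>)" and disj: "disjoint_family_on P I"
    and path: "\<And>i \<phi>. i \<in> I \<Longrightarrow> r i * grad_sq \<phi> (ed i) \<le> (\<Sum>e\<in>P i. w e * grad_sq \<phi> e)"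
  shows "laplacian_det \<Lambda> \<rho> w' \<ge> (\<Prod>i\<in>I. 1 - \<beta> i) * laplacian_det \<Lambda> \<rho> w"
proof -
  let ?V = "insert \<rho> \<Lambda>" and ?E = "edges (insert \<rho> \<Lambda>)"
  have E: "finite ?E" using fin by (simp add: finite_edges)
  \<comment> \<open>The weights after the indices in \<open>J\<close> have been lowered:
    \<open>v {}\<close> dominates \<open>w\<close>, and \<open>v I\<close> is
    \<open>w'\<close>.\<close>
  define v where "v J e = w' e + (\<Sum>i | i \<in> I - J \<and> ed i = e. d i)" for J e
  have form_v: "dirichlet_form ?V (v J) \<phi> = dirichlet_form ?V w' \<phi> + (\<Sum>i\<in>I - J. d i * grad_sq \<phi> (ed i))" for J \<phi>
  proof -
    have "(\<Sum>e\<in>?E. (\<Sum>i | i \<in> I - J \<and> ed i = e. d i) * grad_sq \<phi> e) =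
        (\<Sum>e\<in>?E. \<Sum>i | i \<in> I - J \<and> ed i = e. d i * grad_sq \<phi> (ed i))"
      unfolding sum_distrib_right by (intro sum.cong) auto
    also have "\<dots> = (\<Sum>i\<in>I - J. d i * grad_sq \<phi> (ed i))"
      by (rule sum.group) (use I E ed in auto)
    finally show ?thesis
      unfolding dirichlet_form_def v_def by (simp add: distrib_right sum.distrib)
  qed
  have v_empty: "v {} e \<ge> w e" if "e \<in> ?E" for e using w'[OF that] by (simp add: v_def)
  \<comment> \<open>Disjointness of the paths lets all indices draw on the energy of
    \<open>w\<close> at the same time.\<close>
  have psd: "dirichlet_form ?V (v {}) \<phi> \<ge> (\<Sum>j\<in>J. r j * grad_sq \<phi> (ed j))" if J: "J \<subseteq> I" for J \<phi>
  proof -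
    have "(\<Sum>j\<in>J. r j * grad_sq \<phi> (ed j)) \<le> (\<Sum>j\<in>J. \<Sum>e\<in>P j. w e * grad_sq \<phi> e)"
      using J by (intro sum_mono path) auto
    also have "\<dots> = (\<Sum>e\<in>(\<Union>j\<in>J. P j). w e * grad_sq \<phi> e)"
    proof (rule sum.UNION_disjoint[symmetric])
      show "finite J" using J I finite_subset by blast
      show "\<forall>j\<in>J. finite (P j)" using J P E finite_subset by blast
      show "\<forall>i\<in>J. \<forall>j\<in>J. i \<noteq> j \<longrightarrow> P i \<inter> P j = {}"
        using J disj unfolding disjoint_family_on_def by blast
    qed
    also have "\<dots> \<le> (\<Sum>e\<in>?E. w e * grad_sq \<phi> e)"
      using J P E w by (intro sum_mono2) (auto intro!: mult_nonneg_nonneg grad_sq_nonneg)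
    also have "\<dots> \<le> dirichlet_form ?V (v {}) \<phi>"
      unfolding dirichlet_form_def
      by (intro sum_mono mult_right_mono v_empty grad_sq_nonneg)
    finally show ?thesis .
  qed
  have grad: "grad_sq \<phi> (ed i) \<ge> 0" if "i \<in> I" for i \<phi> using ed[OF that] by (rule grad_sq_nonneg)
  have dr: "d i \<le> r i" if "i \<in> I" for i
    using d[OF that] r[OF that] \<beta>[OF that] by (smt (verit) mult_left_le_one_le mult_less_cancel_right2)
  have det_w: "laplacian_det \<Lambda> \<rho> w \<ge> 0" by (rule laplacian_det_nonneg_weights[OF fin \<rho> w])
  have main: "laplacian_det \<Lambda> \<rho> (v J) \<ge> (\<Prod>i\<in>J. 1 - \<beta> i) * laplacian_det \<Lambda> \<rho> w" if "J \<subseteq> I" for J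
  proof -
    have "finite J" using that I finite_subset by auto
    then show ?thesis using that
    proof induction
      case empty
      then show ?case using laplacian_det_mono[OF fin \<rho>, of w "v {}"] w v_empty by simp
    next
      case (insert i J)
      have i: "i \<in> I" and J: "J \<subseteq> I" using insert by auto
      let ?e = "ed i"
      obtain a b where ab: "\<And>z. laplacian_det \<Lambda> \<rho> ((v J)(?e := z)) = a + z * b"
        using laplacian_det_affine[OF fin \<rho> ed[OF i], of "v J"] by blast
      define z where "z = v J ?e"
      have vJ: "laplacian_det \<Lambda> \<rho> (v J) = a + z * b" using ab[of z] by (simp add: z_def)
      have v_ins: "v (insert i J) = (v J)(?e := z - d i)"
      proof
        fix e
        show "v (insert i J) e = ((v J)(?e := z - d i)) e"
        proof (cases "e = ?e")
          case True
          have "{j. j \<in> I - J \<and> ed j = ?e} = insert i {j. j \<in> I - insert i J \<and> ed j = ?e}"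
            using i insert.hyps by auto
          then show ?thesis using True I by (simp add: v_def z_def)
        next
          case False
          then have "{j. j \<in> I - J \<and> ed j = e} = {j. j \<in> I - insert i J \<and> ed j = e}" by auto
          then show ?thesis using False by (simp add: v_def)
        qed
      qed
      \<comment> \<open>Each index in \<open>J\<close> has used at most its own path, so the path of
        \<open>i\<close> still pays for a decrease by the full \<open>r i\<close>.\<close>
      have "0 \<le> dirichlet_form ?V ((v J)(?e := z - r i)) \<phi>" for \<phi>
      proof -
        have "dirichlet_form ?V ((v J)(?e := z - r i)) \<phi> = dirichlet_form ?V (v J) \<phi> - r i * grad_sq \<phi> ?e"
          unfolding dirichlet_form_def sum.remove[OF E ed[OF i]] z_def
          by (simp add: algebra_simps)
        also have "dirichlet_form ?V (v J) \<phi> = dirichlet_form ?V (v {}) \<phi> - (\<Sum>j\<in>J. d j * grad_sq \<phi> (ed j))"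
          using I J unfolding form_v by (simp add: sum_diff)
        finally have "dirichlet_form ?V ((v J)(?e := z - r i)) \<phi> =
            dirichlet_form ?V (v {}) \<phi> - (\<Sum>j\<in>J. d j * grad_sq \<phi> (ed j)) - r i * grad_sq \<phi> ?e" .
        moreover have "(\<Sum>j\<in>J. d j * grad_sq \<phi> (ed j)) \<le> (\<Sum>j\<in>J. r j * grad_sq \<phi> (ed j))"
          using J by (intro sum_mono mult_right_mono dr grad) auto
        moreover have "(\<Sum>j\<in>J. r j * grad_sq \<phi> (ed j)) + r i * grad_sq \<phi> ?e \<le> dirichlet_form ?V (v {}) \<phi>"
          using psd[OF insert.prems, of \<phi>] insert.hyps by simp
        ultimately show ?thesis by linarith
      qed
      then have "laplacian_det \<Lambda> \<rho> ((v J)(?e := z - r i)) \<ge> 0"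
        by (intro laplacian_det_nonneg fin \<rho>)
      then have low: "a + (z - r i) * b \<ge> 0" using ab by simp
      \<comment> \<open>The weight after lowering by \<open>d i\<close> is a convex combination of
        \<open>z\<close> and \<open>z - r i\<close>; the determinant is affine and nonnegative at
        the latter.\<close>
      define \<mu> where "\<mu> = d i / r i"
      have \<mu>: "0 \<le> \<mu>" "\<mu> \<le> \<beta> i" "\<mu> * r i = d i"
        using d[OF i] r[OF i] by (auto simp: \<mu>_def divide_le_eq)
      have IH: "(\<Prod>i\<in>J. 1 - \<beta> i) * laplacian_det \<Lambda> \<rho> w \<le> a + z * b"
        using insert.IH[OF J] vJ by simp
      have prod: "(\<Prod>i\<in>J. 1 - \<beta> i) \<ge> 0" using J \<beta> by (intro prod_nonneg) auto
      have "laplacian_det \<Lambda> \<rho> (v (insert i J)) = (1 - \<mu>) * (a + z * b) + \<mu> * (a + (z - r i) * b)"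
        unfolding v_ins ab \<mu>(3)[symmetric] by (simp add: algebra_simps)
      also have "\<dots> \<ge> (1 - \<mu>) * (a + z * b)" using low \<mu> by simp
      finally have 1: "laplacian_det \<Lambda> \<rho> (v (insert i J)) \<ge> (1 - \<mu>) * (a + z * b)" .
      have "(1 - \<beta> i) * ((\<Prod>i\<in>J. 1 - \<beta> i) * laplacian_det \<Lambda> \<rho> w) \<le> (1 - \<mu>) * (a + z * b)"
        using IH \<mu> \<beta>[OF i] prod det_w by (intro mult_mono) auto
      then show ?case using 1 insert.hyps by (simp add: mult.assoc)
    qed
  qed
  have "v I = w'" by (simp add: v_def fun_eq_iff)
  then show ?thesis using main[of I] by simp
qed

section \<open>Cutoff functions and the bound for disjoint paths\<close>

lemma B_edge_measurable [measurable (raw)]: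
  assumes [measurable]: "U \<in> M \<rightarrow>\<^sub>M field_space \<Lambda>" "S \<in> M \<rightarrow>\<^sub>M field_space \<Lambda>"
  shows "(\<lambda>x. B_edge \<Lambda> (U x) (S x) e) \<in> borel_measurable M"
  unfolding B_edge_def B_pair_def by measurable

text \<open>
  A nonincreasing \<open>C\<^sup>1\<close> approximation of the indicator function of \<open>{..<1 + \<tau>}\<close>. Multiplying
  \<open>exp (- W\<^sub>e B)\<close> by a nonincreasing function can only increase conductances.
\<close>

definition cutoff :: "real \<Rightarrow> real \<Rightarrow> real \<Rightarrow> real" where
  "cutoff k \<tau> b = (max 0 (1 - exp (k * (b - 1 - \<tau>))))\<^sup>2"

definition cutoff_slope :: "real \<Rightarrow> real \<Rightarrow> real \<Rightarrow> real" where
  "cutoff_slope k \<tau> b = 2 * k * exp (k * (b - 1 - \<tau>)) * max 0 (1 - exp (k * (b - 1 - \<tau>)))"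

lemma cutoff_bounds: "0 \<le> cutoff k \<tau> b" "cutoff k \<tau> b \<le> 1"
  by (auto simp: cutoff_def power_le_one)

lemma cutoff_argument: "k > 0 \<Longrightarrow> 1 \<le> exp (k * (b - 1 - \<tau>)) \<longleftrightarrow> b \<ge> 1 + \<tau>" for k :: real
  by (auto simp: zero_le_mult_iff)

lemma cutoff_eq_0_iff: "k > 0 \<Longrightarrow> cutoff k \<tau> b = 0 \<longleftrightarrow> b \<ge> 1 + \<tau>"
  unfolding cutoff_argument[of k b \<tau>, symmetric] by (simp add: cutoff_def max_def)

lemma cutoff_slope_nonneg: "k > 0 \<Longrightarrow> cutoff_slope k \<tau> b \<ge> 0"
  by (auto simp: cutoff_slope_def)

lemma cutoff_slope_eq_0: "k > 0 \<Longrightarrow> b \<ge> 1 + \<tau> \<Longrightarrow> cutoff_slope k \<tau> b = 0"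
  using cutoff_argument[of k b \<tau>] unfolding cutoff_slope_def by (subst max_absorb1) auto

text \<open>The reason for the square in \<open>cutoff\<close>: the positive part alone is not
  differentiable at 0.\<close>

lemma has_real_derivative_max_0_sq:
  "((\<lambda>x. (max 0 x)\<^sup>2) has_real_derivative 2 * max 0 x) (at x)" for x :: real
proof -
  consider "x > 0" | "x < 0" | "x = 0" by linarith
  then show ?thesis
  proof cases
    case 1
    have "((\<lambda>x. x\<^sup>2) has_real_derivative 2 * max 0 x) (at x)"
      using 1 by (auto intro!: derivative_eq_intros)
    then show ?thesis
      by (rule has_field_derivative_transform_within_open[of _ _ _ "{0<..}"]) (use 1 in auto)
  next
    case 2
    have "((\<lambda>x. 0) has_real_derivative 2 * max 0 x) (at x)" using 2 by simp
    then show ?thesis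
      by (rule has_field_derivative_transform_within_open[of _ _ _ "{..<0}"]) (use 2 in auto)
  next
    case 3
    have "((\<lambda>h :: real. (max 0 h)\<^sup>2 / h) \<longlongrightarrow> 0) (at 0)"
    proof (rule Lim_null_comparison)
      show "eventually (\<lambda>h :: real. norm ((max 0 h)\<^sup>2 / h) \<le> \<bar>h\<bar>) (at 0)"
        by (auto simp: max_def power2_eq_square intro!: always_eventually)
      show "((\<lambda>h :: real. \<bar>h\<bar>) \<longlongrightarrow> 0) (at 0)" by (rule tendsto_eq_intros refl)+ simp
    qed
    then show ?thesis unfolding DERIV_def using 3 by simp
  qed
qed

lemma has_real_derivative_cutoff:
  "(cutoff k \<tau> has_real_derivative - cutoff_slope k \<tau> b) (at b)"
proof -
  have "((\<lambda>b. 1 - exp (k * (b - 1 - \<tau>))) has_real_derivative - (k * exp (k * (b - 1 - \<tau>)))) (at b)"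
    by (auto intro!: derivative_eq_intros)
  from DERIV_chain2[OF has_real_derivative_max_0_sq this]
  show ?thesis unfolding cutoff_def cutoff_slope_def by (simp add: mult_ac)
qed

lemma cutoff_tendsto_indicator:
  "(\<lambda>n. cutoff (real (Suc n)) \<tau> b) \<longlonglongrightarrow> (if b < 1 + \<tau> then 1 else 0)"
proof (cases "b < 1 + \<tau>")
  case True
  define d where "d = 1 + \<tau> - b"
  have "d > 0" using True by (simp add: d_def)
  then have "(\<lambda>n. (max 0 (1 - exp (- (real (Suc n) * d))))\<^sup>2) \<longlonglongrightarrow> (max 0 (1 - 0))\<^sup>2"
    by (intro tendsto_intros) real_asymp
  then show ?thesis using True by (simp add: cutoff_def d_def algebra_simps)
next
  case False
  then have "cutoff (real (Suc n)) \<tau> b = 0" for n by (subst cutoff_eq_0_iff) auto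
  then show ?thesis using False by simp
qed

text \<open>For edges without an indicator the position of the cutoff recedes to infinity together
  with its steepness.\<close>

lemma cutoff_tendsto_1: "(\<lambda>n. cutoff (real (Suc n)) (real (Suc n)) b) \<longlonglongrightarrow> 1"
proof -
  have "(\<lambda>n. (max 0 (1 - exp (real (Suc n) * (b - 1 - real (Suc n)))))\<^sup>2) \<longlonglongrightarrow> (max 0 (1 - 0))\<^sup>2"
    by (intro tendsto_intros) real_asymp
  then show ?thesis by (simp add: cutoff_def)
qed

text \<open>With cutoffs the Ward integral is a product of values \<open>f e 1\<close>, hence at
  most 1. Pointwise the Ward density is at least the product of the 1 - \<beta> times the integrand,
  because the lowered conductances are compensated for along the disjoint paths. The vector
  \<open>r\<close> may depend on the fields, \<beta> may not.\<close>

lemma expectation_bound_disjoint_paths: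
  fixes \<rho> :: "'v :: linorder"
  assumes fin: "finite \<Lambda>" and \<rho>: "\<rho> \<notin> \<Lambda>" and I: "finite I"
    and ed: "\<And>i. i \<in> I \<Longrightarrow> ed i \<in> edges (insert \<rho> \<Lambda>)"
    and W: "\<And>e. e \<in> edges (insert \<rho> \<Lambda>) \<Longrightarrow> W e \<ge> 0"
    and m: "\<And>i. i \<in> I \<Longrightarrow> m i \<ge> 0" and \<beta>: "\<And>i. i \<in> I \<Longrightarrow> \<beta> i < 1"
    and T: "T \<subseteq> edges (insert \<rho> \<Lambda>)" and \<tau>: "\<And>e. e \<in> T \<Longrightarrow> \<tau> e \<ge> 0"
    and P: "\<And>i. i \<in> I \<Longrightarrow> P i \<subseteq> edges (insert \<rho> \<Lambda>)" and disj: "disjoint_family_on P I"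
    and path: "\<And>i u s. i \<in> I \<Longrightarrow> (\<And>e. e \<in> T \<Longrightarrow> B_edge \<Lambda> u s e < 1 + \<tau> e) \<Longrightarrow>
      \<exists>r>0. m i / B_edge \<Lambda> u s (ed i) * (\<Prod>k\<in>ed i. exp (pinned \<Lambda> u k)) \<le> \<beta> i * r \<and>
        (\<forall>\<phi>. r * grad_sq \<phi> (ed i) \<le> (\<Sum>e\<in>P i. conductance W (pinned \<Lambda> u) e * grad_sq \<phi> e))"
  shows "(\<integral>\<^sup>+(u, s). ennreal (edge_density \<Lambda> \<rho> W u s * (\<Prod>i\<in>I. B_edge \<Lambda> u s (ed i) powr m i) *
      (\<Prod>e\<in>T. if B_edge \<Lambda> u s e < 1 + \<tau> e then 1 else 0)) \<partial>double_field_space \<Lambda>) \<le> ennreal (\<Prod>i\<in>I. 1 / (1 - \<beta> i))"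
proof -
  let ?E = "edges (insert \<rho> \<Lambda>)" and ?M = "double_field_space \<Lambda>"
  have E: "finite ?E" using fin by (simp add: finite_edges)
  \<comment> \<open>The map \<open>ed\<close> may hit an edge several times; the exponents add
    up.\<close>
  define me where "me e = (\<Sum>i | i \<in> I \<and> ed i = e. m i)" for e
  have me: "me e \<ge> 0" for e unfolding me_def by (intro sum_nonneg) (use m in auto)
  define k where "k n = real (Suc n)" for n
  have k: "k n > 0" for n by (simp add: k_def)
  define \<theta> where "\<theta> n e = (if e \<in> T then \<tau> e else k n)" for n e
  have \<theta>: "\<theta> n e \<ge> 0" for n e using \<tau> k[of n] by (auto simp: \<theta>_def)
  define q where "q e b = exp (- W e * (b - 1)) * b powr me e" for e b
  define f where "f n e b = q e b * cutoff (k n) (\<theta> n e) b" for n e b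
  \<comment> \<open>Minus the derivative of \<open>f\<close>. After division by \<open>f\<close>,
    the first summand is the conductance lowered by me / b and the second one is
    nonnegative.\<close>
  define g where "g n e b = (W e - me e / b) * f n e b + q e b * cutoff_slope (k n) (\<theta> n e) b" for n e b
  have C1: "compactly_supported_C1 (f n e) (g n e)" for n e
    unfolding compactly_supported_C1_def
  proof (intro conjI allI impI)
    fix b :: real assume b: "b \<ge> 1"
    have "(q e has_real_derivative - (W e - me e / b) * q e b) (at b)"
      unfolding q_def using b
      by (auto intro!: derivative_eq_intros simp: powr_diff field_simps)
    from DERIV_mult[OF this has_real_derivative_cutoff[of "k n" "\<theta> n e" b]]
    show "(f n e has_real_derivative - g n e b) (at b)"
      unfolding f_def g_def by (simp add: algebra_simps)
  next
    have "continuous_on {1..} (cutoff (k n) (\<theta> n e))"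
      using has_real_derivative_cutoff by (meson DERIV_isCont continuous_at_imp_continuous_on)
    moreover have "continuous_on {1..} (cutoff_slope (k n) (\<theta> n e))"
      unfolding cutoff_slope_def by (intro continuous_intros)
    moreover have "continuous_on {1..} (q e)"
      unfolding q_def by (intro continuous_intros) auto
    ultimately show "continuous_on {1..} (g n e)"
      unfolding g_def f_def by (intro continuous_intros) auto
  next
    show "\<exists>K. \<forall>b\<ge>K. f n e b = 0 \<and> g n e b = 0"
      by (intro exI[of _ "1 + \<theta> n e"])
        (auto simp: f_def g_def cutoff_slope_eq_0[OF k] cutoff_eq_0_iff[OF k])
  qed
  have q_pos: "q e b > 0" if "b \<ge> 1" for e b using that by (simp add: q_def)
  have f_nonneg: "f n e b \<ge> 0" if "b \<ge> 1" for n e b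
    unfolding f_def using q_pos[OF that] cutoff_bounds by (intro mult_nonneg_nonneg) (auto intro: less_imp_le)
  have ward: "has_bochner_integral ?M (\<lambda>(u, s). ward_density \<Lambda> \<rho> (f n) (g n) u s) (\<Prod>e\<in>?E. f n e 1)" for n
    by (rule ward_identity[OF fin \<rho> C1])
  have f1: "(\<Prod>e\<in>?E. f n e 1) \<le> 1" for n
    using f_nonneg by (intro prod_le_1) (auto simp: f_def q_def cutoff_bounds)
  let ?c = "\<Prod>i\<in>I. 1 - \<beta> i"
  have c_pos: "?c > 0" using \<beta> by (intro prod_pos) auto
  define F where "F n u s = edge_density \<Lambda> \<rho> W u s * (\<Prod>i\<in>I. B_edge \<Lambda> u s (ed i) powr m i) *
      (\<Prod>e\<in>?E. cutoff (k n) (\<theta> n e) (B_edge \<Lambda> u s e))" for n u s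
  have dens_nonneg: "edge_density \<Lambda> \<rho> W u s \<ge> 0" for u s by (rule edge_density_nonneg[OF fin \<rho> W])
  have F_nonneg: "F n u s \<ge> 0" for n u s
    unfolding F_def using dens_nonneg cutoff_bounds by (intro mult_nonneg_nonneg prod_nonneg) auto
  have F_eq: "F n u s = (\<Prod>e\<in>?E. f n e (B_edge \<Lambda> u s e)) * laplacian_det \<Lambda> \<rho> (conductance W (pinned \<Lambda> u)) *
      (\<Prod>i\<in>\<Lambda>. exp (- u i) / (2 * pi))" for n u s
  proof -
    have "(\<Prod>e\<in>?E. B_edge \<Lambda> u s e powr me e) = (\<Prod>e\<in>?E. \<Prod>i | i \<in> I \<and> ed i = e. B_edge \<Lambda> u s (ed i) powr m i)"
    proof (rule prod.cong[OF refl])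
      fix e assume "e \<in> ?E"
      then have "B_edge \<Lambda> u s e \<noteq> 0" using B_edge_ge_1[of e "insert \<rho> \<Lambda>" \<Lambda> u s] by auto
      then show "B_edge \<Lambda> u s e powr me e = (\<Prod>i | i \<in> I \<and> ed i = e. B_edge \<Lambda> u s (ed i) powr m i)"
        unfolding me_def using I by (simp add: powr_sum)
    qed
    also have "\<dots> = (\<Prod>i\<in>I. B_edge \<Lambda> u s (ed i) powr m i)"
      by (rule prod.group) (use I E ed in auto)
    finally have 1: "(\<Prod>e\<in>?E. B_edge \<Lambda> u s e powr me e) = (\<Prod>i\<in>I. B_edge \<Lambda> u s (ed i) powr m i)" .
    have 2: "(\<Prod>e\<in>?E. exp (- W e * (B_edge \<Lambda> u s e - 1))) = exp (- (\<Sum>e\<in>?E. W e * (B_edge \<Lambda> u s e - 1)))"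
      using E by (simp add: exp_sum sum_negf[symmetric])
    show ?thesis unfolding F_def f_def q_def prod.distrib 1 2 edge_density_eq by (simp only: mult_ac)
  qed
  have lower: "?c * F n u s \<le> ward_density \<Lambda> \<rho> (f n) (g n) u s" for n u s
  \<comment> \<open>Where some \<open>f\<close> vanishes, its \<open>g\<close> vanishes as well and
    both sides are 0. Elsewhere all constraints on \<open>T\<close> hold, so the path hypothesis is
    available.\<close>
  proof (cases "\<exists>e\<in>?E. f n e (B_edge \<Lambda> u s e) = 0")
    case True
    then obtain e where e: "e \<in> ?E" "f n e (B_edge \<Lambda> u s e) = 0" by blast
    have b: "B_edge \<Lambda> u s e \<ge> 1" using B_edge_ge_1[OF e(1)] .
    have "cutoff (k n) (\<theta> n e) (B_edge \<Lambda> u s e) = 0"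
      using e(2) q_pos[OF b, of e] by (simp add: f_def)
    then have "g n e (B_edge \<Lambda> u s e) = 0"
      unfolding g_def e(2) cutoff_eq_0_iff[OF k] by (simp add: cutoff_slope_eq_0[OF k])
    then have "(\<Prod>e\<in>?E. if e \<in> S then g n e (B_edge \<Lambda> u s e) * (\<Prod>k\<in>e. exp (pinned \<Lambda> u k)) else f n e (B_edge \<Lambda> u s e)) = 0" for S
      using e E by (subst prod_zero_iff) (auto intro!: bexI[of _ e])
    then have "ward_density \<Lambda> \<rho> (f n) (g n) u s = 0" unfolding ward_density_def by simp
    moreover have "(\<Prod>e\<in>?E. f n e (B_edge \<Lambda> u s e)) = 0" using e E by (subst prod_zero_iff) auto
    ultimately show ?thesis unfolding F_eq by simp
  next
    case False
    let ?B = "B_edge \<Lambda> u s" and ?X = "conductance W (pinned \<Lambda> u)"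
    let ?Y = "conductance (\<lambda>e. g n e (?B e) / f n e (?B e)) (pinned \<Lambda> u)"
    have fpos: "f n e (?B e) > 0" if "e \<in> ?E" for e
      using False that f_nonneg[OF B_edge_ge_1[OF that]] by (auto simp: less_le)
    have cut: "?B e < 1 + \<tau> e" if "e \<in> T" for e
    proof (rule ccontr)
      assume "\<not> ?B e < 1 + \<tau> e"
      then have "cutoff (k n) (\<theta> n e) (?B e) = 0" using that by (simp add: cutoff_eq_0_iff[OF k] \<theta>_def)
      then show False using fpos[of e] that T by (auto simp: f_def)
    qed
    have "\<forall>i\<in>I. \<exists>r>0. m i / ?B (ed i) * (\<Prod>k\<in>ed i. exp (pinned \<Lambda> u k)) \<le> \<beta> i * r \<and>
        (\<forall>\<phi>. r * grad_sq \<phi> (ed i) \<le> (\<Sum>e\<in>P i. ?X e * grad_sq \<phi> e))"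
      by (intro ballI path cut)
    from bchoice[OF this] obtain r where r: "\<And>i. i \<in> I \<Longrightarrow> r i > 0"
      "\<And>i. i \<in> I \<Longrightarrow> m i / ?B (ed i) * (\<Prod>k\<in>ed i. exp (pinned \<Lambda> u k)) \<le> \<beta> i * r i"
      "\<And>i \<phi>. i \<in> I \<Longrightarrow> r i * grad_sq \<phi> (ed i) \<le> (\<Sum>e\<in>P i. ?X e * grad_sq \<phi> e)"
      by blast
    have p: "(\<Prod>k\<in>e. exp (pinned \<Lambda> u k)) > 0" for e by (intro prod_pos) simp
    have "?c * laplacian_det \<Lambda> \<rho> ?X \<le> laplacian_det \<Lambda> \<rho> ?Y"
    proof (rule laplacian_det_lower_bound[OF fin \<rho> I ed _ _ _ r(1) _ P disj r(3)])
      show "?X e \<ge> 0" if "e \<in> ?E" for e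
        unfolding conductance_def using W[OF that] p[of e] by simp
      show "0 \<le> m i / ?B (ed i) * (\<Prod>k\<in>ed i. exp (pinned \<Lambda> u k)) \<and>
          m i / ?B (ed i) * (\<Prod>k\<in>ed i. exp (pinned \<Lambda> u k)) \<le> \<beta> i * r i" if "i \<in> I" for i
        using r(2)[OF that] m[OF that] p[of "ed i"] B_edge_ge_1[OF ed[OF that], of \<Lambda> u s] by auto
      show "\<beta> i \<le> 1" if "i \<in> I" for i using \<beta>[OF that] by simp
      show "?Y e \<ge> ?X e - (\<Sum>i | i \<in> I \<and> ed i = e. m i / ?B (ed i) * (\<Prod>k\<in>ed i. exp (pinned \<Lambda> u k)))" if e: "e \<in> ?E" for e
      proof -
        have "(\<Sum>i | i \<in> I \<and> ed i = e. m i / ?B (ed i) * (\<Prod>k\<in>ed i. exp (pinned \<Lambda> u k))) =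
            me e / ?B e * (\<Prod>k\<in>e. exp (pinned \<Lambda> u k))"
          unfolding me_def sum_divide_distrib sum_distrib_right by (rule sum.cong) auto
        then have "?X e - (\<Sum>i | i \<in> I \<and> ed i = e. m i / ?B (ed i) * (\<Prod>k\<in>ed i. exp (pinned \<Lambda> u k))) =
            (W e - me e / ?B e) * (\<Prod>k\<in>e. exp (pinned \<Lambda> u k))"
          by (simp add: conductance_def algebra_simps)
        also have "\<dots> \<le> ?Y e" unfolding conductance_def
        proof (rule mult_right_mono)
          have "q e (?B e) * cutoff_slope (k n) (\<theta> n e) (?B e) \<ge> 0"
            using q_pos[OF B_edge_ge_1[OF e]] cutoff_slope_nonneg[OF k] by (intro mult_nonneg_nonneg) (auto intro: less_imp_le)
          then show "W e - me e / ?B e \<le> g n e (?B e) / f n e (?B e)"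
            using fpos[OF e] by (simp add: g_def le_divide_eq)
        qed (use p[of e] in simp)
        finally show ?thesis .
      qed
    qed
    moreover have "(\<Prod>e\<in>?E. f n e (?B e)) \<ge> 0" using fpos by (intro prod_nonneg) (auto intro: less_imp_le)
    moreover have "(\<Prod>i\<in>\<Lambda>. exp (- u i) / (2 * pi)) \<ge> 0" by (intro prod_nonneg) simp
    ultimately have "(\<Prod>e\<in>?E. f n e (?B e)) * (?c * laplacian_det \<Lambda> \<rho> ?X) * (\<Prod>i\<in>\<Lambda>. exp (- u i) / (2 * pi)) \<le>
        (\<Prod>e\<in>?E. f n e (?B e)) * laplacian_det \<Lambda> \<rho> ?Y * (\<Prod>i\<in>\<Lambda>. exp (- u i) / (2 * pi))"
      by (intro mult_right_mono mult_left_mono)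
    also have "\<dots> = ward_density \<Lambda> \<rho> (f n) (g n) u s"
      by (rule ward_density_eq[OF fin \<rho>, symmetric]) (use fpos in force)
    finally show ?thesis unfolding F_eq by (simp only: mult_ac)
  qed
  have meas: "(\<lambda>(u, s). ennreal (F n u s)) \<in> borel_measurable ?M" for n
  proof -
    have [measurable]: "(\<lambda>p. edge_density \<Lambda> \<rho> W (fst p) (snd p)) \<in> borel_measurable ?M"
      by (rule edge_density_measurable) measurable
    have [measurable]: "cutoff (k n) (\<theta> n e) \<in> borel_measurable borel" for e
      unfolding cutoff_def by measurable
    show ?thesis unfolding F_def case_prod_beta by measurable
  qed
  have bound: "(\<integral>\<^sup>+(u, s). ennreal (F n u s) \<partial>?M) \<le> ennreal (\<Prod>i\<in>I. 1 / (1 - \<beta> i))" for n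
  proof -
    have wnn: "ward_density \<Lambda> \<rho> (f n) (g n) u s \<ge> 0" for u s
      using order_trans[OF _ lower] F_nonneg c_pos by (metis less_imp_le mult_nonneg_nonneg)
    have "ennreal ?c * (\<integral>\<^sup>+(u, s). ennreal (F n u s) \<partial>?M) = (\<integral>\<^sup>+p. ennreal ?c * (case p of (u, s) \<Rightarrow> ennreal (F n u s)) \<partial>?M)"
      by (rule nn_integral_cmult[symmetric]) (rule meas)
    also have "\<dots> \<le> (\<integral>\<^sup>+p. ennreal (case p of (u, s) \<Rightarrow> ward_density \<Lambda> \<rho> (f n) (g n) u s) \<partial>?M)"
      using lower c_pos F_nonneg
      by (intro nn_integral_mono) (auto simp: ennreal_mult[symmetric] intro!: ennreal_leI)
    also have "\<dots> = ennreal (\<Prod>e\<in>?E. f n e 1)"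
      using ward[of n] wnn by (subst nn_integral_eq_integral) (auto simp: has_bochner_integral_iff)
    also have "\<dots> \<le> 1" using f1[of n] by simp
    finally have "ennreal ?c * (\<integral>\<^sup>+(u, s). ennreal (F n u s) \<partial>?M) \<le> 1" .
    then have "ennreal (1 / ?c) * (ennreal ?c * (\<integral>\<^sup>+(u, s). ennreal (F n u s) \<partial>?M)) \<le> ennreal (1 / ?c) * 1"
      by (rule mult_left_mono) simp
    moreover have "ennreal (1 / ?c) * ennreal ?c = 1"
      using c_pos by (simp add: ennreal_mult[symmetric])
    moreover have "1 / ?c = (\<Prod>i\<in>I. 1 / (1 - \<beta> i))" by (simp add: prod_dividef)
    ultimately show ?thesis by (simp add: mult.assoc[symmetric])
  qed
  let ?G = "\<lambda>(u, s). ennreal (edge_density \<Lambda> \<rho> W u s * (\<Prod>i\<in>I. B_edge \<Lambda> u s (ed i) powr m i) *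
      (\<Prod>e\<in>T. if B_edge \<Lambda> u s e < 1 + \<tau> e then 1 else 0))"
  have lim: "(\<lambda>n. (case p of (u, s) \<Rightarrow> ennreal (F n u s))) \<longlonglongrightarrow> ?G p" for p
  proof -
    obtain u s where p: "p = (u, s)" by (cases p)
    have "(\<lambda>n. \<Prod>e\<in>?E. cutoff (k n) (\<theta> n e) (B_edge \<Lambda> u s e)) \<longlonglongrightarrow>
        (\<Prod>e\<in>?E. if e \<in> T then if B_edge \<Lambda> u s e < 1 + \<tau> e then 1 else 0 else 1)"
    proof (rule tendsto_prod)
      fix e
      show "(\<lambda>n. cutoff (k n) (\<theta> n e) (B_edge \<Lambda> u s e)) \<longlonglongrightarrow>
          (if e \<in> T then if B_edge \<Lambda> u s e < 1 + \<tau> e then 1 else 0 else 1)"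
        using cutoff_tendsto_indicator[of "\<tau> e"] cutoff_tendsto_1 by (cases "e \<in> T") (simp_all add: \<theta>_def k_def)
    qed
    also have "(\<Prod>e\<in>?E. if e \<in> T then if B_edge \<Lambda> u s e < 1 + \<tau> e then 1 else 0 else 1) =
        (\<Prod>e\<in>T. if B_edge \<Lambda> u s e < 1 + \<tau> e then 1 else 0 :: real)"
      using T E by (subst prod.inter_restrict[symmetric]) (auto simp: Int_absorb1)
    finally show ?thesis unfolding p F_def
      by (auto intro!: tendsto_ennrealI tendsto_mult tendsto_const)
  qed
  \<comment> \<open>Fatou's lemma: the bound is uniform in \<open>n\<close>, and finiteness of the
    limit is part of the conclusion.\<close>
  have "(\<integral>\<^sup>+p. ?G p \<partial>?M) = (\<integral>\<^sup>+p. liminf (\<lambda>n. (case p of (u, s) \<Rightarrow> ennreal (F n u s))) \<partial>?M)"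
    by (intro nn_integral_cong lim_imp_Liminf[symmetric] lim) simp
  also have "\<dots> \<le> liminf (\<lambda>n. \<integral>\<^sup>+p. (case p of (u, s) \<Rightarrow> ennreal (F n u s)) \<partial>?M)"
    by (rule nn_integral_liminf) (rule meas)
  also have "\<dots> \<le> liminf (\<lambda>n. ennreal (\<Prod>i\<in>I. 1 / (1 - \<beta> i)))"
    by (intro Liminf_mono always_eventually allI bound)
  also have "\<dots> = ennreal (\<Prod>i\<in>I. 1 / (1 - \<beta> i))" by (rule Liminf_const) simp
  finally show ?thesis .
qed

section \<open>The inhomogeneous one-dimensional model\<close>

lemma B_pair_self [simp]: "B_pair u s i i = 1"
  by (simp add: B_pair_def)

lemma B_pair_ge_1: "B_pair u s i j \<ge> 1"
  using B_pair_minus_one[of u s i j] by (smt (verit) divide_nonneg_pos exp_ge_zero mult_nonneg_nonneg zero_le_power2)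

text \<open>\<open>B_pair\<close> is the hyperbolic cosine of the distance between the points (s,
  exp (- u)) of the upper half-plane, so this is the triangle inequality combined with cosh (a + b)
  \<le> 2 cosh a cosh b. The proof exhibits the difference of the two sides as a sum of nonnegative
  terms.\<close>

lemma B_pair_split: "B_pair u s x y \<le> 2 * B_pair u s x z * B_pair u s z y"
proof -
  define X Y Z where "X = exp (u x)" "Y = exp (u y)" "Z = exp (u z)"
  define \<sigma> \<tau> where "\<sigma> = s x - s z" "\<tau> = s z - s y"
  have pos: "X > 0" "Y > 0" "Z > 0" by (auto simp: X_Y_Z_def)
  have B: "B_pair u s i j = (exp (u i) / exp (u j) + exp (u j) / exp (u i)) / 2 + (s i - s j)\<^sup>2 * (exp (u i) * exp (u j)) / 2" for i j
    by (simp only: B_pair_def cosh_def minus_diff_eq exp_diff exp_add) simp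
  have st: "s x - s y = \<sigma> + \<tau>" by (simp add: \<sigma>_\<tau>_def)
  note xy = B[of x y, unfolded st, folded X_Y_Z_def]
  note xz = B[of x z, folded X_Y_Z_def \<sigma>_\<tau>_def] and zy = B[of z y, folded X_Y_Z_def \<sigma>_\<tau>_def]
  have eq: "2 * B_pair u s x z * B_pair u s z y = B_pair u s x y +
      (X * Y * (1 / Z - \<sigma> * \<tau> * Z)\<^sup>2 + Z\<^sup>2 / (X * Y) + \<sigma>\<^sup>2 * X * Z\<^sup>2 / Y + \<tau>\<^sup>2 * Y * Z\<^sup>2 / X) / 2"
    unfolding xy xz zy using pos by (simp add: field_simps power2_eq_square)
  have "X * Y * (1 / Z - \<sigma> * \<tau> * Z)\<^sup>2 + Z\<^sup>2 / (X * Y) + \<sigma>\<^sup>2 * X * Z\<^sup>2 / Y + \<tau>\<^sup>2 * Y * Z\<^sup>2 / X \<ge> 0"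
    using pos by (intro add_nonneg_nonneg mult_nonneg_nonneg divide_nonneg_nonneg) auto
  then show ?thesis unfolding eq by simp
qed

lemma B_pair_split_three: "B_pair u s x y \<le> 4 * (B_pair u s x z * B_pair u s z z' * B_pair u s z' y)"
proof -
  have "B_pair u s x y \<le> 2 * B_pair u s x z * B_pair u s z y" by (rule B_pair_split)
  also have "\<dots> \<le> 2 * B_pair u s x z * (2 * B_pair u s z z' * B_pair u s z' y)"
    using B_pair_ge_1[of u s x z] by (intro mult_left_mono B_pair_split) auto
  finally show ?thesis by (simp add: mult_ac)
qed

text \<open>Since cosh v - 1 is at least half the square of v. Here the factor \<open>sqrt 2\<close>
  in the definition of \<open>c4\<close> arises.\<close>

lemma abs_diff_less_of_B_pair:
  assumes "B_pair u s i j < 1 + t\<^sup>2" "t \<ge> 0"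
  shows "\<bar>u i - u j\<bar> \<le> sqrt 2 * t"
proof -
  let ?v = "u i - u j"
  have "cosh ?v \<le> B_pair u s i j" by (simp add: B_pair_def)
  then have "2 * (sinh (?v / 2))\<^sup>2 < t\<^sup>2" using assms cosh_minus_one_half[of ?v] by linarith
  moreover have "(?v / 2)\<^sup>2 \<le> (sinh (?v / 2))\<^sup>2"
  proof -
    have sinh: "sinh (?v / 2) = (exp (?v / 2) - inverse (exp (?v / 2))) / 2"
      by (simp add: sinh_def exp_minus)
    show ?thesis unfolding sinh abs_le_square_iff[symmetric] by (rule real_le_abs_sinh)
  qed
  ultimately have "?v\<^sup>2 \<le> (sqrt 2 * t)\<^sup>2" by (simp add: power_mult_distrib power_divide)
  then show ?thesis using assms(2) by (simp add: abs_le_square_iff[symmetric])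
qed

text \<open>Comparison with the integral of \<open>z powr (- s)\<close>, one unit interval at a time
  by the mean value theorem.\<close>

lemma sum_powr_le:
  assumes s: "s > 1" and x: "x \<ge> 1" "x \<le> y"
  shows "(\<Sum>i\<in>{x..<y}. real (Suc i) powr (- s)) \<le> (real x powr (1 - s) - real y powr (1 - s)) / (s - 1)"
  using x(2)
proof (induction rule: dec_induct)
  case base
  then show ?case by simp
next
  case (step y)
  then have y: "real y > 0" using x by simp
  have "\<exists>z. real y < z \<and> z < real (Suc y) \<and>
      real (Suc y) powr (1 - s) - real y powr (1 - s) = (real (Suc y) - real y) * ((1 - s) * z powr (1 - s - 1))"
    using y by (intro MVT2) (auto intro!: derivative_eq_intros)
  then obtain z where z: "real y < z" "z < real (Suc y)"
    "real (Suc y) powr (1 - s) - real y powr (1 - s) = (1 - s) * z powr (- s)" by auto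
  have "real (Suc y) powr (- s) \<le> z powr (- s)" using z y s by (intro powr_mono2') auto
  also have "\<dots> = (real y powr (1 - s) - real (Suc y) powr (1 - s)) / (s - 1)"
    using z(3) s by (simp add: field_simps)
  finally have "real (Suc y) powr (- s) \<le> (real y powr (1 - s) - real (Suc y) powr (1 - s)) / (s - 1)" .
  moreover have "(real x powr (1 - s) - real y powr (1 - s)) / (s - 1) + (real y powr (1 - s) - real (Suc y) powr (1 - s)) / (s - 1) =
      (real x powr (1 - s) - real (Suc y) powr (1 - s)) / (s - 1)"
    by (simp add: add_divide_distrib[symmetric])
  ultimately show ?case using step by simp
qed

lemma sum_powr_tail_le:
  assumes s: "s > 1" and x: "x \<ge> 1"
  shows "(\<Sum>i\<in>{x..<y}. real (Suc i) powr (- s)) \<le> real x powr (1 - s) / (s - 1)"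
proof (cases "x \<le> y")
  case True
  have "(real x powr (1 - s) - real y powr (1 - s)) / (s - 1) \<le> real x powr (1 - s) / (s - 1)"
    using s by (intro divide_right_mono) auto
  then show ?thesis using sum_powr_le[OF s x True] by linarith
next
  case False
  then show ?thesis using s by simp
qed

text \<open>The term at 1 is counted separately and the tail adds 1 / (s - 1); for s = \<xi> this is
  the quotient in \<open>spread\<close>.\<close>

lemma sum_powr_total_le:
  assumes s: "s > 1" and x: "x \<ge> 1"
  shows "(\<Sum>i\<in>{x..<y}. real i powr (- s)) \<le> s / (s - 1)"
proof (cases y)
  case 0
  then show ?thesis using s by simp
next
  case (Suc z)
  have "(\<Sum>i\<in>{x..<y}. real i powr (- s)) \<le> (\<Sum>i\<in>{1..<Suc y}. real i powr (- s))"
    using x by (intro sum_mono2) auto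
  also have "\<dots> = real 1 powr (- s) + (\<Sum>i\<in>{Suc 1..<Suc y}. real i powr (- s))"
    by (rule sum.atLeast_Suc_lessThan) (simp add: Suc)
  also have "\<dots> = 1 + (\<Sum>i\<in>{1..<y}. real (Suc i) powr (- s))"
    unfolding sum.shift_bounds_Suc_ivl by simp
  also have "\<dots> \<le> 1 + 1 / (s - 1)" using sum_powr_tail_le[OF s, of 1 y] by simp
  also have "\<dots> = s / (s - 1)" using s by (simp add: field_simps)
  finally show ?thesis .
qed

text \<open>The series law by Cauchy-Schwarz: a path conducts at least like a single edge whose
  resistance is the sum of the resistances.\<close>

lemma series_conductance:
  fixes \<phi> :: "nat \<Rightarrow> real"
  assumes "x \<le> y" and X: "\<And>i. i \<in> {x..<y} \<Longrightarrow> X i > 0"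
  shows "(\<phi> x - \<phi> y)\<^sup>2 \<le> (\<Sum>i\<in>{x..<y}. 1 / X i) * (\<Sum>i\<in>{x..<y}. X i * (\<phi> i - \<phi> (Suc i))\<^sup>2)"
proof -
  have "\<phi> x - \<phi> y = (\<Sum>i\<in>{x..<y}. \<phi> i - \<phi> (Suc i))"
    using sum_Suc_diff'[OF assms(1), of \<phi>] by (simp add: sum_subtractf)
  also have "\<dots> = (\<Sum>i\<in>{x..<y}. 1 / sqrt (X i) * (sqrt (X i) * (\<phi> i - \<phi> (Suc i))))"
    by (intro sum.cong refl) (use X in \<open>fastforce\<close>)
  finally have "(\<phi> x - \<phi> y)\<^sup>2 \<le> (\<Sum>i\<in>{x..<y}. (1 / sqrt (X i))\<^sup>2) * (\<Sum>i\<in>{x..<y}. (sqrt (X i) * (\<phi> i - \<phi> (Suc i)))\<^sup>2)"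
    using Cauchy_Schwarz_ineq_sum by metis
  also have "(\<Sum>i\<in>{x..<y}. (1 / sqrt (X i))\<^sup>2) = (\<Sum>i\<in>{x..<y}. 1 / X i)"
    using X by (intro sum.cong refl) (auto simp: power_divide less_imp_le)
  also have "(\<Sum>i\<in>{x..<y}. (sqrt (X i) * (\<phi> i - \<phi> (Suc i)))\<^sup>2) = (\<Sum>i\<in>{x..<y}. X i * (\<phi> i - \<phi> (Suc i))\<^sup>2)"
    using X by (intro sum.cong refl) (auto simp: power_mult_distrib less_imp_le)
  finally show ?thesis .
qed

lemma sum_abs_increments:
  fixes \<phi> :: "nat \<Rightarrow> real"
  assumes "x \<le> y"
  shows "\<bar>\<phi> x - \<phi> y\<bar> \<le> (\<Sum>i\<in>{x..<y}. \<bar>\<phi> i - \<phi> (Suc i)\<bar>)"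
proof -
  have "\<phi> x - \<phi> y = (\<Sum>i\<in>{x..<y}. \<phi> i - \<phi> (Suc i))"
    using sum_Suc_diff'[OF assms(1), of \<phi>] by (simp add: sum_subtractf)
  then show ?thesis using sum_abs by metis
qed

text \<open>The graph of \<open>ln\<close> lies above its chord from 1 to 2.\<close>

lemma ln_one_plus_ge:
  fixes t :: real
  assumes "0 \<le> t" "t \<le> 1"
  shows "t * ln 2 \<le> ln (1 + t)"
proof -
  have "(1 - t) * ln 1 + t * ln 2 \<le> ln ((1 - t) *\<^sub>R 1 + t *\<^sub>R 2)"
    using concave_onD[OF ln_concave, of t 1 2] assms by simp
  then show ?thesis by (simp add: algebra_simps)
qed

section \<open>The chain: constants, regular paths and the cost of irregular edges\<close>

locale inhomogeneous_chain =
  fixes \<kappa> \<alpha> \<gamma> Wbar :: real and N :: nat and \<Lambda> :: "nat set" and \<rho> :: nat and W :: "nat set \<Rightarrow> real"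
  assumes \<kappa>: "0 < \<kappa>" "\<kappa> \<le> 1" and \<gamma>: "0 \<le> \<gamma>" "\<gamma> < \<alpha> - 3"
    and Wbar: "Wbar \<ge> Wbar0 \<kappa> \<alpha> \<gamma>" and model: "inhomogeneous_model \<alpha> Wbar N \<Lambda> \<rho> W"
begin

text \<open>Half the threshold exponent: the decay rate of the increments of \<open>u\<close> on
  regular edges.\<close>

definition \<xi> :: real where "\<xi> = (\<alpha> - \<gamma> - 1) / 2"

text \<open>Bounds the total variation of \<open>u\<close> along any regular path.\<close>

definition spread :: real where "spread = sqrt 2 * ((\<alpha> - \<gamma> - 1) / (\<alpha> - \<gamma> - 3))"

text \<open>The edge \<open>{i, i + 1}\<close> is regular if \<open>B\<close> is less than \<open>1 + threshold i\<close> there.\<close>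

definition threshold :: "nat \<Rightarrow> real" where "threshold i = real i powr (- (\<alpha> - \<gamma> - 1))"

abbreviation C3 :: real where "C3 \<equiv> c3 \<kappa> \<alpha> \<gamma>"
abbreviation C4 :: real where "C4 \<equiv> c4 \<kappa> \<alpha> \<gamma>"
abbreviation M :: "nat \<Rightarrow> real" where "M x \<equiv> m_vertex \<kappa> \<alpha> \<gamma> Wbar x"
abbreviation V :: "nat set" where "V \<equiv> insert \<rho> \<Lambda>"
abbreviation E :: "nat set set" where "E \<equiv> edges V"

lemma \<xi>_gt_1: "\<xi> > 1" using \<gamma> by (simp add: \<xi>_def)

lemma spread_eq: "spread = sqrt 2 * (\<xi> / (\<xi> - 1))"
  unfolding spread_def \<xi>_def using \<gamma> by (simp add: field_simps)

lemma threshold_eq: "threshold i = (real i powr (- \<xi>))\<^sup>2"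
  by (simp add: threshold_def \<xi>_def powr_power[symmetric])
    (simp add: powr_realpow[symmetric] powr_powr power2_eq_square powr_add[symmetric])

lemma threshold_bounds: "i \<ge> 1 \<Longrightarrow> 0 < threshold i" "i \<ge> 1 \<Longrightarrow> threshold i \<le> 1" "0 \<le> threshold i"
proof -
  assume i: "i \<ge> 1"
  have "real i powr (- (\<alpha> - \<gamma> - 1)) \<le> real i powr 0" using i \<gamma> by (intro powr_mono) auto
  then show "threshold i \<le> 1" using i by (simp add: threshold_def)
qed (auto simp: threshold_def)

lemma C4_bounds: "0 < C4" "C4 \<le> 1 / 16" "C4 \<le> 2 * ln 2 / (3 * exp spread) * \<kappa>"
  using \<kappa> by (auto simp: c4_def spread_def)

lemma C3_bounds: "0 < C3" "C3 * ln 2 = C4" "C3 * exp spread \<le> 2 / 3 * \<kappa>" "C3 \<le> 3 / 32"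
proof -
  show "0 < C3" "C3 * ln 2 = C4" using C4_bounds by (auto simp: c3_def)
  have "C3 * exp spread \<le> 2 * ln 2 / (3 * exp spread) * \<kappa> / ln 2 * exp spread"
    using C4_bounds unfolding c3_def by (intro mult_right_mono divide_right_mono) auto
  then show "C3 * exp spread \<le> 2 / 3 * \<kappa>" by simp
  have "C3 * (2 / 3) \<le> C3 * ln 2" using \<open>0 < C3\<close> ln2_ge_two_thirds by (intro mult_left_mono) auto
  then show "C3 \<le> 3 / 32" using C4_bounds \<open>C3 * ln 2 = C4\<close> by simp
qed

text \<open>Serves the final bound by a power of 1 + \<kappa>: on a nearest-neighbour edge an
  exponent up to \<open>M\<close> is at most \<kappa> / 3 times the weight.\<close>

lemma C3_le_\<kappa>: "C3 \<le> \<kappa> / 3"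
proof -
  have "spread \<ge> 1"
  proof -
    have "(\<alpha> - \<gamma> - 1) / (\<alpha> - \<gamma> - 3) \<ge> 1" using \<gamma> by (simp add: le_divide_eq)
    moreover have "sqrt 2 \<ge> (1 :: real)" by simp
    ultimately show ?thesis unfolding spread_def using mult_mono[of 1 "sqrt 2" 1 "(\<alpha> - \<gamma> - 1) / (\<alpha> - \<gamma> - 3)"] by simp
  qed
  then have "exp spread \<ge> 2" using exp_ge_add_one_self[of spread] by linarith
  then have "C3 * 2 \<le> C3 * exp spread" using C3_bounds by (intro mult_left_mono) auto
  then show ?thesis using C3_bounds by linarith
qed

text \<open>The form in which the lower bound on \<open>Wbar\<close> is used: it bounds the ratio of
  the geometric series of irregular costs.\<close>

lemma Wbar_exp: "exp (- 2 * C4 * Wbar) \<le> \<kappa> / 36"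
proof -
  have "2 * C4 * Wbar \<ge> 2 * C4 * Wbar0 \<kappa> \<alpha> \<gamma>" using Wbar C4_bounds by (intro mult_left_mono) auto
  also have "2 * C4 * Wbar0 \<kappa> \<alpha> \<gamma> = - ln (\<kappa> / 36)" using C4_bounds by (simp add: Wbar0_def)
  finally have "exp (- 2 * C4 * Wbar) \<le> exp (ln (\<kappa> / 36))" by simp
  then show ?thesis using \<kappa> by simp
qed

lemma Wbar_pos: "Wbar > 0"
proof (rule ccontr)
  assume "\<not> Wbar > 0"
  then have "C4 * Wbar \<le> 0" using C4_bounds by (intro mult_nonneg_nonpos) auto
  then have "exp (- 2 * C4 * Wbar) \<ge> 1" unfolding one_le_exp_iff by (simp add: mult.commute)
  then show False using Wbar_exp \<kappa> by linarith
qed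

lemma finite_\<Lambda>: "finite \<Lambda>" and \<rho>_notin: "\<rho> \<notin> \<Lambda>" and vertices: "{1..N} \<subseteq> V"
  using model unfolding inhomogeneous_model_def pinning_P1_def pinning_P2_def by auto

lemma W_nonneg: "e \<in> E \<Longrightarrow> W e \<ge> 0"
  using model unfolding inhomogeneous_model_def by auto

lemma W_nearest: "1 \<le> i \<Longrightarrow> i < N \<Longrightarrow> W {i, Suc i} \<ge> Wbar * real (Suc i) powr \<alpha>"
  using model unfolding inhomogeneous_model_def by (auto dest!: bspec[of _ _ "Suc i"])

lemma W_nearest_pos: "1 \<le> i \<Longrightarrow> i < N \<Longrightarrow> W {i, Suc i} > 0"
  using W_nearest[of i] Wbar_pos by (smt (verit) mult_pos_pos of_nat_0_less_iff powr_gt_zero zero_less_Suc)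

lemma edge_in_E: "1 \<le> x \<Longrightarrow> x < y \<Longrightarrow> y \<le> N \<Longrightarrow> {x, y} \<in> E"
  by (intro doubleton_in_edges subsetD[OF vertices]) auto

lemma M_nonneg: "M x \<ge> 0"
  using C3_bounds Wbar_pos by (simp add: m_vertex_def)

text \<open>After a split at \<open>i\<close>, the exponent of the whole segment stays admissible on
  the right piece, whose left end is larger.\<close>

lemma M_mono: "x \<le> y \<Longrightarrow> M x \<le> M y"
  unfolding m_vertex_def using C3_bounds Wbar_pos \<gamma> by (intro mult_left_mono powr_mono2) auto

lemma M_le_W:
  assumes "1 \<le> x" "x \<le> i" "i < N"
  shows "M x \<le> C3 * W {i, Suc i}"
proof -
  have "real x powr \<gamma> \<le> real (Suc i) powr \<gamma>" using assms \<gamma> by (intro powr_mono2) auto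
  also have "\<dots> \<le> real (Suc i) powr \<alpha>" using \<gamma> by (intro powr_mono) auto
  finally have "C3 * (Wbar * real x powr \<gamma>) \<le> C3 * (Wbar * real (Suc i) powr \<alpha>)"
    using C3_bounds Wbar_pos by (intro mult_left_mono) auto
  also have "\<dots> \<le> C3 * W {i, Suc i}" using C3_bounds W_nearest[of i] assms by (intro mult_left_mono) auto
  finally show ?thesis by (simp add: m_vertex_def mult.assoc)
qed

abbreviation BB :: "(nat \<Rightarrow> real) \<Rightarrow> (nat \<Rightarrow> real) \<Rightarrow> nat \<Rightarrow> nat \<Rightarrow> real" where
  "BB u s x y \<equiv> B_pair (pinned \<Lambda> u) (pinned \<Lambda> s) x y"

definition path_edges :: "nat \<Rightarrow> nat \<Rightarrow> nat set set" where
  "path_edges x y = (\<lambda>i. {i, Suc i}) ` {x..<y}"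

lemma inj_successor_edge: "inj_on (\<lambda>i :: nat. {i, Suc i}) A"
  by (auto simp: inj_on_def doubleton_eq_iff)

lemma path_edges_subset: "1 \<le> x \<Longrightarrow> y \<le> N \<Longrightarrow> path_edges x y \<subseteq> E"
  unfolding path_edges_def by (auto intro!: edge_in_E)

text \<open>\<open>r\<close> is the series conductance of the path. Relative to the factor
  \<open>exp (U x) * exp (U y)\<close>, bounded variation of \<open>u\<close> costs at most
  \<open>exp spread\<close>, and the resistances sum to order
  \<open>x powr (1 - \<alpha>) / Wbar\<close>, which outweighs \<open>m\<close>, of order
  \<open>Wbar * x powr \<gamma>\<close>.\<close>

lemma regular_path_conductance:
  assumes x: "1 \<le> x" "x < y" "y \<le> N" and m: "0 \<le> m" "m \<le> M x"
    and reg: "\<And>i. i \<in> {x..<y} \<Longrightarrow> BB u s i (Suc i) < 1 + threshold i"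
  shows "\<exists>r>0. m / B_edge \<Lambda> u s {x, y} * (\<Prod>k\<in>{x, y}. exp (pinned \<Lambda> u k)) \<le> \<kappa> / 3 * r \<and>
    (\<forall>\<phi>. r * grad_sq \<phi> {x, y} \<le> (\<Sum>e\<in>path_edges x y. conductance W (pinned \<Lambda> u) e * grad_sq \<phi> e))"
proof -
  define U where "U = pinned \<Lambda> u"
  define X where "X i = W {i, Suc i} * (exp (U i) * exp (U (Suc i)))" for i
  have Wpos: "W {i, Suc i} > 0" if "i \<in> {x..<y}" for i
    using that x by (intro W_nearest_pos) auto
  have X: "X i > 0" if "i \<in> {x..<y}" for i using Wpos[OF that] by (simp add: X_def)
  define R where "R = (\<Sum>i\<in>{x..<y}. 1 / X i)"
  have R: "R > 0" unfolding R_def using X x by (intro sum_pos) auto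
  define TV where "TV a b = (\<Sum>i\<in>{a..<b}. \<bar>U i - U (Suc i)\<bar>)" for a b
  have "TV x y \<le> (\<Sum>i\<in>{x..<y}. sqrt 2 * real i powr (- \<xi>))"
    unfolding TV_def U_def using reg
    by (intro sum_mono abs_diff_less_of_B_pair) (auto simp: threshold_eq)
  also have "\<dots> \<le> spread"
    unfolding spread_eq sum_distrib_left[symmetric]
    using sum_powr_total_le[OF \<xi>_gt_1 x(1)] by (intro mult_left_mono) auto
  finally have TV: "TV x y \<le> spread" .
  \<comment> \<open>Going from \<open>x\<close> to \<open>i\<close> and from \<open>y\<close> to
    \<open>Suc i\<close> uses disjoint parts of the path, so the total variation is paid only
    once.\<close>
  have osc: "U x + U y - (U i + U (Suc i)) \<le> spread" if i: "i \<in> {x..<y}" for i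
  proof -
    have "\<bar>U x - U i\<bar> \<le> TV x i" "\<bar>U (Suc i) - U y\<bar> \<le> TV (Suc i) y"
      unfolding TV_def using i by (auto intro: sum_abs_increments)
    moreover have "TV x i + TV (Suc i) y \<le> TV x y"
    proof -
      have "TV x y = TV x i + (TV i (Suc i) + TV (Suc i) y)"
      proof -
        have "TV x y = TV x i + TV i y"
          unfolding TV_def using i by (intro sum.atLeastLessThan_concat[symmetric]) auto
        moreover have "TV i y = \<bar>U i - U (Suc i)\<bar> + TV (Suc i) y"
          unfolding TV_def using i by (intro sum.atLeast_Suc_lessThan) auto
        ultimately show ?thesis by (simp add: TV_def)
      qed
      then show ?thesis by (simp add: TV_def)
    qed
    ultimately show ?thesis using TV by linarith
  qed
  have summand: "exp (U x) * exp (U y) * (1 / X i) \<le> exp spread / Wbar * real (Suc i) powr (- \<alpha>)" if i: "i \<in> {x..<y}" for i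
  proof -
    have "exp (U x) * exp (U y) * (1 / X i) = exp (U x + U y - (U i + U (Suc i))) * (1 / W {i, Suc i})"
      by (simp add: X_def exp_add exp_diff)
    also have "\<dots> \<le> exp spread * (1 / (Wbar * real (Suc i) powr \<alpha>))"
    proof (intro mult_mono)
      show "1 / W {i, Suc i} \<le> 1 / (Wbar * real (Suc i) powr \<alpha>)"
        using W_nearest[of i] i x Wbar_pos Wpos[OF i] by (intro divide_left_mono mult_pos_pos) auto
    qed (use osc[OF i] Wpos[OF i] in auto)
    finally show ?thesis by (simp add: powr_minus divide_inverse)
  qed
  have "exp (U x) * exp (U y) * R \<le> (\<Sum>i\<in>{x..<y}. exp spread / Wbar * real (Suc i) powr (- \<alpha>))"
    unfolding R_def sum_distrib_left by (intro sum_mono summand)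
  also have "\<dots> \<le> exp spread / Wbar * (real x powr (1 - \<alpha>) / (\<alpha> - 1))"
    unfolding sum_distrib_left[symmetric] using \<gamma> x Wbar_pos
    by (intro mult_left_mono sum_powr_tail_le) auto
  finally have ER: "exp (U x) * exp (U y) * R \<le> exp spread / Wbar * (real x powr (1 - \<alpha>) / (\<alpha> - 1))" .
  have "m * (exp (U x) * exp (U y) * R) \<le> M x * (exp spread / Wbar * (real x powr (1 - \<alpha>) / (\<alpha> - 1)))"
    using m ER R M_nonneg by (intro mult_mono[OF m(2) ER]) auto
  also have "\<dots> = C3 * exp spread * (real x powr (\<gamma> + (1 - \<alpha>)) / (\<alpha> - 1))"
    using Wbar_pos by (simp add: m_vertex_def powr_add)
  \<comment> \<open>The constant in \<open>c4\<close> gives the first factor, \<alpha> - 1 > 2 the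
    second; \<kappa> / 3 results.\<close>
  also have "\<dots> \<le> 2 / 3 * \<kappa> * (1 / 2)"
  proof (rule mult_mono[OF C3_bounds(3)])
    have "real x powr (\<gamma> + (1 - \<alpha>)) \<le> real x powr 0" using x \<gamma> by (intro powr_mono) auto
    then show "real x powr (\<gamma> + (1 - \<alpha>)) / (\<alpha> - 1) \<le> 1 / 2"
      using x \<gamma> by (intro frac_le) auto
  qed (use \<kappa> \<gamma> in auto)
  finally have mR: "m * (exp (U x) * exp (U y)) * R \<le> \<kappa> / 3" by (simp add: mult_ac)
  have B: "B_edge \<Lambda> u s {x, y} \<ge> 1" unfolding B_edge_pair by (rule B_pair_ge_1)
  show ?thesis
  proof (intro exI[of _ "1 / R"] conjI allI)
    show "1 / R > 0" using R by simp
    have "m / B_edge \<Lambda> u s {x, y} * (exp (U x) * exp (U y)) \<le> m * (exp (U x) * exp (U y))"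
      using m B by (intro mult_right_mono) (auto simp: divide_le_eq mult_le_cancel_left1)
    also have "\<dots> \<le> \<kappa> / 3 * (1 / R)" using mR R by (simp add: field_simps)
    finally show "m / B_edge \<Lambda> u s {x, y} * (\<Prod>k\<in>{x, y}. exp (pinned \<Lambda> u k)) \<le> \<kappa> / 3 * (1 / R)"
      using x by (simp add: U_def)
    fix \<phi> :: "nat \<Rightarrow> real"
    have "(\<Sum>e\<in>path_edges x y. conductance W (pinned \<Lambda> u) e * grad_sq \<phi> e) =
        (\<Sum>i\<in>{x..<y}. X i * (\<phi> i - \<phi> (Suc i))\<^sup>2)"
      unfolding path_edges_def
      by (subst sum.reindex) (auto simp: inj_successor_edge grad_sq_pair conductance_def X_def U_def)
    moreover have "(\<phi> x - \<phi> y)\<^sup>2 \<le> R * (\<Sum>i\<in>{x..<y}. X i * (\<phi> i - \<phi> (Suc i))\<^sup>2)"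
      unfolding R_def using x by (intro series_conductance X) auto
    ultimately show "1 / R * grad_sq \<phi> {x, y} \<le> (\<Sum>e\<in>path_edges x y. conductance W (pinned \<Lambda> u) e * grad_sq \<phi> e)"
      using R x by (simp add: grad_sq_pair divide_le_eq mult.commute)
  qed
qed

text \<open>The edge is its own path, so an exponent \<open>m\<close> uses up the fraction m / W of
  its conductance.\<close>

lemma nearest_neighbour_conductance:
  assumes x: "1 \<le> x" "x < N" and m: "0 \<le> m"
  shows "\<exists>r>0. m / B_edge \<Lambda> u s {x, Suc x} * (\<Prod>k\<in>{x, Suc x}. exp (pinned \<Lambda> u k)) \<le> m / W {x, Suc x} * r \<and>
    (\<forall>\<phi>. r * grad_sq \<phi> {x, Suc x} \<le> (\<Sum>e\<in>path_edges x (Suc x). conductance W (pinned \<Lambda> u) e * grad_sq \<phi> e))"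
proof (intro exI[of _ "conductance W (pinned \<Lambda> u) {x, Suc x}"] conjI allI)
  let ?p = "\<Prod>k\<in>{x, Suc x}. exp (pinned \<Lambda> u k)"
  have W: "W {x, Suc x} > 0" using x by (intro W_nearest_pos) auto
  have p: "?p > 0" by (intro prod_pos) simp
  show "conductance W (pinned \<Lambda> u) {x, Suc x} > 0" using W p unfolding conductance_def by simp
  have B: "B_edge \<Lambda> u s {x, Suc x} \<ge> 1" unfolding B_edge_pair by (rule B_pair_ge_1)
  have "m / B_edge \<Lambda> u s {x, Suc x} \<le> m" using m B by (simp add: divide_le_eq mult_le_cancel_left1)
  then have "m / B_edge \<Lambda> u s {x, Suc x} * ?p \<le> m * ?p" using p by (intro mult_right_mono) auto
  then show "m / B_edge \<Lambda> u s {x, Suc x} * ?p \<le> m / W {x, Suc x} * conductance W (pinned \<Lambda> u) {x, Suc x}"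
    using W by (simp add: conductance_def)
  show "conductance W (pinned \<Lambda> u) {x, Suc x} * grad_sq \<phi> {x, Suc x} \<le>
      (\<Sum>e\<in>path_edges x (Suc x). conductance W (pinned \<Lambda> u) e * grad_sq \<phi> e)" for \<phi>
    by (simp add: path_edges_def)
qed

text \<open>
  The cost of an irregular edge \<open>{i, i + 1}\<close> inside an interval starting at \<open>x\<close>: the factor \<open>4 powr m\<close>
  from splitting the interval at \<open>i\<close> and \<open>i + 1\<close> is beaten by Markov's inequality with the
  exponent \<open>W\<^sub>i / 2\<close>, which is of order \<open>i powr \<alpha>\<close>.
\<close>

definition irregular_cost :: "real \<Rightarrow> nat \<Rightarrow> real" where
  "irregular_cost m i = 4 powr m * (1 + threshold i) powr (- (W {i, Suc i} / 2 - m))"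

lemma irregular_cost_nonneg: "irregular_cost m i \<ge> 0"
  by (simp add: irregular_cost_def)

text \<open>Threshold times weight is at least \<open>w\<close>, of order
  \<open>i powr (\<gamma> + 1)\<close>. In the exponent the losses (\<open>4 powr m\<close> and the
  \<open>m\<close> subtracted from \<open>W / 2\<close>) amount to at most 3 C4 w, while the gain is
  \<open>ln 2 / 2 * w\<close>.\<close>

lemma irregular_cost_le:
  assumes x: "1 \<le> x" "x \<le> i" "i < N" and m: "0 \<le> m" "m \<le> M x"
  shows "irregular_cost m i \<le> (\<kappa> / 36) ^ i"
proof -
  have i: "i \<ge> 1" using x by simp
  define t where "t = threshold i"
  define w where "w = Wbar * real i powr (\<gamma> + 1)"
  have t: "0 < t" "t \<le> 1" using threshold_bounds(1,2)[OF i] by (auto simp: t_def)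
  have mi: "m \<le> C3 * w"
  proof -
    have "m \<le> M i" using m M_mono[OF x(2)] by simp
    also have "\<dots> \<le> C3 * (Wbar * real i powr (\<gamma> + 1))"
      unfolding m_vertex_def mult.assoc using C3_bounds Wbar_pos i
      by (intro mult_left_mono powr_mono) auto
    finally show ?thesis by (simp add: w_def)
  qed
  have tW: "w \<le> t * W {i, Suc i}"
  proof -
    have "w = Wbar * (t * real i powr \<alpha>)"
      using i by (simp add: w_def t_def threshold_def powr_add[symmetric] add.commute)
    also have "\<dots> \<le> Wbar * (t * real (Suc i) powr \<alpha>)"
      using Wbar_pos t \<gamma> by (intro mult_left_mono powr_mono2) auto
    also have "\<dots> \<le> t * W {i, Suc i}"
      using mult_left_mono[OF W_nearest[of i], of t] i x t by (simp add: mult_ac)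
    finally show ?thesis .
  qed
  have q: "W {i, Suc i} / 2 - m \<ge> 0"
  proof -
    have "m \<le> C3 * W {i, Suc i}" using M_le_W[OF x] m by simp
    also have "\<dots> \<le> 1 / 2 * W {i, Suc i}"
      using C3_bounds W_nearest_pos[of i] i x by (intro mult_right_mono) auto
    finally show ?thesis by simp
  qed
  have "irregular_cost m i = exp (m * ln 4 - (W {i, Suc i} / 2 - m) * ln (1 + t))"
    using t by (simp add: irregular_cost_def powr_def exp_add[symmetric] t_def[symmetric] algebra_simps)
  also have "\<dots> \<le> exp (- 2 * C4 * w)"
  proof -
    have l4: "ln 4 = 2 * ln (2 :: real)" using ln_realpow[of 2 2] by simp
    have "(W {i, Suc i} / 2 - m) * (t * ln 2) \<le> (W {i, Suc i} / 2 - m) * ln (1 + t)"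
      using q t by (intro mult_left_mono ln_one_plus_ge) auto
    moreover have "(W {i, Suc i} / 2 - m) * (t * ln 2) = ln 2 / 2 * (t * W {i, Suc i}) - t * (m * ln 2)"
      by (simp add: algebra_simps)
    moreover have "ln 2 / 2 * w \<le> ln 2 / 2 * (t * W {i, Suc i})" using tW by (intro mult_left_mono) auto
    moreover have "t * (m * ln 2) \<le> m * ln 2" using t m by (intro mult_left_le_one_le) auto
    moreover have "m * ln 2 \<le> C4 * w"
      using mult_right_mono[OF mi, of "ln 2"] C3_bounds(2) by (simp add: mult_ac)
    \<comment> \<open>The origin of 1 / 16 in \<open>c4\<close>: the gain covers 5 C4 w, so 2 C4 w
      is left after the losses.\<close>
    moreover have "5 * C4 * w \<le> ln 2 / 2 * w"
    proof (rule mult_right_mono)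
      show "5 * C4 \<le> ln 2 / 2" using C4_bounds ln2_ge_two_thirds by linarith
      show "w \<ge> 0" using Wbar_pos by (simp add: w_def)
    qed
    ultimately show ?thesis unfolding l4 exp_le_cancel_iff by linarith
  qed
  also have "\<dots> \<le> exp (- 2 * C4 * (Wbar * real i))"
  proof -
    have "real i powr 1 \<le> real i powr (\<gamma> + 1)" using i \<gamma> by (intro powr_mono) auto
    then have "Wbar * real i \<le> w" using i Wbar_pos unfolding w_def by (intro mult_left_mono) auto
    then show ?thesis using C4_bounds by (simp add: mult_left_mono)
  qed
  also have "\<dots> = exp (- 2 * C4 * Wbar) ^ i"
    by (simp add: exp_of_nat_mult[symmetric] mult_ac)
  also have "\<dots> \<le> (\<kappa> / 36) ^ i" by (intro power_mono Wbar_exp) auto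
  finally show ?thesis .
qed

text \<open>A geometric series with ratio at most 1 / 36 that starts with the first power, as all
  indices are at least 1.\<close>

lemma sum_irregular_cost_le:
  assumes x: "1 \<le> x" "y \<le> N" and m: "0 \<le> m" "m \<le> M x"
  shows "(\<Sum>i\<in>{x..<y}. irregular_cost m i) \<le> \<kappa> / 35"
proof -
  let ?z = "\<kappa> / 36"
  have z: "0 < ?z" "?z \<le> 1 / 36" using \<kappa> by auto
  have "(\<Sum>i\<in>{x..<y}. irregular_cost m i) \<le> (\<Sum>i\<in>{x..<y}. ?z ^ i)"
    using assms by (intro sum_mono irregular_cost_le) auto
  also have "\<dots> \<le> (\<Sum>i\<in>{Suc 0..<Suc y}. ?z ^ i)" using x z by (intro sum_mono2) auto
  also have "\<dots> = ?z * (\<Sum>i<y. ?z ^ i)"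
    by (simp only: sum.shift_bounds_Suc_ivl atLeast0LessThan sum_distrib_left power_Suc)
  also have "(\<Sum>i<y. ?z ^ i) = (1 - ?z ^ y) / (1 - ?z)" using z by (subst sum_gp_strict) auto
  also have "?z * ((1 - ?z ^ y) / (1 - ?z)) \<le> ?z * (1 / (35 / 36))"
    using z by (intro mult_left_mono frac_le) auto
  finally show ?thesis by simp
qed

end

section \<open>Products over segments and the induction on the free length\<close>

text \<open>
  The factors of the product under the expectation. A \<open>Nearest\<close> segment is a nearest-neighbour edge
  with exponent below \<open>W\<^sub>e\<close>; a \<open>Regular\<close> segment carries the indicator of the event that all
  nearest-neighbour edges below it are regular. Segments with \<open>lo = hi\<close> contribute the factor \<open>1\<close>.
\<close>

datatype segment_kind = Nearest | Regular | Free

datatype segment = Segment (kind: segment_kind) (lo: nat) (hi: nat) (exponent: real)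

definition apart :: "segment \<Rightarrow> segment \<Rightarrow> bool" where
  "apart \<sigma> \<tau> \<longleftrightarrow> hi \<sigma> \<le> lo \<tau> \<or> hi \<tau> \<le> lo \<sigma>"

lemma apart_subsegment:
  "apart \<sigma> \<tau> \<Longrightarrow> lo \<sigma> \<le> lo \<sigma>' \<Longrightarrow> hi \<sigma>' \<le> hi \<sigma> \<Longrightarrow> apart \<sigma>' \<tau>"
  "apart \<tau> \<sigma> \<Longrightarrow> lo \<sigma> \<le> lo \<sigma>' \<Longrightarrow> hi \<sigma>' \<le> hi \<sigma> \<Longrightarrow> apart \<tau> \<sigma>'"
  by (auto simp: apart_def)

context inhomogeneous_chain
begin

text \<open>Only \<open>Free\<close> segments may be degenerate; such pieces arise when a segment is
  split next to one of its ends.\<close>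

definition valid_segment :: "segment \<Rightarrow> bool" where
  "valid_segment \<sigma> \<longleftrightarrow> 1 \<le> lo \<sigma> \<and> lo \<sigma> \<le> hi \<sigma> \<and> hi \<sigma> \<le> N \<and> 0 \<le> exponent \<sigma> \<and>
    (case kind \<sigma> of
       Nearest \<Rightarrow> hi \<sigma> = Suc (lo \<sigma>) \<and> exponent \<sigma> < W {lo \<sigma>, hi \<sigma>}
     | Regular \<Rightarrow> lo \<sigma> < hi \<sigma> \<and> exponent \<sigma> \<le> M (lo \<sigma>)
     | Free \<Rightarrow> exponent \<sigma> \<le> M (lo \<sigma>))"

definition factor :: "(nat \<Rightarrow> real) \<Rightarrow> (nat \<Rightarrow> real) \<Rightarrow> segment \<Rightarrow> real" where
  "factor u s \<sigma> = BB u s (lo \<sigma>) (hi \<sigma>) powr exponent \<sigma> *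
    (if kind \<sigma> = Regular then \<Prod>i\<in>{lo \<sigma>..<hi \<sigma>}. if BB u s i (Suc i) < 1 + threshold i then 1 else 0 else 1)"

text \<open>A \<open>Regular\<close> segment is granted only \<kappa> / 2; the difference to
  \<open>Free\<close> pays for the irregular cases.\<close>

definition factor_bound :: "segment \<Rightarrow> real" where
  "factor_bound \<sigma> = (case kind \<sigma> of
       Nearest \<Rightarrow> 1 / (1 - exponent \<sigma> / W {lo \<sigma>, hi \<sigma>})
     | Regular \<Rightarrow> 1 + \<kappa> / 2
     | Free \<Rightarrow> 1 + \<kappa>)"

text \<open>A list and not a set, since degenerate segments from neighbouring splits may coincide.
  \<open>apart\<close> is symmetric, so the order of the list carries no information.\<close>

definition configuration :: "segment list \<Rightarrow> bool" where
  "configuration l \<longleftrightarrow> (\<forall>\<sigma>\<in>set l. valid_segment \<sigma>) \<and> sorted_wrt apart l"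

abbreviation factors :: "(nat \<Rightarrow> real) \<Rightarrow> (nat \<Rightarrow> real) \<Rightarrow> segment list \<Rightarrow> real" where
  "factors u s l \<equiv> prod_list (map (factor u s) l)"

abbreviation factor_bounds :: "segment list \<Rightarrow> real" where
  "factor_bounds l \<equiv> prod_list (map factor_bound l)"

text \<open>A nonnegative integral, meaningful before finiteness is known.\<close>

definition expect :: "((nat \<Rightarrow> real) \<Rightarrow> (nat \<Rightarrow> real) \<Rightarrow> real) \<Rightarrow> ennreal" where
  "expect F = (\<integral>\<^sup>+(u, s). ennreal (edge_density \<Lambda> \<rho> W u s * F u s) \<partial>double_field_space \<Lambda>)"

lemma factor_nonneg: "factor u s \<sigma> \<ge> 0"
  by (auto simp: factor_def intro!: mult_nonneg_nonneg prod_nonneg)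

lemma factors_nonneg: "factors u s l \<ge> 0"
  by (induction l) (auto simp: factor_nonneg)

lemma factor_bound_nonneg: "valid_segment \<sigma> \<Longrightarrow> factor_bound \<sigma> \<ge> 0"
  using \<kappa> by (cases "kind \<sigma>") (auto simp: factor_bound_def valid_segment_def divide_le_eq_1)

lemma factor_bounds_nonneg: "\<forall>\<sigma>\<in>set l. valid_segment \<sigma> \<Longrightarrow> factor_bounds l \<ge> 0"
  by (induction l) (auto simp: factor_bound_nonneg)

lemma edge_density_W_nonneg: "edge_density \<Lambda> \<rho> W u s \<ge> 0"
  by (rule edge_density_nonneg[OF finite_\<Lambda> \<rho>_notin W_nonneg])

lemma BB_measurable [measurable]:
  "(\<lambda>p. BB (fst p) (snd p) x y) \<in> borel_measurable (double_field_space \<Lambda>)"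
  using B_edge_measurable[of fst "double_field_space \<Lambda>" \<Lambda> snd "{x, y}"] by (simp add: B_edge_pair)

lemma factor_measurable [measurable]:
  "(\<lambda>p. factor (fst p) (snd p) \<sigma>) \<in> borel_measurable (double_field_space \<Lambda>)"
  unfolding factor_def by measurable

lemma factors_measurable [measurable]:
  "(\<lambda>p. factors (fst p) (snd p) l) \<in> borel_measurable (double_field_space \<Lambda>)"
  by (induction l) (simp_all, measurable)

lemma edge_density_W_measurable [measurable]:
  "(\<lambda>p. edge_density \<Lambda> \<rho> W (fst p) (snd p)) \<in> borel_measurable (double_field_space \<Lambda>)"
  by (rule edge_density_measurable) measurable

text \<open>(1 + \<kappa> / 2) (1 - \<kappa> / 3) exceeds 1 by \<kappa> (1 - \<kappa>) / 6.\<close>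

lemma one_over_one_minus_le:
  assumes "0 \<le> x" "x \<le> \<kappa> / 3"
  shows "1 / (1 - x) \<le> 1 + \<kappa> / 2"
proof -
  have "1 \<le> (1 + \<kappa> / 2) * (1 - \<kappa> / 3)" using \<kappa> by (simp add: algebra_simps)
  also have "\<dots> \<le> (1 + \<kappa> / 2) * (1 - x)" using assms \<kappa> by (intro mult_left_mono) auto
  finally show ?thesis using assms \<kappa> by (simp add: divide_le_eq)
qed

text \<open>The bound for disjoint paths, with every segment compensated for by the
  nearest-neighbour edges below it; segments that are apart have disjoint paths.\<close>

lemma expect_factors_base:
  assumes l: "configuration l" and no_free: "\<forall>\<sigma>\<in>set l. kind \<sigma> \<noteq> Free"
  shows "expect (\<lambda>u s. factors u s l) \<le> ennreal (factor_bounds l)"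
proof -
  define I where "I = {..<length l}"
  define ed where "ed i = {lo (l ! i), hi (l ! i)}" for i
  define P where "P i = path_edges (lo (l ! i)) (hi (l ! i))" for i
  define \<beta> where "\<beta> i = (if kind (l ! i) = Nearest then exponent (l ! i) / W (ed i) else \<kappa> / 3)" for i
  define J where "J = {i \<in> I. kind (l ! i) = Regular}"
  define T where "T = (\<Union>i\<in>J. P i)"
  have I: "finite I" by (simp add: I_def)
  have J: "J \<subseteq> I" "finite J" using I by (auto simp: J_def)
  have valid: "valid_segment (l ! i)" and nf: "kind (l ! i) \<noteq> Free" if "i \<in> I" for i
    using that l no_free by (auto simp: I_def configuration_def)
  have pos: "1 \<le> lo (l ! i)" "lo (l ! i) < hi (l ! i)" "hi (l ! i) \<le> N" "0 \<le> exponent (l ! i)" if "i \<in> I" for i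
    using valid[OF that] nf[OF that] by (auto simp: valid_segment_def split: segment_kind.splits)
  have nearest: "hi (l ! i) = Suc (lo (l ! i))" "exponent (l ! i) < W (ed i)"
    if "i \<in> I" "kind (l ! i) = Nearest" for i
    using valid[OF that(1)] that by (auto simp: valid_segment_def ed_def)
  have regular: "exponent (l ! i) \<le> M (lo (l ! i))" if "i \<in> I" "kind (l ! i) = Regular" for i
    using valid[OF that(1)] that by (auto simp: valid_segment_def)
  have edE: "ed i \<in> E" if "i \<in> I" for i unfolding ed_def using pos[OF that] by (intro edge_in_E)
  have PE: "P i \<subseteq> E" if "i \<in> I" for i unfolding P_def using pos[OF that] by (intro path_edges_subset)
  have disj: "disjoint_family_on P I"
  proof (unfold disjoint_family_on_def, intro ballI impI)
    have less: "P i \<inter> P j = {}" if "i < j" "j \<in> I" for i j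
    proof -
      have "apart (l ! i) (l ! j)"
        using l that unfolding configuration_def sorted_wrt_iff_nth_less I_def by auto
      then show ?thesis unfolding P_def path_edges_def apart_def
        by (auto simp: doubleton_eq_iff)
    qed
    fix i j assume "i \<in> I" "j \<in> I" "i \<noteq> j"
    then show "P i \<inter> P j = {}" using less[of i j] less[of j i] by (cases "i < j") auto
  qed
  \<comment> \<open>\<open>Min e\<close> recovers the index \<open>i\<close> of the edge {i, i +
    1}.\<close>
  have indicators: "(\<Prod>e\<in>T. if B_edge \<Lambda> u s e < 1 + threshold (Min e) then 1 else 0 :: real) =
      (\<Prod>i\<in>I. if kind (l ! i) = Regular
        then \<Prod>j\<in>{lo (l ! i)..<hi (l ! i)}. if BB u s j (Suc j) < 1 + threshold j then 1 else 0 else 1)" for u s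
  proof -
    have "(\<Prod>e\<in>T. if B_edge \<Lambda> u s e < 1 + threshold (Min e) then 1 else 0 :: real) =
        (\<Prod>i\<in>J. \<Prod>e\<in>P i. if B_edge \<Lambda> u s e < 1 + threshold (Min e) then 1 else 0)"
      unfolding T_def
    proof (rule prod.UNION_disjoint[OF J(2)])
      show "\<forall>i\<in>J. finite (P i)" by (simp add: P_def path_edges_def)
      show "\<forall>i\<in>J. \<forall>j\<in>J. i \<noteq> j \<longrightarrow> P i \<inter> P j = {}"
        using J(1) disj unfolding disjoint_family_on_def by blast
    qed
    also have "\<dots> = (\<Prod>i\<in>J. \<Prod>j\<in>{lo (l ! i)..<hi (l ! i)}. if BB u s j (Suc j) < 1 + threshold j then 1 else 0)"
      unfolding P_def path_edges_def
      by (intro prod.cong refl, subst prod.reindex) (auto simp: inj_successor_edge B_edge_pair)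
    finally show ?thesis unfolding J_def using I by (simp add: prod.inter_filter)
  qed
  have eq: "factors u s l = (\<Prod>i\<in>I. B_edge \<Lambda> u s (ed i) powr exponent (l ! i)) *
      (\<Prod>e\<in>T. if B_edge \<Lambda> u s e < 1 + threshold (Min e) then 1 else 0)" for u s
    unfolding indicators prod.distrib[symmetric] prod.list_conv_set_nth
    by (simp add: I_def ed_def factor_def B_edge_pair atLeast0LessThan)
  have "(\<integral>\<^sup>+(u, s). ennreal (edge_density \<Lambda> \<rho> W u s * (\<Prod>i\<in>I. B_edge \<Lambda> u s (ed i) powr exponent (l ! i)) *
      (\<Prod>e\<in>T. if B_edge \<Lambda> u s e < 1 + threshold (Min e) then 1 else 0)) \<partial>double_field_space \<Lambda>) \<le>
      ennreal (\<Prod>i\<in>I. 1 / (1 - \<beta> i))"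
  proof (rule expectation_bound_disjoint_paths[OF finite_\<Lambda> \<rho>_notin I edE W_nonneg _ _ _ _ PE disj])
    fix i assume i: "i \<in> I"
    show "0 \<le> exponent (l ! i)" by (rule pos[OF i])
    show "\<beta> i < 1" using nearest[OF i] \<kappa> pos(4)[OF i] by (auto simp: \<beta>_def divide_less_eq)
  next
    show "T \<subseteq> E" unfolding T_def using PE J by auto
    show "0 \<le> threshold (Min e)" for e by (rule threshold_bounds)
  next
    fix i u s
    assume i: "i \<in> I" and reg: "\<And>e. e \<in> T \<Longrightarrow> B_edge \<Lambda> u s e < 1 + threshold (Min e)"
    show "\<exists>r>0. exponent (l ! i) / B_edge \<Lambda> u s (ed i) * (\<Prod>k\<in>ed i. exp (pinned \<Lambda> u k)) \<le> \<beta> i * r \<and>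
        (\<forall>\<phi>. r * grad_sq \<phi> (ed i) \<le> (\<Sum>e\<in>P i. conductance W (pinned \<Lambda> u) e * grad_sq \<phi> e))"
    proof (cases "kind (l ! i)")
      case Nearest
      then show ?thesis
        using nearest_neighbour_conductance[of "lo (l ! i)" "exponent (l ! i)" u s] pos[OF i] nearest[OF i]
        by (simp add: \<beta>_def ed_def P_def)
    next
      case Regular
      have "BB u s j (Suc j) < 1 + threshold j" if "j \<in> {lo (l ! i)..<hi (l ! i)}" for j
      proof -
        have "{j, Suc j} \<in> T" using that i Regular unfolding T_def J_def P_def path_edges_def by auto
        from reg[OF this] show ?thesis by (simp add: B_edge_pair)
      qed
      then show ?thesis
        using regular_path_conductance[OF pos[OF i] regular[OF i Regular], of u s] Regular
        by (simp add: \<beta>_def ed_def P_def)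
    next
      case Free
      then show ?thesis using nf[OF i] by simp
    qed
  qed
  also have "(\<Prod>i\<in>I. 1 / (1 - \<beta> i)) \<le> (\<Prod>i\<in>I. factor_bound (l ! i))"
  proof (rule prod_mono, safe)
    fix i assume i: "i \<in> I"
    show "0 \<le> 1 / (1 - \<beta> i)" using nearest[OF i] \<kappa> pos(4)[OF i] by (auto simp: \<beta>_def divide_le_eq)
    show "1 / (1 - \<beta> i) \<le> factor_bound (l ! i)"
      using nf[OF i] one_over_one_minus_le[of "\<kappa> / 3"] \<kappa>
      by (cases "kind (l ! i)") (auto simp: \<beta>_def factor_bound_def ed_def)
  qed
  also have "(\<Prod>i\<in>I. factor_bound (l ! i)) = factor_bounds l"
    unfolding prod.list_conv_set_nth by (simp add: I_def atLeast0LessThan)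
  finally show ?thesis unfolding expect_def eq by (simp add: mult.assoc ennreal_leI)
qed

text \<open>Either all edges below the segment are regular, or some edge \<open>i\<close> is not and
  the segment is split there. The unknown \<open>i\<close> is absorbed by summing over all
  positions.\<close>

lemma factor_free_le:
  assumes "lo \<sigma> < hi \<sigma>" "kind \<sigma> = Free" and valid: "valid_segment \<sigma>"
  shows "factor u s \<sigma> \<le> factor u s (Segment Regular (lo \<sigma>) (hi \<sigma>) (exponent \<sigma>)) +
    (\<Sum>i\<in>{lo \<sigma>..<hi \<sigma>}. irregular_cost (exponent \<sigma>) i *
      (factor u s (Segment Free (lo \<sigma>) i (exponent \<sigma>)) *
       (factor u s (Segment Nearest i (Suc i) (W {i, Suc i} / 2)) *
        factor u s (Segment Free (Suc i) (hi \<sigma>) (exponent \<sigma>)))))"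
    (is "_ \<le> ?R + (\<Sum>i\<in>_. ?S i)")
proof -
  let ?x = "lo \<sigma>" and ?y = "hi \<sigma>" and ?m = "exponent \<sigma>"
  have m: "0 \<le> ?m" "?m \<le> M ?x" and x: "1 \<le> ?x" "?y \<le> N"
    using valid assms(2) by (auto simp: valid_segment_def)
  have S: "?S i \<ge> 0" for i by (intro mult_nonneg_nonneg factor_nonneg irregular_cost_nonneg)
  have f: "factor u s \<sigma> = BB u s ?x ?y powr ?m" using assms(2) by (simp add: factor_def)
  show ?thesis
  proof (cases "\<forall>i\<in>{?x..<?y}. BB u s i (Suc i) < 1 + threshold i")
    case True
    then have "?R = factor u s \<sigma>" unfolding f by (simp add: factor_def)
    then show ?thesis using S by (simp add: sum_nonneg)
  next
    case False
    then obtain i where i: "i \<in> {?x..<?y}" "BB u s i (Suc i) \<ge> 1 + threshold i" by (auto simp: not_less)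
    let ?w = "W {i, Suc i}" and ?b = "BB u s i (Suc i)"
    have q: "?w / 2 - ?m \<ge> 0"
    proof -
      have "?m \<le> C3 * ?w" using M_le_W[OF x(1), of i] m i x by auto
      also have "\<dots> \<le> 1 / 2 * ?w" using C3_bounds W_nearest_pos[of i] i x by (intro mult_right_mono) auto
      finally show ?thesis by simp
    qed
    have bs: "BB u s j k \<ge> 0" for j k by (rule order_trans[OF zero_le_one B_pair_ge_1])
    have "factor u s \<sigma> \<le> (4 * (BB u s ?x i * ?b * BB u s (Suc i) ?y)) powr ?m"
      unfolding f using m bs by (intro powr_mono2 B_pair_split_three) auto
    also have "\<dots> = 4 powr ?m * (BB u s ?x i powr ?m * ?b powr ?m * BB u s (Suc i) ?y powr ?m)"
      using bs by (simp add: powr_mult)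
    also have "?b powr ?m = ?b powr (?w / 2) * ?b powr (- (?w / 2 - ?m))"
      by (simp add: powr_add[symmetric])
    \<comment> \<open>Markov's inequality in pointwise form: raising the exponent of the irregular
      edge to W / 2 costs a negative power of a number that is at least 1 +
      \<open>threshold i\<close>.\<close>
    also have "?b powr (- (?w / 2 - ?m)) \<le> (1 + threshold i) powr (- (?w / 2 - ?m))"
      using i(2) q threshold_bounds(3)[of i] by (intro powr_mono2') auto
    finally have "factor u s \<sigma> \<le> 4 powr ?m * (BB u s ?x i powr ?m *
        (?b powr (?w / 2) * (1 + threshold i) powr (- (?w / 2 - ?m))) * BB u s (Suc i) ?y powr ?m)"
      by (auto simp: mult_left_mono mult_right_mono)
    also have "\<dots> = ?S i" by (simp add: factor_def irregular_cost_def mult_ac)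
    also have "\<dots> \<le> (\<Sum>i\<in>{?x..<?y}. ?S i)" using i(1) S by (intro member_le_sum) auto
    finally show ?thesis using factor_nonneg[of u s "Segment Regular ?x ?y ?m"] by linarith
  qed
qed

text \<open>The summand 1 lets degenerate segments count, the factor 2 makes up for it: a split
  removes an edge worth 2 and adds only one further segment.\<close>

definition free_length :: "segment list \<Rightarrow> nat" where
  "free_length l = sum_list (map (\<lambda>\<sigma>. if kind \<sigma> = Free then 2 * (hi \<sigma> - lo \<sigma>) + 1 else 0) l)"

lemma expect_mono:
  assumes "\<And>u s. F u s \<le> G u s"
  shows "expect F \<le> expect G"
  unfolding expect_def
  by (intro nn_integral_mono) (auto intro!: ennreal_leI mult_left_mono assms edge_density_W_nonneg)

lemma expect_add_sum:
  assumes "\<And>i. i \<in> A \<Longrightarrow> C i \<ge> 0"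
  shows "expect (\<lambda>u s. factors u s l + (\<Sum>i\<in>A. C i * factors u s (k i))) =
    expect (\<lambda>u s. factors u s l) + (\<Sum>i\<in>A. ennreal (C i) * expect (\<lambda>u s. factors u s (k i)))"
proof -
  let ?d = "\<lambda>p. edge_density \<Lambda> \<rho> W (fst p) (snd p)" and ?f = "\<lambda>l p. factors (fst p) (snd p) l"
  have "expect (\<lambda>u s. factors u s l + (\<Sum>i\<in>A. C i * factors u s (k i))) =
      (\<integral>\<^sup>+p. ennreal (?d p * ?f l p) + (\<Sum>i\<in>A. ennreal (C i) * ennreal (?d p * ?f (k i) p)) \<partial>double_field_space \<Lambda>)"
    unfolding expect_def case_prod_beta
  proof (rule nn_integral_cong)
    fix p
    have nonneg: "?d p * ?f l p \<ge> 0" for l by (intro mult_nonneg_nonneg edge_density_W_nonneg factors_nonneg)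
    have "?d p * (?f l p + (\<Sum>i\<in>A. C i * ?f (k i) p)) = ?d p * ?f l p + (\<Sum>i\<in>A. C i * (?d p * ?f (k i) p))"
      by (simp add: distrib_left sum_distrib_left mult_ac)
    moreover have "(\<Sum>i\<in>A. ennreal (C i) * ennreal (?d p * ?f (k i) p)) = ennreal (\<Sum>i\<in>A. C i * (?d p * ?f (k i) p))"
      using assms nonneg by (subst sum_ennreal[symmetric]) (auto simp: ennreal_mult)
    ultimately show "ennreal (?d p * (?f l p + (\<Sum>i\<in>A. C i * ?f (k i) p))) =
        ennreal (?d p * ?f l p) + (\<Sum>i\<in>A. ennreal (C i) * ennreal (?d p * ?f (k i) p))"
      using assms nonneg by (simp add: ennreal_plus sum_nonneg)
  qed
  also have "\<dots> = (\<integral>\<^sup>+p. ennreal (?d p * ?f l p) \<partial>double_field_space \<Lambda>) +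
      (\<Sum>i\<in>A. \<integral>\<^sup>+p. ennreal (C i) * ennreal (?d p * ?f (k i) p) \<partial>double_field_space \<Lambda>)"
    by (subst nn_integral_add, measurable) (subst nn_integral_sum, measurable)
  also have "(\<Sum>i\<in>A. \<integral>\<^sup>+p. ennreal (C i) * ennreal (?d p * ?f (k i) p) \<partial>double_field_space \<Lambda>) =
      (\<Sum>i\<in>A. ennreal (C i) * (\<integral>\<^sup>+p. ennreal (?d p * ?f (k i) p) \<partial>double_field_space \<Lambda>))"
    by (intro sum.cong refl nn_integral_cmult) measurable
  finally show ?thesis by (simp only: expect_def case_prod_beta')
qed

text \<open>A \<open>Free\<close> segment is replaced by a \<open>Regular\<close> one plus the sum
  over split positions; all resulting configurations have smaller free length, so the induction
  covers them together with the remaining segments.\<close>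

theorem expect_factors_le:
  assumes "configuration l"
  shows "expect (\<lambda>u s. factors u s l) \<le> ennreal (factor_bounds l)"
  using assms
proof (induction "free_length l" arbitrary: l rule: less_induct)
  case less
  show ?case
  proof (cases "\<forall>\<sigma>\<in>set l. kind \<sigma> \<noteq> Free")
    case True
    then show ?thesis by (intro expect_factors_base less.prems)
  next
    case False
    then obtain p \<sigma> q where l: "l = p @ \<sigma> # q" and free: "kind \<sigma> = Free"
      by (metis split_list)
    let ?x = "lo \<sigma>" and ?y = "hi \<sigma>" and ?m = "exponent \<sigma>"
    have valid_l: "\<forall>\<tau>\<in>set p \<union> set q. valid_segment \<tau>" "valid_segment \<sigma>"
      and sorted: "sorted_wrt apart p" "sorted_wrt apart q" "\<forall>\<tau>\<in>set p. apart \<tau> \<sigma> \<and> (\<forall>\<tau>'\<in>set q. apart \<tau> \<tau>')"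
        "\<forall>\<tau>'\<in>set q. apart \<sigma> \<tau>'"
      using less.prems unfolding l configuration_def sorted_wrt_append by auto
    have x: "1 \<le> ?x" "?x \<le> ?y" "?y \<le> N" and m: "0 \<le> ?m" "?m \<le> M ?x"
      using valid_l(2) free by (auto simp: valid_segment_def)
    have pq: "factor_bounds p \<ge> 0" "factor_bounds q \<ge> 0"
      using valid_l by (auto intro!: factor_bounds_nonneg)
    have bound_\<sigma>: "factor_bound \<sigma> = 1 + \<kappa>" using free by (simp add: factor_bound_def)
    show ?thesis
    proof (cases "?x = ?y")
      case True
      have "free_length (p @ q) < free_length l" using free by (simp add: l free_length_def)
      moreover have "configuration (p @ q)"
        using valid_l sorted by (auto simp: configuration_def sorted_wrt_append)
      ultimately have "expect (\<lambda>u s. factors u s (p @ q)) \<le> ennreal (factor_bounds (p @ q))" by (rule less.hyps)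
      moreover have "factors u s l = factors u s (p @ q)" for u s
        using True free by (simp add: l factor_def)
      moreover have "factor_bounds (p @ q) \<le> factor_bounds l"
      proof -
        have "factor_bounds p * 1 * factor_bounds q \<le> factor_bounds p * (1 + \<kappa>) * factor_bounds q"
          using pq \<kappa> by (intro mult_right_mono mult_left_mono) auto
        then show ?thesis by (simp add: l bound_\<sigma> mult.assoc)
      qed
      ultimately show ?thesis by (simp add: order_trans[OF _ ennreal_leI])
    next
      case False
      with x have xy: "?x < ?y" by simp
      let ?r = "p @ Segment Regular ?x ?y ?m # q"
      let ?k = "\<lambda>i. p @ Segment Free ?x i ?m # Segment Nearest i (Suc i) (W {i, Suc i} / 2) # Segment Free (Suc i) ?y ?m # q"
      have conf_r: "configuration ?r"
      proof -
        have "apart \<tau> (Segment Regular ?x ?y ?m)" if "\<tau> \<in> set p" for \<tau>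
          using sorted(3) that by (auto intro: apart_subsegment(2)[of _ \<sigma>])
        moreover have "apart (Segment Regular ?x ?y ?m) \<tau>" if "\<tau> \<in> set q" for \<tau>
          using sorted(4) that by (auto intro: apart_subsegment(1)[of \<sigma>])
        moreover have "valid_segment (Segment Regular ?x ?y ?m)"
          using x m xy by (simp add: valid_segment_def)
        ultimately show ?thesis
          using valid_l sorted unfolding configuration_def sorted_wrt_append by auto
      qed
      have conf_k: "configuration (?k i)" if i: "i \<in> {?x..<?y}" for i
      proof -
        have "W {i, Suc i} > 0" using i x by (intro W_nearest_pos) auto
        moreover have "?m \<le> M (Suc i)" using m M_mono[of ?x "Suc i"] i by auto
        moreover have "apart \<tau> (Segment Free ?x i ?m)" "apart \<tau> (Segment Nearest i (Suc i) (W {i, Suc i} / 2))"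
          "apart \<tau> (Segment Free (Suc i) ?y ?m)" if "\<tau> \<in> set p" for \<tau>
          using sorted(3) that i by (auto intro: apart_subsegment(2)[of _ \<sigma>])
        moreover have "apart (Segment Free ?x i ?m) \<tau>" "apart (Segment Nearest i (Suc i) (W {i, Suc i} / 2)) \<tau>"
          "apart (Segment Free (Suc i) ?y ?m) \<tau>" if "\<tau> \<in> set q" for \<tau>
          using sorted(4) that i by (auto intro: apart_subsegment(1)[of \<sigma>])
        moreover have "apart (Segment Free ?x i ?m) (Segment Nearest i (Suc i) (W {i, Suc i} / 2))"
          "apart (Segment Free ?x i ?m) (Segment Free (Suc i) ?y ?m)"
          "apart (Segment Nearest i (Suc i) (W {i, Suc i} / 2)) (Segment Free (Suc i) ?y ?m)"
          by (auto simp: apart_def)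
        ultimately show ?thesis
          using valid_l sorted x m i
          unfolding configuration_def sorted_wrt_append by (auto simp: valid_segment_def)
      qed
      have less_r: "free_length ?r < free_length l" using free by (simp add: l free_length_def)
      have less_k: "free_length (?k i) < free_length l" if "i \<in> {?x..<?y}" for i
      proof -
        have "(2 * (i - ?x) + 1) + (2 * (?y - Suc i) + 1) < 2 * (?y - ?x) + 1" using that by auto
        then show ?thesis using free by (simp add: l free_length_def)
      qed
      define C where "C i = irregular_cost ?m i" for i
      have C: "C i \<ge> 0" for i by (simp add: C_def irregular_cost_nonneg)
      have "expect (\<lambda>u s. factors u s l) \<le> expect (\<lambda>u s. factors u s ?r + (\<Sum>i\<in>{?x..<?y}. C i * factors u s (?k i)))"
      proof (rule expect_mono)
        fix u s
        have "factors u s p * factor u s \<sigma> * factors u s q \<le> factors u s p *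
            (factor u s (Segment Regular ?x ?y ?m) + (\<Sum>i\<in>{?x..<?y}. C i *
              (factor u s (Segment Free ?x i ?m) * (factor u s (Segment Nearest i (Suc i) (W {i, Suc i} / 2)) *
               factor u s (Segment Free (Suc i) ?y ?m))))) * factors u s q"
          unfolding C_def
          by (intro mult_right_mono mult_left_mono factor_free_le xy free valid_l factors_nonneg)
        also have "\<dots> = factors u s ?r + (\<Sum>i\<in>{?x..<?y}. C i * factors u s (?k i))"
          by (simp add: distrib_left distrib_right sum_distrib_left sum_distrib_right mult_ac)
        finally show "factors u s l \<le> factors u s ?r + (\<Sum>i\<in>{?x..<?y}. C i * factors u s (?k i))"
          by (simp add: l mult_ac)
      qed
      also have "\<dots> = expect (\<lambda>u s. factors u s ?r) + (\<Sum>i\<in>{?x..<?y}. ennreal (C i) * expect (\<lambda>u s. factors u s (?k i)))"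
        by (rule expect_add_sum) (rule C)
      also have "\<dots> \<le> ennreal (factor_bounds ?r) + (\<Sum>i\<in>{?x..<?y}. ennreal (C i) * ennreal (factor_bounds (?k i)))"
        by (intro add_mono sum_mono mult_left_mono less.hyps conf_r conf_k less_r less_k) auto
      also have "\<dots> = ennreal (factor_bounds ?r + (\<Sum>i\<in>{?x..<?y}. C i * factor_bounds (?k i)))"
      proof -
        have k_nonneg: "factor_bounds (?k i) \<ge> 0" if "i \<in> {?x..<?y}" for i
          using conf_k[OF that] by (intro factor_bounds_nonneg) (simp add: configuration_def)
        have r_nonneg: "factor_bounds ?r \<ge> 0"
          using conf_r by (intro factor_bounds_nonneg) (simp add: configuration_def)
        have "(\<Sum>i\<in>{?x..<?y}. ennreal (C i) * ennreal (factor_bounds (?k i))) =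
            ennreal (\<Sum>i\<in>{?x..<?y}. C i * factor_bounds (?k i))"
          using C k_nonneg by (subst sum_ennreal[symmetric]) (auto simp: ennreal_mult)
        moreover have "(\<Sum>i\<in>{?x..<?y}. C i * factor_bounds (?k i)) \<ge> 0"
          using C k_nonneg by (intro sum_nonneg mult_nonneg_nonneg) auto
        ultimately show ?thesis using r_nonneg by (simp only: ennreal_plus)
      qed
      also have "\<dots> \<le> ennreal (factor_bounds l)"
      proof (rule ennreal_leI)
        \<comment> \<open>Exponent W / 2 on the middle edge gives 1 / (1 - 1 / 2) = 2, and each
          outer piece gives 1 + \<kappa>.\<close>
        have bound_k: "factor_bounds (?k i) = factor_bounds p * (2 * (1 + \<kappa>)\<^sup>2) * factor_bounds q" if i: "i \<in> {?x..<?y}" for i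
        proof -
          have "W {i, Suc i} > 0" using i x by (intro W_nearest_pos) auto
          then show ?thesis by (simp add: factor_bound_def power2_eq_square)
        qed
        have "(\<Sum>i\<in>{?x..<?y}. C i * factor_bounds (?k i)) =
            (\<Sum>i\<in>{?x..<?y}. C i) * (factor_bounds p * (2 * (1 + \<kappa>)\<^sup>2) * factor_bounds q)"
          unfolding sum_distrib_right by (intro sum.cong refl arg_cong2[where f = "(*)"] bound_k)
        also have "\<dots> = factor_bounds p * ((\<Sum>i\<in>{?x..<?y}. C i) * (2 * (1 + \<kappa>)\<^sup>2)) * factor_bounds q"
          by (simp only: mult_ac)
        also have "\<dots> \<le> factor_bounds p * (\<kappa> / 2) * factor_bounds q"
        proof (intro mult_right_mono mult_left_mono pq)
          \<comment> \<open>The constant 36 of \<open>Wbar0\<close> is felt here: 8 \<kappa> / 35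
            stays below \<kappa> / 2.\<close>
          have "(1 + \<kappa>)\<^sup>2 \<le> 2\<^sup>2" using \<kappa> by (intro power_mono) auto
          then have "(\<Sum>i\<in>{?x..<?y}. C i) * (2 * (1 + \<kappa>)\<^sup>2) \<le> \<kappa> / 35 * 8"
            using sum_irregular_cost_le[OF x(1,3) m] \<kappa> by (intro mult_mono) (auto simp: C_def)
          then show "(\<Sum>i\<in>{?x..<?y}. C i) * (2 * (1 + \<kappa>)\<^sup>2) \<le> \<kappa> / 2" using \<kappa> by simp
        qed
        finally show "factor_bounds ?r + (\<Sum>i\<in>{?x..<?y}. C i * factor_bounds (?k i)) \<le> factor_bounds l"
          by (simp add: l factor_bound_def free algebra_simps)
      qed
      finally show ?thesis .
    qed
  qed
qed

section \<open>Transfer to the measure of the model\<close>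

lemma sigma_density_eq: "sigma_density \<Lambda> \<rho> W u s = edge_density \<Lambda> \<rho> W u s"
proof -
  have "(\<Sum>e\<in>positive_edges \<Lambda> \<rho> W. W e * (B_edge \<Lambda> u s e - 1)) = (\<Sum>e\<in>E. W e * (B_edge \<Lambda> u s e - 1))"
    using W_nonneg finite_edges[of V] finite_\<Lambda>
    by (intro sum.mono_neutral_left) (force simp: positive_edges_def)+
  moreover have "det_on \<Lambda> (D_matrix \<Lambda> \<rho> W u) = laplacian_det \<Lambda> \<rho> (conductance W (pinned \<Lambda> u))"
    unfolding laplacian_det_def
  proof (rule det_on_cong)
    have pair: "conductance W (pinned \<Lambda> u) {i, k} = W {i, k} * exp (pinned \<Lambda> u i + pinned \<Lambda> u k)" if "k \<noteq> i" for i k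
      using that by (simp add: conductance_def exp_add)
    fix i j
    show "D_matrix \<Lambda> \<rho> W u i j = laplacian \<Lambda> \<rho> (conductance W (pinned \<Lambda> u)) i j"
      unfolding D_matrix_def laplacian_def using pair by (auto intro!: sum.cong)
  qed
  ultimately show ?thesis by (simp add: sigma_density_def edge_density_eq)
qed

lemma sets_sigma_measure: "sets (sigma_measure \<Lambda> \<rho> W) = sets (double_field_space \<Lambda>)"
  by (simp add: sigma_measure_def)

lemma nn_integral_sigma_measure:
  assumes [measurable]: "(\<lambda>p. F (fst p) (snd p)) \<in> borel_measurable (double_field_space \<Lambda>)"
    and nonneg: "\<And>u s. F u s \<ge> 0"
  shows "(\<integral>\<^sup>+(u, s). ennreal (F u s) \<partial>sigma_measure \<Lambda> \<rho> W) = expect F"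
  unfolding sigma_measure_def sigma_density_eq case_prod_beta expect_def
  by (subst nn_integral_density) (auto simp: ennreal_mult edge_density_W_nonneg nonneg)

lemma sigma_measure_bound:
  assumes meas: "(\<lambda>p. F (fst p) (snd p)) \<in> borel_measurable (double_field_space \<Lambda>)"
    and nonneg: "\<And>u s. F u s \<ge> 0" and le: "expect F \<le> ennreal c" and c: "c \<ge> 0"
  shows "integrable (sigma_measure \<Lambda> \<rho> W) (\<lambda>(u, s). F u s)"
    and "(\<integral>(u, s). F u s \<partial>sigma_measure \<Lambda> \<rho> W) \<le> c"
proof -
  have meas': "(\<lambda>(u, s). F u s) \<in> borel_measurable (sigma_measure \<Lambda> \<rho> W)"
    using meas by (subst measurable_cong_sets[OF sets_sigma_measure refl]) (simp add: case_prod_beta)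
  have nn: "(\<integral>\<^sup>+p. ennreal (case p of (u, s) \<Rightarrow> F u s) \<partial>sigma_measure \<Lambda> \<rho> W) \<le> ennreal c"
    using nn_integral_sigma_measure[OF meas nonneg] le by (simp add: case_prod_beta')
  show "integrable (sigma_measure \<Lambda> \<rho> W) (\<lambda>(u, s). F u s)"
    using meas' nonneg nn by (intro integrableI_nonneg) (auto intro: le_less_trans)
  show "(\<integral>(u, s). F u s \<partial>sigma_measure \<Lambda> \<rho> W) \<le> c"
    using meas' nonneg nn c by (subst integral_eq_nn_integral) (auto intro: enn2real_leI)
qed

lemma edge_Min_Max:
  assumes "e \<in> edges {1..N}"
  shows "e = {Min e, Max e}" "1 \<le> Min e" "Min e < Max e" "Max e \<le> N"
proof -
  obtain i j where e: "e = {i, j}" "i \<in> {1..N}" "j \<in> {1..N}" "i \<noteq> j" using assms by (auto simp: edges_def)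
  then show "e = {Min e, Max e}" "1 \<le> Min e" "Min e < Max e" "Max e \<le> N"
    by (cases "i < j"; auto simp: min_def max_def)+
qed

text \<open>Edges of \<open>E'\<close> become \<open>Nearest\<close> segments, those of
  \<open>E''\<close> \<open>Free\<close> ones; disjoint open intervals are segments that are
  apart.\<close>

lemma expect_product_le:
  assumes adm: "admissible_edges N E' E''"
    and m': "\<And>e. e \<in> E' \<Longrightarrow> 0 \<le> m e \<and> m e < W e"
    and m'': "\<And>e. e \<in> E'' \<Longrightarrow> 0 \<le> m e \<and> m e \<le> M (Min e)"
  shows "expect (\<lambda>u s. (\<Prod>e\<in>E'. B_edge \<Lambda> u s e powr m e) * (\<Prod>e\<in>E''. B_edge \<Lambda> u s e powr m e)) \<le>
    ennreal ((\<Prod>e\<in>E'. 1 / (1 - m e / W e)) * (1 + \<kappa>) ^ card E'')"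
proof -
  have sub: "E' \<subseteq> edges {1..N}" "E'' \<subseteq> edges {1..N}" "E' \<inter> E'' = {}"
    and near: "\<And>e. e \<in> E' \<Longrightarrow> Max e = Suc (Min e)"
    and disj: "\<And>e f. e \<in> E' \<union> E'' \<Longrightarrow> f \<in> E' \<union> E'' \<Longrightarrow> e \<noteq> f \<Longrightarrow>
        {real (Min e)<..<real (Max e)} \<inter> {real (Min f)<..<real (Max f)} = {}"
    using adm unfolding admissible_edges_def by auto
  have fin: "finite E'" "finite E''" using sub finite_edges[of "{1..N}"] finite_subset by auto
  then have "finite (E' \<union> E'')" by simp
  then obtain es where es: "set es = E' \<union> E''" "distinct es" using finite_distinct_list by blast
  define seg where "seg e = Segment (if e \<in> E' then Nearest else Free) (Min e) (Max e) (m e)" for e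
  have conf: "configuration (map seg es)"
    unfolding configuration_def
  proof
    show "\<forall>\<sigma>\<in>set (map seg es). valid_segment \<sigma>"
    proof
      fix \<sigma> assume "\<sigma> \<in> set (map seg es)"
      then obtain e where e: "e \<in> E' \<union> E''" "\<sigma> = seg e" using es by auto
      then have "e \<in> edges {1..N}" using sub by auto
      note emm = edge_Min_Max[OF this]
      show "valid_segment \<sigma>"
        using e m'[of e] m''[of e] near[of e] emm(2-4) emm(1)[symmetric]
        by (auto simp: valid_segment_def seg_def)
    qed
    have "apart (seg e) (seg f)" if "e \<in> E' \<union> E''" "f \<in> E' \<union> E''" "e \<noteq> f" for e f
    proof (rule ccontr)
      assume "\<not> apart (seg e) (seg f)"
      then have ef: "Min f < Max e" "Min e < Max f" by (auto simp: apart_def seg_def)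
      have lt: "Min e < Max e" "Min f < Max f" using that sub edge_Min_Max(3) by blast+
      \<comment> \<open>Overlapping intervals with integer end points share a half-integer.\<close>
      define z where "z = max (real (Min e)) (real (Min f)) + 1 / 2"
      have "z \<in> {real (Min e)<..<real (Max e)}" "z \<in> {real (Min f)<..<real (Max f)}"
        using ef lt unfolding z_def by (auto simp: max_def split: if_splits)
      then show False using disj[OF that] by auto
    qed
    note apart_seg = this
    show "sorted_wrt apart (map seg es)"
      unfolding sorted_wrt_iff_nth_less
    proof (intro allI impI)
      fix i j assume "i < j" "j < length (map seg es)"
      then have ij: "i < j" "j < length es" by auto
      then have "es ! i \<noteq> es ! j" using es(2) by (simp add: nth_eq_iff_index_eq)
      moreover have "es ! i \<in> E' \<union> E''" "es ! j \<in> E' \<union> E''"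
        unfolding es(1)[symmetric] using ij by auto
      ultimately have "apart (seg (es ! i)) (seg (es ! j))" by (intro apart_seg)
      then show "apart (map seg es ! i) (map seg es ! j)" using ij by simp
    qed
  qed
  have union: "(\<Prod>e\<in>E' \<union> E''. h e) = (\<Prod>e\<in>E'. h e) * (\<Prod>e\<in>E''. h e)" for h :: "nat set \<Rightarrow> real"
    using sub fin by (intro prod.union_disjoint) auto
  have Bseg: "factor u s (seg e) = B_edge \<Lambda> u s e powr m e" if "e \<in> E' \<union> E''" for u s e
    by (simp add: factor_def seg_def B_edge_def)
  have "factors u s (map seg es) = (\<Prod>e\<in>E' \<union> E''. factor u s (seg e))" for u s
    unfolding es(1)[symmetric] prod.distinct_set_conv_list[OF es(2)] by (simp add: o_def)
  then have 1: "factors u s (map seg es) = (\<Prod>e\<in>E'. B_edge \<Lambda> u s e powr m e) * (\<Prod>e\<in>E''. B_edge \<Lambda> u s e powr m e)" for u s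
    using Bseg by (simp add: union)
  have "factor_bounds (map seg es) = (\<Prod>e\<in>E' \<union> E''. factor_bound (seg e))"
    unfolding es(1)[symmetric] prod.distinct_set_conv_list[OF es(2)] by (simp add: o_def)
  also have "\<dots> = (\<Prod>e\<in>E'. 1 / (1 - m e / W e)) * (\<Prod>e\<in>E''. 1 + \<kappa>)"
    unfolding union
  proof (intro arg_cong2[where f = "(*)"] prod.cong refl)
    fix e assume "e \<in> E'"
    then show "factor_bound (seg e) = 1 / (1 - m e / W e)"
      using edge_Min_Max(1)[of e] sub by (auto simp: factor_bound_def seg_def)
  next
    fix e assume "e \<in> E''"
    then show "factor_bound (seg e) = 1 + \<kappa>"
      using sub by (auto simp: factor_bound_def seg_def)
  qed
  finally show ?thesis using expect_factors_le[OF conf] unfolding 1 by simp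
qed

lemma nearest_bound_le:
  assumes "e \<in> edges {1..N}" "Max e = Min e + 1" "0 \<le> x" "x \<le> M (Min e)"
  shows "0 \<le> 1 / (1 - x / W e)" "1 / (1 - x / W e) \<le> 1 + \<kappa>"
proof -
  note emm = edge_Min_Max[OF assms(1)]
  have e: "e = {Min e, Suc (Min e)}" using emm(1) assms(2) by simp
  have W: "W e > 0" using W_nearest_pos[of "Min e"] emm e assms(2) by simp
  have "x \<le> C3 * W e" using M_le_W[of "Min e" "Min e"] emm e assms by auto
  also have "\<dots> \<le> \<kappa> / 3 * W e" using W C3_le_\<kappa> by (intro mult_right_mono) auto
  finally have "x / W e \<le> \<kappa> / 3" using W by (simp add: divide_le_eq)
  moreover have "0 \<le> x / W e" using W assms by simp
  ultimately have 1: "1 - x / W e \<ge> 0" "1 / (1 - x / W e) \<le> 1 + \<kappa> / 2"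
    using one_over_one_minus_le[of "x / W e"] \<kappa> by linarith+
  show "0 \<le> 1 / (1 - x / W e)" using 1(1) by (intro divide_nonneg_nonneg) auto
  show "1 / (1 - x / W e) \<le> 1 + \<kappa>" using 1(2) \<kappa> by linarith
qed

lemma sigma_measure_product_bound:
  assumes adm: "admissible_edges N E' E''"
    and m': "\<And>e. e \<in> E' \<Longrightarrow> 0 \<le> m e \<and> m e < W e"
    and m'': "\<And>e. e \<in> E'' \<Longrightarrow> 0 \<le> m e \<and> m e \<le> M (Min e)"
  shows "integrable (sigma_measure \<Lambda> \<rho> W)
      (\<lambda>(u, s). (\<Prod>e\<in>E'. B_edge \<Lambda> u s e powr m e) * (\<Prod>e\<in>E''. B_edge \<Lambda> u s e powr m e))" (is ?int)
    and "(\<integral>(u, s). (\<Prod>e\<in>E'. B_edge \<Lambda> u s e powr m e) * (\<Prod>e\<in>E''. B_edge \<Lambda> u s e powr m e) \<partial>sigma_measure \<Lambda> \<rho> W)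
      \<le> (\<Prod>e\<in>E'. 1 / (1 - m e / W e)) * (1 + \<kappa>) ^ card E''" (is ?le)
proof -
  have meas: "(\<lambda>p. (\<Prod>e\<in>E'. B_edge \<Lambda> (fst p) (snd p) e powr m e) * (\<Prod>e\<in>E''. B_edge \<Lambda> (fst p) (snd p) e powr m e))
      \<in> borel_measurable (double_field_space \<Lambda>)" by measurable
  have c: "(\<Prod>e\<in>E'. 1 / (1 - m e / W e)) * (1 + \<kappa>) ^ card E'' \<ge> 0"
    using m' \<kappa> by (intro mult_nonneg_nonneg prod_nonneg) (force simp: divide_le_eq_1)+
  show ?int ?le
    by (rule sigma_measure_bound[OF meas _ expect_product_le[OF adm m' m''] c]; (intro mult_nonneg_nonneg prod_nonneg)?; simp)+
qed

lemma product_bound_le_power: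
  assumes adm: "admissible_edges N E' E''" and "\<And>e. e \<in> E' \<Longrightarrow> 0 \<le> m e \<and> m e \<le> M (Min e)"
  shows "(\<Prod>e\<in>E'. 1 / (1 - m e / W e)) * (1 + \<kappa>) ^ card E'' \<le> (1 + \<kappa>) ^ (card E' + card E'')"
proof -
  have "e \<in> edges {1..N} \<and> Max e = Min e + 1" if "e \<in> E'" for e
    using adm that unfolding admissible_edges_def by auto
  then have "(\<Prod>e\<in>E'. 1 / (1 - m e / W e)) \<le> (\<Prod>e\<in>E'. 1 + \<kappa>)"
    using assms(2) by (intro prod_mono conjI nearest_bound_le) auto
  then show ?thesis using \<kappa> by (simp add: power_add mult_right_mono)
qed

lemma single_edge_bounds:
  assumes xy: "x \<in> {1..N}" "y \<in> {1..N}" "x < y" and m: "0 \<le> m" "m \<le> M x"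
  shows "integrable (sigma_measure \<Lambda> \<rho> W) (\<lambda>(u, s). cosh (pinned \<Lambda> u x - pinned \<Lambda> u y) powr m)"
    and "integrable (sigma_measure \<Lambda> \<rho> W) (\<lambda>(u, s). B_edge \<Lambda> u s {x, y} powr m)"
    and "(\<integral>(u, s). cosh (pinned \<Lambda> u x - pinned \<Lambda> u y) powr m \<partial>sigma_measure \<Lambda> \<rho> W)
      \<le> (\<integral>(u, s). B_edge \<Lambda> u s {x, y} powr m \<partial>sigma_measure \<Lambda> \<rho> W)"
    and "(\<integral>(u, s). B_edge \<Lambda> u s {x, y} powr m \<partial>sigma_measure \<Lambda> \<rho> W) \<le> 1 + \<kappa>"
proof -
  have adm: "admissible_edges N {} {{x, y}}"
    using xy by (auto simp: admissible_edges_def intro: doubleton_in_edges)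
  have Min: "Min {x, y} = x" using xy by (simp add: min_def)
  have B: "integrable (sigma_measure \<Lambda> \<rho> W) (\<lambda>(u, s). B_edge \<Lambda> u s {x, y} powr m)"
    "(\<integral>(u, s). B_edge \<Lambda> u s {x, y} powr m \<partial>sigma_measure \<Lambda> \<rho> W) \<le> 1 + \<kappa>"
    using sigma_measure_product_bound[OF adm, of "\<lambda>_. m"] m by (auto simp: Min)
  have le: "cosh (pinned \<Lambda> u x - pinned \<Lambda> u y) powr m \<le> B_edge \<Lambda> u s {x, y} powr m" for u s
    unfolding B_edge_pair B_pair_def using m cosh_real_nonneg by (intro powr_mono2) auto
  have meas: "(\<lambda>(u, s). cosh (pinned \<Lambda> u x - pinned \<Lambda> u y) powr m) \<in> borel_measurable (sigma_measure \<Lambda> \<rho> W)"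
    unfolding measurable_cong_sets[OF sets_sigma_measure refl] case_prod_beta by measurable
  show cosh: "integrable (sigma_measure \<Lambda> \<rho> W) (\<lambda>(u, s). cosh (pinned \<Lambda> u x - pinned \<Lambda> u y) powr m)"
    by (rule Bochner_Integration.integrable_bound[OF B(1) meas]) (use le in \<open>auto intro!: AE_I2\<close>)
  show "(\<integral>(u, s). cosh (pinned \<Lambda> u x - pinned \<Lambda> u y) powr m \<partial>sigma_measure \<Lambda> \<rho> W)
      \<le> (\<integral>(u, s). B_edge \<Lambda> u s {x, y} powr m \<partial>sigma_measure \<Lambda> \<rho> W)"
    by (rule integral_mono[OF cosh B(1)]) (use le in auto)
  show "integrable (sigma_measure \<Lambda> \<rho> W) (\<lambda>(u, s). B_edge \<Lambda> u s {x, y} powr m)"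
    "(\<integral>(u, s). B_edge \<Lambda> u s {x, y} powr m \<partial>sigma_measure \<Lambda> \<rho> W) \<le> 1 + \<kappa>"
    by (fact B)+
qed

end

text \<open>The logarithm of 1 / 36 is -2 ln 6, so \<open>Wbar0\<close> is ln 6 divided by a
  minimum, hence a maximum of two quotients.\<close>

lemma Wbar0_special:
  "Wbar0 1 \<alpha> 0 = max (16 * ln 6) (3 / 2 * exp (sqrt 2 * ((\<alpha> - 1) / (\<alpha> - 3))) * log 2 6)"
proof -
  define a where "a = 2 * ln 2 / (3 * exp (sqrt 2 * ((\<alpha> - 1) / (\<alpha> - 3))))"
  have a: "a > 0" by (simp add: a_def)
  have c4: "c4 1 \<alpha> 0 = min a (1 / 16)" by (simp add: c4_def a_def)
  have "ln (1 / 36) = - ln (6\<^sup>2 :: real)" by (subst ln_div) auto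
  also have "\<dots> = - (2 * ln 6)" by (subst ln_realpow) auto
  finally have "Wbar0 1 \<alpha> 0 = ln 6 / min a (1 / 16)" unfolding Wbar0_def c4 by simp
  also have "\<dots> = max (16 * ln 6) (ln 6 / a)"
    using a by (auto simp: min_def max_def field_simps)
  also have "ln 6 / a = 3 / 2 * exp (sqrt 2 * ((\<alpha> - 1) / (\<alpha> - 3))) * log 2 6"
    by (simp add: a_def log_def)
  finally show ?thesis .
qed

text \<open>The bound by a power of 1 + \<kappa> carries the condition of \<open>E''\<close> on the
  exponents of \<open>E'\<close> too, because 1 / (1 - m / W) is unbounded as m approaches W.
  Integrability is asserted separately, since the Bochner integral of a non-integrable function is
  0. Uniformity lies in the bounds: 1 + \<kappa> does not involve the size or the pinning.\<close>

theorem lemma1p4: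
  fixes \<kappa> \<alpha> \<gamma> :: real
  assumes "0 < \<kappa>" "\<kappa> \<le> 1" "\<alpha> > 3" "0 \<le> \<gamma>" "\<gamma> < \<alpha> - 3"
  shows
    "(\<forall>Wbar N \<Lambda> \<rho> W.
        Wbar \<ge> Wbar0 \<kappa> \<alpha> \<gamma> \<longrightarrow> inhomogeneous_model \<alpha> Wbar N \<Lambda> \<rho> W \<longrightarrow>
        (\<forall>E' E'' m.
           admissible_edges N E' E'' \<longrightarrow>
           (\<forall>e\<in>E'. 0 \<le> m e \<and> m e < W e) \<longrightarrow>
           (\<forall>e\<in>E''. 0 \<le> m e \<and> m e \<le> m_vertex \<kappa> \<alpha> \<gamma> Wbar (Min e)) \<longrightarrow>
           integrable (sigma_measure \<Lambda> \<rho> W)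
             (\<lambda>(u, s). (\<Prod>e\<in>E'. B_edge \<Lambda> u s e powr m e) * (\<Prod>e\<in>E''. B_edge \<Lambda> u s e powr m e)) \<and>
           (\<integral>(u, s). (\<Prod>e\<in>E'. B_edge \<Lambda> u s e powr m e) * (\<Prod>e\<in>E''. B_edge \<Lambda> u s e powr m e)
              \<partial>sigma_measure \<Lambda> \<rho> W)
             \<le> (\<Prod>e\<in>E'. 1 / (1 - m e / W e)) * (1 + \<kappa>) ^ card E'' \<and>
           ((\<forall>e\<in>E'. m e \<le> m_vertex \<kappa> \<alpha> \<gamma> Wbar (Min e)) \<longrightarrow>
             (\<Prod>e\<in>E'. 1 / (1 - m e / W e)) * (1 + \<kappa>) ^ card E''
               \<le> (1 + \<kappa>) ^ (card E' + card E''))) \<and>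
        (\<forall>x\<in>{1..N}. \<forall>y\<in>{1..N}. \<forall>m.
           x < y \<longrightarrow> 0 \<le> m \<longrightarrow> m \<le> m_vertex \<kappa> \<alpha> \<gamma> Wbar x \<longrightarrow>
           integrable (sigma_measure \<Lambda> \<rho> W)
             (\<lambda>(u, s). cosh (pinned \<Lambda> u x - pinned \<Lambda> u y) powr m) \<and>
           integrable (sigma_measure \<Lambda> \<rho> W) (\<lambda>(u, s). B_edge \<Lambda> u s {x, y} powr m) \<and>
           (\<integral>(u, s). cosh (pinned \<Lambda> u x - pinned \<Lambda> u y) powr m \<partial>sigma_measure \<Lambda> \<rho> W)
             \<le> (\<integral>(u, s). B_edge \<Lambda> u s {x, y} powr m \<partial>sigma_measure \<Lambda> \<rho> W) \<and>
           (\<integral>(u, s). B_edge \<Lambda> u s {x, y} powr m \<partial>sigma_measure \<Lambda> \<rho> W) \<le> 1 + \<kappa>)) \<and>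
     (\<gamma> = 0 \<and> \<kappa> = 1 \<longrightarrow>
        Wbar0 \<kappa> \<alpha> \<gamma> =
          max (16 * ln 6) (3 / 2 * exp (sqrt 2 * ((\<alpha> - 1) / (\<alpha> - 3))) * log 2 6))"
proof (intro conjI allI impI)
  fix Wbar N \<Lambda> \<rho> W E' E'' m
  assume "Wbar0 \<kappa> \<alpha> \<gamma> \<le> Wbar" "inhomogeneous_model \<alpha> Wbar N \<Lambda> \<rho> W"
  then interpret inhomogeneous_chain \<kappa> \<alpha> \<gamma> Wbar N \<Lambda> \<rho> W
    using assms by unfold_locales auto
  assume "admissible_edges N E' E''" "\<forall>e\<in>E'. 0 \<le> m e \<and> m e < W e"
    "\<forall>e\<in>E''. 0 \<le> m e \<and> m e \<le> m_vertex \<kappa> \<alpha> \<gamma> Wbar (Min e)"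
  note prem = this
  show "integrable (sigma_measure \<Lambda> \<rho> W)
      (\<lambda>(u, s). (\<Prod>e\<in>E'. B_edge \<Lambda> u s e powr m e) * (\<Prod>e\<in>E''. B_edge \<Lambda> u s e powr m e))"
    "(\<integral>(u, s). (\<Prod>e\<in>E'. B_edge \<Lambda> u s e powr m e) * (\<Prod>e\<in>E''. B_edge \<Lambda> u s e powr m e) \<partial>sigma_measure \<Lambda> \<rho> W)
      \<le> (\<Prod>e\<in>E'. 1 / (1 - m e / W e)) * (1 + \<kappa>) ^ card E''"
    using prem by (auto intro!: sigma_measure_product_bound)
  show "(\<Prod>e\<in>E'. 1 / (1 - m e / W e)) * (1 + \<kappa>) ^ card E'' \<le> (1 + \<kappa>) ^ (card E' + card E'')"
    if "\<forall>e\<in>E'. m e \<le> m_vertex \<kappa> \<alpha> \<gamma> Wbar (Min e)"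
    using prem that by (auto intro!: product_bound_le_power)
next
  fix Wbar N \<Lambda> \<rho> W
  assume "Wbar0 \<kappa> \<alpha> \<gamma> \<le> Wbar" "inhomogeneous_model \<alpha> Wbar N \<Lambda> \<rho> W"
  then interpret inhomogeneous_chain \<kappa> \<alpha> \<gamma> Wbar N \<Lambda> \<rho> W
    using assms by unfold_locales auto
  show "\<forall>x\<in>{1..N}. \<forall>y\<in>{1..N}. \<forall>m.
           x < y \<longrightarrow> 0 \<le> m \<longrightarrow> m \<le> m_vertex \<kappa> \<alpha> \<gamma> Wbar x \<longrightarrow>
           integrable (sigma_measure \<Lambda> \<rho> W)
             (\<lambda>(u, s). cosh (pinned \<Lambda> u x - pinned \<Lambda> u y) powr m) \<and>
           integrable (sigma_measure \<Lambda> \<rho> W) (\<lambda>(u, s). B_edge \<Lambda> u s {x, y} powr m) \<and>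
           (\<integral>(u, s). cosh (pinned \<Lambda> u x - pinned \<Lambda> u y) powr m \<partial>sigma_measure \<Lambda> \<rho> W)
             \<le> (\<integral>(u, s). B_edge \<Lambda> u s {x, y} powr m \<partial>sigma_measure \<Lambda> \<rho> W) \<and>
           (\<integral>(u, s). B_edge \<Lambda> u s {x, y} powr m \<partial>sigma_measure \<Lambda> \<rho> W) \<le> 1 + \<kappa>"
    by (intro ballI allI impI conjI single_edge_bounds)
next
  show "Wbar0 \<kappa> \<alpha> \<gamma> = max (16 * ln 6) (3 / 2 * exp (sqrt 2 * ((\<alpha> - 1) / (\<alpha> - 3))) * log 2 6)"
    if "\<gamma> = 0 \<and> \<kappa> = 1"
    using that Wbar0_special by simp
qed

end
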